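(* Let $(M,g)$ be a compact $n$-dimensional ($n\ge 2$) Riemannian manifold with scalar curvature $s$, and let $${\rm Ric}=\Big(\tfrac12\,{\cal L}_\xi g+\lambda\,g\Big)+\varphi$$ be the orthogonal expansion (with respect to the global scalar product) of the Ricci tensor, for some smooth vector field $\xi$, some function $\lambda\in C^\infty(M)$ and some divergence-free and trace-free symmetric two-tensor $\varphi$. Then: (1) if $n\ge3$, the vector field $\xi$ is an infinitesimal harmonic transformation if and only if $\lambda$ is constant; if $n=2$, the vector field $\xi$ is an infinitesimal harmonic transformation; (2) if $n\ge 3$ and $\int_M({\cal L}_\xi s)\,d\,{\rm vol}_g\ge 0$, then $s$ is constant, $\varphi={\rm Ric}-\frac{s}{n}\,g$, and $\xi$ is a conformal Killing vector field.
   Context: Manifolds are smooth and connected, and compact manifolds are without boundary. $\nabla$ is the Levi-Civita connection, ${\rm Ric}$ the Ricci tensor, $({\cal L}_\xi g)(X,Y)=g(\nabla_X\xi,Y)+g(\nabla_Y\xi,X)$, and ${\cal L}_\xi s=\xi(s)$. The global scalar product of symmetric covariant $p$-tensors is $\langle\varphi,\varphi'\rangle=\int_M g(\varphi,\varphi')\,d\,{\rm vol}_g$. Let $\delta^*$ be the operator from one-forms to symmetric two-tensors given by $\delta^*\theta=\frac12{\cal L}_\xi g$, where $\xi$ is the $g$-dual vector field of $\theta$, and let $\delta$ (divergence) be its formal adjoint, i.e. $\langle\varphi,\delta^*\theta\rangle=\langle\delta\varphi,\theta\rangle$ (so $(\delta\varphi)_j=-\nabla^i\varphi_{ij}$). On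 a compact $(M,g)$ the space $S^2M$ of smooth symmetric two-tensors decomposes as $S^2M=({\rm Im}\,\delta^*+C^\infty(M)\cdot g)\oplus(\delta^{-1}(0)\cap{\rm trace}_g^{-1}(0))$, with the two factors orthogonal with respect to the global scalar product; the orthogonal expansion of ${\rm Ric}$ is its expansion according to this decomposition. A vector field $\xi$ is an infinitesimal harmonic transformation on $(M,g)$ if the local one-parameter group of infinitesimal self-diffeomorphisms generated by $\xi$ is a group of harmonic self-diffeomorphisms; the paper uses this notion through the known characterization that this holds if and only if $\bar\Delta\theta={\rm Ric}(\xi,\cdot)$, where $\theta$ is the $g$-dual one-form of $\xi$ and $\bar\Delta=\nabla^*\nabla$ (in coordinates $\bar\Delta=-\nabla^i\nabla_i$). A vector field $\xi$ is conformal Killing if $\frac12{\cal L}_\xi g=\frac1n({\rm div}\,\xi)\,g$. *)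

theory Defs
  imports "HOL-Analysis.Analysis"
begin

section \<open>Smooth maps between normed spaces\<close>

text \<open>Meaningful for open \<open>S\<close>: \<open>C_diff k S f\<close> says that all iterated directional derivatives of \<open>f\<close>
  of order \<open>< k\<close> are differentiable on \<open>S\<close> and those of order \<open>k\<close> are continuous there.\<close>

primrec C_diff :: "nat \<Rightarrow> 'v::real_normed_vector set \<Rightarrow> ('v \<Rightarrow> 'w::real_normed_vector) \<Rightarrow> bool" where
  "C_diff 0 S f \<longleftrightarrow> continuous_on S f"
| "C_diff (Suc k) S f \<longleftrightarrow> (\<forall>x\<in>S. f differentiable (at x)) \<and>
     (\<forall>v. C_diff k S (\<lambda>x. frechet_derivative f (at x) v))"

definition smooth_on :: "'v::real_normed_vector set \<Rightarrow> ('v \<Rightarrow> 'w::real_normed_vector) \<Rightarrow> bool" where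
  "smooth_on S f \<longleftrightarrow> (\<forall>k. C_diff k S f)"

section \<open>Tensor calculus of a metric on an open set of coordinates\<close>

text \<open>Throughout, \<open>G\<close> is a metric in one coordinate system, \<open>G x $ i $ j = g\<^sub>i\<^sub>j(x)\<close>. For covariant
  derivatives the first index is the direction of differentiation.\<close>

definition pd :: "'n \<Rightarrow> (real^'n::finite \<Rightarrow> real) \<Rightarrow> real^'n \<Rightarrow> real" where
  "pd i f x = frechet_derivative f (at x) (axis i 1)"

definition ginv :: "(real^'n::finite \<Rightarrow> real^'n^'n) \<Rightarrow> 'n \<Rightarrow> 'n \<Rightarrow> real^'n \<Rightarrow> real" where
  "ginv G i j x = matrix_inv (G x) $ i $ j"

text \<open>\<open>christoffel G k i j\<close> is \<open>\<Gamma>\<^sup>k\<^sub>i\<^sub>j\<close> of the Levi-Civita connection.\<close>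

definition christoffel :: "(real^'n::finite \<Rightarrow> real^'n^'n) \<Rightarrow> 'n \<Rightarrow> 'n \<Rightarrow> 'n \<Rightarrow> real^'n \<Rightarrow> real" where
  "christoffel G k i j x = (1/2) * (\<Sum>l\<in>UNIV. ginv G k l x *
     (pd i (\<lambda>y. G y $ j $ l) x + pd j (\<lambda>y. G y $ i $ l) x - pd l (\<lambda>y. G y $ i $ j) x))"

text \<open>\<open>riemann G l k i j\<close> is \<open>R\<^sup>l\<^sub>k\<^sub>i\<^sub>j\<close>, where \<open>R(\<partial>\<^sub>i, \<partial>\<^sub>j)\<partial>\<^sub>k = R\<^sup>l\<^sub>k\<^sub>i\<^sub>j \<partial>\<^sub>l\<close> and
  \<open>R(X,Y) = [\<nabla>\<^sub>X, \<nabla>\<^sub>Y] - \<nabla>\<^sub>[\<^sub>X\<^sub>,\<^sub>Y\<^sub>]\<close>; with the contraction below the round sphere has positive Ricci tensor.\<close>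

definition riemann :: "(real^'n::finite \<Rightarrow> real^'n^'n) \<Rightarrow> 'n \<Rightarrow> 'n \<Rightarrow> 'n \<Rightarrow> 'n \<Rightarrow> real^'n \<Rightarrow> real" where
  "riemann G l k i j x = pd i (christoffel G l j k) x - pd j (christoffel G l i k) x
     + (\<Sum>m\<in>UNIV. christoffel G l i m x * christoffel G m j k x)
     - (\<Sum>m\<in>UNIV. christoffel G l j m x * christoffel G m i k x)"

definition ricci :: "(real^'n::finite \<Rightarrow> real^'n^'n) \<Rightarrow> real^'n \<Rightarrow> real^'n^'n" where
  "ricci G x = (\<chi> j k. \<Sum>i\<in>UNIV. riemann G i k i j x)"

definition metric_trace :: "(real^'n::finite \<Rightarrow> real^'n^'n) \<Rightarrow> (real^'n \<Rightarrow> real^'n^'n) \<Rightarrow> real^'n \<Rightarrow> real" where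
  "metric_trace G T x = (\<Sum>i\<in>UNIV. \<Sum>j\<in>UNIV. ginv G i j x * T x $ i $ j)"

definition scalar :: "(real^'n::finite \<Rightarrow> real^'n^'n) \<Rightarrow> real^'n \<Rightarrow> real" where
  "scalar G = metric_trace G (ricci G)"

definition nabla_vec :: "(real^'n::finite \<Rightarrow> real^'n^'n) \<Rightarrow> (real^'n \<Rightarrow> real^'n) \<Rightarrow> real^'n \<Rightarrow> real^'n^'n" where
  "nabla_vec G X x = (\<chi> i k. pd i (\<lambda>y. X y $ k) x + (\<Sum>a\<in>UNIV. christoffel G k i a x * X x $ a))"

definition nabla_form :: "(real^'n::finite \<Rightarrow> real^'n^'n) \<Rightarrow> (real^'n \<Rightarrow> real^'n) \<Rightarrow> real^'n \<Rightarrow> real^'n^'n" where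
  "nabla_form G \<theta> x = (\<chi> i j. pd i (\<lambda>y. \<theta> y $ j) x - (\<Sum>a\<in>UNIV. christoffel G a i j x * \<theta> x $ a))"

definition nabla_two :: "(real^'n::finite \<Rightarrow> real^'n^'n) \<Rightarrow> (real^'n \<Rightarrow> real^'n^'n) \<Rightarrow> real^'n \<Rightarrow> real^'n^'n^'n" where
  "nabla_two G T x = (\<chi> i j k. pd i (\<lambda>y. T y $ j $ k) x
     - (\<Sum>a\<in>UNIV. christoffel G a i j x * T x $ a $ k)
     - (\<Sum>a\<in>UNIV. christoffel G a i k x * T x $ j $ a))"

definition divergence_vec :: "(real^'n::finite \<Rightarrow> real^'n^'n) \<Rightarrow> (real^'n \<Rightarrow> real^'n) \<Rightarrow> real^'n \<Rightarrow> real" where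
  "divergence_vec G X x = (\<Sum>i\<in>UNIV. nabla_vec G X x $ i $ i)"

text \<open>\<open>(\<L>\<^sub>X g)(\<partial>\<^sub>i, \<partial>\<^sub>j) = g(\<nabla>\<^sub>i X, \<partial>\<^sub>j) + g(\<nabla>\<^sub>j X, \<partial>\<^sub>i)\<close>\<close>

definition lie_metric :: "(real^'n::finite \<Rightarrow> real^'n^'n) \<Rightarrow> (real^'n \<Rightarrow> real^'n) \<Rightarrow> real^'n \<Rightarrow> real^'n^'n" where
  "lie_metric G X x = (\<chi> i j. (\<Sum>k\<in>UNIV. G x $ k $ j * nabla_vec G X x $ i $ k)
                            + (\<Sum>k\<in>UNIV. G x $ k $ i * nabla_vec G X x $ j $ k))"

text \<open>\<open>(\<delta>T)\<^sub>j = - \<nabla>\<^sup>i T\<^sub>i\<^sub>j\<close>\<close>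

definition delta :: "(real^'n::finite \<Rightarrow> real^'n^'n) \<Rightarrow> (real^'n \<Rightarrow> real^'n^'n) \<Rightarrow> real^'n \<Rightarrow> real^'n" where
  "delta G T x = (\<chi> j. - (\<Sum>k\<in>UNIV. \<Sum>i\<in>UNIV. ginv G k i x * nabla_two G T x $ k $ i $ j))"

definition flat :: "(real^'n::finite \<Rightarrow> real^'n^'n) \<Rightarrow> (real^'n \<Rightarrow> real^'n) \<Rightarrow> real^'n \<Rightarrow> real^'n" where
  "flat G X x = (\<chi> i. \<Sum>j\<in>UNIV. G x $ i $ j * X x $ j)"

text \<open>\<open>\<nabla>\<^sup>*\<nabla> = - \<nabla>\<^sup>i \<nabla>\<^sub>i\<close> on one-forms\<close>

definition rough_laplacian :: "(real^'n::finite \<Rightarrow> real^'n^'n) \<Rightarrow> (real^'n \<Rightarrow> real^'n) \<Rightarrow> real^'n \<Rightarrow> real^'n" where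
  "rough_laplacian G \<theta> x =
     (\<chi> k. - (\<Sum>i\<in>UNIV. \<Sum>j\<in>UNIV. ginv G i j x * nabla_two G (nabla_form G \<theta>) x $ i $ j $ k))"

text \<open>The tension field \<open>trace\<^sub>g \<nabla>dF\<close> of a map \<open>F\<close> from \<open>(M,g)\<close> to itself, in coordinates near \<open>x\<close>
  and \<open>F x\<close> belonging to the same chart; \<open>F\<close> is harmonic iff its tension field vanishes.\<close>

definition tension :: "(real^'n::finite \<Rightarrow> real^'n^'n) \<Rightarrow> (real^'n \<Rightarrow> real^'n) \<Rightarrow> real^'n \<Rightarrow> real^'n" where
  "tension G F x = (\<chi> k. \<Sum>i\<in>UNIV. \<Sum>j\<in>UNIV. ginv G i j x *
     (pd i (pd j (\<lambda>y. F y $ k)) x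
      - (\<Sum>l\<in>UNIV. christoffel G l i j x * pd l (\<lambda>y. F y $ k) x)
      + (\<Sum>a\<in>UNIV. \<Sum>b\<in>UNIV. christoffel G k a b (F x) * pd i (\<lambda>y. F y $ a) x * pd j (\<lambda>y. F y $ b) x)))"


section \<open>Manifolds\<close>

text \<open>The underlying topological space is a type; a chart is a pair (domain, coordinate map).\<close>

type_synonym ('a, 'n) chart = "'a set \<times> ('a \<Rightarrow> real^'n)"

abbreviation chart_img :: "('a, 'n) chart \<Rightarrow> (real^'n) set" where
  "chart_img c \<equiv> snd c ` fst c"

abbreviation chart_inv :: "('a, 'n) chart \<Rightarrow> real^'n \<Rightarrow> 'a" where
  "chart_inv c \<equiv> inv_into (fst c) (snd c)"

definition smooth_atlas :: "('a::t2_space, 'n::finite) chart set \<Rightarrow> bool" where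
  "smooth_atlas A \<longleftrightarrow>
     (\<Union>c\<in>A. fst c) = UNIV \<and>
     (\<forall>c\<in>A. open (fst c) \<and> open (chart_img c)
            \<and> homeomorphism (fst c) (chart_img c) (snd c) (chart_inv c)) \<and>
     (\<forall>c\<in>A. \<forall>d\<in>A. smooth_on (snd c ` (fst c \<inter> fst d)) (snd d \<circ> chart_inv c))"

definition jacobian :: "('a, 'n::finite) chart \<Rightarrow> ('a, 'n) chart \<Rightarrow> 'a \<Rightarrow> real^'n \<Rightarrow> real^'n" where
  "jacobian c d p = frechet_derivative (snd d \<circ> chart_inv c) (at (snd c p))"

text \<open>A tensor field is given by its components in every chart of the atlas, as functions of the
  coordinates, subject to the transformation law on overlaps.\<close>

definition smooth_fun :: "('a, 'n::finite) chart set \<Rightarrow> ('a \<Rightarrow> real) \<Rightarrow> bool" where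
  "smooth_fun A f \<longleftrightarrow> (\<forall>c\<in>A. smooth_on (chart_img c) (f \<circ> chart_inv c))"

definition smooth_vector_field ::
  "('a, 'n::finite) chart set \<Rightarrow> (('a, 'n) chart \<Rightarrow> real^'n \<Rightarrow> real^'n) \<Rightarrow> bool" where
  "smooth_vector_field A X \<longleftrightarrow>
     (\<forall>c\<in>A. smooth_on (chart_img c) (X c)) \<and>
     (\<forall>c\<in>A. \<forall>d\<in>A. \<forall>p\<in>fst c \<inter> fst d. X d (snd d p) = jacobian c d p (X c (snd c p)))"

definition smooth_sym_tensor ::
  "('a, 'n::finite) chart set \<Rightarrow> (('a, 'n) chart \<Rightarrow> real^'n \<Rightarrow> real^'n^'n) \<Rightarrow> bool" where
  "smooth_sym_tensor A T \<longleftrightarrow>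
     (\<forall>c\<in>A. smooth_on (chart_img c) (T c)) \<and>
     (\<forall>c\<in>A. \<forall>x\<in>chart_img c. \<forall>i j. T c x $ i $ j = T c x $ j $ i) \<and>
     (\<forall>c\<in>A. \<forall>d\<in>A. \<forall>p\<in>fst c \<inter> fst d. \<forall>v w.
        v \<bullet> (T c (snd c p) *v w) = jacobian c d p v \<bullet> (T d (snd d p) *v jacobian c d p w))"

definition riemannian_metric ::
  "('a, 'n::finite) chart set \<Rightarrow> (('a, 'n) chart \<Rightarrow> real^'n \<Rightarrow> real^'n^'n) \<Rightarrow> bool" where
  "riemannian_metric A g \<longleftrightarrow> smooth_sym_tensor A g \<and>
     (\<forall>c\<in>A. \<forall>x\<in>chart_img c. \<forall>v. v \<noteq> 0 \<longrightarrow> 0 < v \<bullet> (g c x *v v))"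

text \<open>The function on the manifold whose coordinate expressions are \<open>h c\<close>. It is only used for scalar
  invariants, for which the choice of the chart around \<open>p\<close> is immaterial.\<close>

definition glue :: "('a, 'n) chart set \<Rightarrow> (('a, 'n) chart \<Rightarrow> real^'n \<Rightarrow> real) \<Rightarrow> 'a \<Rightarrow> real" where
  "glue A h p = (let c = (SOME c. c \<in> A \<and> p \<in> fst c) in h c (snd c p))"

definition scalar_curvature ::
  "('a, 'n::finite) chart set \<Rightarrow> (('a, 'n) chart \<Rightarrow> real^'n \<Rightarrow> real^'n^'n) \<Rightarrow> 'a \<Rightarrow> real" where
  "scalar_curvature A g = glue A (\<lambda>c. scalar (g c))"

definition lie_fun ::
  "('a, 'n::finite) chart set \<Rightarrow> (('a, 'n) chart \<Rightarrow> real^'n \<Rightarrow> real^'n) \<Rightarrow> ('a \<Rightarrow> real) \<Rightarrow> 'a \<Rightarrow> real" where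
  "lie_fun A X f = glue A (\<lambda>c x. frechet_derivative (f \<circ> chart_inv c) (at x) (X c x))"

text \<open>The Riemannian measure: the unique Borel measure with density \<open>sqrt (det g\<^sub>i\<^sub>j)\<close> in every chart.\<close>

definition is_riemannian_measure ::
  "('a::t2_space, 'n::finite) chart set \<Rightarrow> (('a, 'n) chart \<Rightarrow> real^'n \<Rightarrow> real^'n^'n) \<Rightarrow> 'a measure \<Rightarrow> bool" where
  "is_riemannian_measure A g \<mu> \<longleftrightarrow> sets \<mu> = sets borel \<and>
     (\<forall>c\<in>A. \<forall>B\<in>sets borel. B \<subseteq> fst c \<longrightarrow>
        emeasure \<mu> B = (\<integral>\<^sup>+x\<in>snd c ` B. ennreal (sqrt (det (g c x))) \<partial>lborel))"

definition vol ::
  "('a::t2_space, 'n::finite) chart set \<Rightarrow> (('a, 'n) chart \<Rightarrow> real^'n \<Rightarrow> real^'n^'n) \<Rightarrow> 'a measure" where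
  "vol A g = (THE \<mu>. is_riemannian_measure A g \<mu>)"

definition tt_tensor ::
  "('a, 'n::finite) chart set \<Rightarrow> (('a, 'n) chart \<Rightarrow> real^'n \<Rightarrow> real^'n^'n)
     \<Rightarrow> (('a, 'n) chart \<Rightarrow> real^'n \<Rightarrow> real^'n^'n) \<Rightarrow> bool" where
  "tt_tensor A g T \<longleftrightarrow> smooth_sym_tensor A T \<and>
     (\<forall>c\<in>A. \<forall>x\<in>chart_img c. delta (g c) (T c) x = 0 \<and> metric_trace (g c) (T c) x = 0)"

text \<open>The orthogonal expansion of the Ricci tensor with respect to
  \<open>S\<^sup>2M = (Im \<delta>\<^sup>* + C\<^sup>\<infinity>(M) g) \<oplus> (\<delta>\<^sup>-\<^sup>1(0) \<inter> trace\<^sup>-\<^sup>1(0))\<close>. Orthogonality of the two parts is a consequence of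
  their membership in these spaces.\<close>

definition ricci_expansion ::
  "('a, 'n::finite) chart set \<Rightarrow> (('a, 'n) chart \<Rightarrow> real^'n \<Rightarrow> real^'n^'n)
     \<Rightarrow> (('a, 'n) chart \<Rightarrow> real^'n \<Rightarrow> real^'n) \<Rightarrow> ('a \<Rightarrow> real)
     \<Rightarrow> (('a, 'n) chart \<Rightarrow> real^'n \<Rightarrow> real^'n^'n) \<Rightarrow> bool" where
  "ricci_expansion A g \<xi> l \<phi> \<longleftrightarrow>
     smooth_vector_field A \<xi> \<and> smooth_fun A l \<and> tt_tensor A g \<phi> \<and>
     (\<forall>c\<in>A. \<forall>x\<in>chart_img c.
        ricci (g c) x = ((1/2) *\<^sub>R lie_metric (g c) (\<xi> c) x + l (chart_inv c x) *\<^sub>R g c x) + \<phi> c x)"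

text \<open>The infinitesimal self-diffeomorphisms generated by \<open>\<xi>\<close> are \<open>y \<mapsto> y + t \<xi>(y)\<close> in coordinates, with
  terms of order \<open>t\<^sup>2\<close> neglected; they are harmonic if their tension field vanishes to first order in \<open>t\<close>.
  (As the identity is harmonic, neither the choice of the chart nor the replacement of
  \<open>y + t \<xi>(y)\<close> by the flow of \<open>\<xi>\<close> affects the derivative at \<open>t = 0\<close>.) Lemma
  \<open>infinitesimal_harmonic_iff\<close> below is the characterization by \<open>\<nabla>\<^sup>*\<nabla>\<theta> = Ric(\<xi>, \<cdot>)\<close>.\<close>

definition infinitesimal_harmonic ::
  "('a, 'n::finite) chart set \<Rightarrow> (('a, 'n) chart \<Rightarrow> real^'n \<Rightarrow> real^'n^'n)
     \<Rightarrow> (('a, 'n) chart \<Rightarrow> real^'n \<Rightarrow> real^'n) \<Rightarrow> bool" where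
  "infinitesimal_harmonic A g \<xi> \<longleftrightarrow> (\<forall>c\<in>A. \<forall>x\<in>chart_img c.
     ((\<lambda>t. tension (g c) (\<lambda>y. y + t *\<^sub>R \<xi> c y) x) has_vector_derivative 0) (at 0))"

definition conformal_killing ::
  "('a, 'n::finite) chart set \<Rightarrow> (('a, 'n) chart \<Rightarrow> real^'n \<Rightarrow> real^'n^'n)
     \<Rightarrow> (('a, 'n) chart \<Rightarrow> real^'n \<Rightarrow> real^'n) \<Rightarrow> bool" where
  "conformal_killing A g \<xi> \<longleftrightarrow> (\<forall>c\<in>A. \<forall>x\<in>chart_img c.
     (1/2) *\<^sub>R lie_metric (g c) (\<xi> c) x =
       (1 / real CARD('n) * divergence_vec (g c) (\<xi> c) x) *\<^sub>R g c x)"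

section \<open>The equation of infinitesimal harmonic transformations\<close>

lemma C_diff_cong:
  assumes "open S" "\<And>x. x \<in> S \<Longrightarrow> f x = g x" "C_diff k S f"
  shows "C_diff k S g"
  using assms(2,3)
proof (induction k arbitrary: f g)
  case 0 then show ?case by (simp cong: continuous_on_cong)
next
  case (Suc k)
  have fr: "frechet_derivative f (at x) = frechet_derivative g (at x)" and d: "g differentiable (at x)" if "x \<in> S" for x
  proof -
    have f: "f differentiable (at x)" using Suc.prems that by simp
    show "frechet_derivative f (at x) = frechet_derivative g (at x)"
      using f assms(1) that Suc.prems(1) by (rule frechet_derivative_transform_within_open)
    from f show "g differentiable (at x)"
      unfolding differentiable_def by (metis has_derivative_transform_within_open[OF _ assms(1) that] Suc.prems(1))
  qed
  have "C_diff k S (\<lambda>x. frechet_derivative g (at x) v)" for v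
    by (rule Suc.IH[of "\<lambda>x. frechet_derivative f (at x) v"]) (use Suc.prems fr in auto)
  then show ?case using d by simp
qed

lemma C_diff_linear:
  assumes "open S" "bounded_linear h" "C_diff k S f"
  shows "C_diff k S (\<lambda>x. h (f x))"
  using assms(3)
proof (induction k arbitrary: f)
  case 0 then show ?case using assms(2) by (simp add: bounded_linear.continuous_on)
next
  case (Suc k)
  have der: "((\<lambda>x. h (f x)) has_derivative (\<lambda>v. h (frechet_derivative f (at x) v))) (at x)" if "x \<in> S" for x
    using Suc.prems that by (intro bounded_linear.has_derivative[OF assms(2)]) (simp add: frechet_derivative_works[symmetric])
  then have fr: "frechet_derivative (\<lambda>x. h (f x)) (at x) = (\<lambda>v. h (frechet_derivative f (at x) v))" if "x \<in> S" for x
    using that by (metis frechet_derivative_at)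
  have "C_diff k S (\<lambda>x. frechet_derivative (\<lambda>x. h (f x)) (at x) v)" for v
    by (rule C_diff_cong[OF assms(1), of "\<lambda>x. h (frechet_derivative f (at x) v)"])
       (use fr Suc in auto)
  then show ?case using der by (auto simp: differentiable_def)
qed

lemma smooth_on_comp_nth: "open S \<Longrightarrow> smooth_on S f \<Longrightarrow> smooth_on S (\<lambda>x. f x $ i)"
  unfolding smooth_on_def by (auto intro: C_diff_linear[OF _ bounded_linear_vec_nth])

lemma smooth_on_D: "smooth_on S f \<Longrightarrow> x \<in> S \<Longrightarrow> f differentiable (at x)"
  unfolding smooth_on_def by (metis C_diff.simps(2))

lemma smooth_on_fd: "smooth_on S f \<Longrightarrow> smooth_on S (\<lambda>x. frechet_derivative f (at x) v)"
  unfolding smooth_on_def by (metis C_diff.simps(2))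

lemma smooth_on_pd: "smooth_on S f \<Longrightarrow> smooth_on S (pd i f)"
  unfolding pd_def by (rule smooth_on_fd)

lemma smooth_on_cont: "smooth_on S f \<Longrightarrow> continuous_on S f"
  unfolding smooth_on_def by (metis C_diff.simps(1))

lemma frechet_derivative_worksI: "f differentiable F \<Longrightarrow> (f has_derivative frechet_derivative f F) F"
  by (simp add: frechet_derivative_works)

lemma pd_eqI: "(f has_derivative f') (at x) \<Longrightarrow> pd i f x = f' (axis i 1)"
  unfolding pd_def by (metis frechet_derivative_at)

lemma pd_has_derivative:
  "f differentiable (at x) \<Longrightarrow> (f has_derivative (\<lambda>v. \<Sum>i\<in>UNIV. v $ i * pd i f x)) (at x)"
proof -
  assume f: "f differentiable (at x)"
  then have D: "(f has_derivative frechet_derivative f (at x)) (at x)" by (simp add: frechet_derivative_works)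
  have L: "linear (frechet_derivative f (at x))" by (rule linear_frechet_derivative[OF f])
  have "frechet_derivative f (at x) v = (\<Sum>i\<in>UNIV. v $ i * pd i f x)" for v
  proof -
    have "frechet_derivative f (at x) v = frechet_derivative f (at x) (\<Sum>i\<in>UNIV. v $ i *s axis i 1)"
      by (simp add: basis_expansion)
    also have "\<dots> = (\<Sum>i\<in>UNIV. v $ i * pd i f x)"
      by (simp add: linear_sum[OF L] scalar_mult_eq_scaleR linear_scale[OF L] pd_def)
    finally show ?thesis .
  qed
  then show ?thesis using D by (metis (no_types, lifting) ext)
qed

lemma pd_add: "f differentiable (at x) \<Longrightarrow> g differentiable (at x) \<Longrightarrow> pd i (\<lambda>y. f y + g y) x = pd i f x + pd i g x"
  by (subst pd_eqI[OF has_derivative_add]) (auto simp: frechet_derivative_works[symmetric] pd_def)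

lemma pd_diff: "f differentiable (at x) \<Longrightarrow> g differentiable (at x) \<Longrightarrow> pd i (\<lambda>y. f y - g y) x = pd i f x - pd i g x"
  by (subst pd_eqI[OF has_derivative_diff]) (auto simp: frechet_derivative_works[symmetric] pd_def)

lemma pd_mult: "f differentiable (at x) \<Longrightarrow> g differentiable (at x) \<Longrightarrow>
   pd i (\<lambda>y. f y * g y) x = pd i f x * g x + f x * pd i g x"
  by (simp add: pd_eqI[OF has_derivative_mult[OF frechet_derivative_worksI frechet_derivative_worksI]]) (simp add: pd_def)

lemma pd_sum: "(\<And>a. a \<in> I \<Longrightarrow> f a differentiable (at x)) \<Longrightarrow> pd i (\<lambda>y. \<Sum>a\<in>I. f a y) x = (\<Sum>a\<in>I. pd i (f a) x)"
  by (subst pd_eqI[OF has_derivative_sum]) (auto simp: frechet_derivative_works[symmetric] pd_def)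

lemma pd_const [simp]: "pd i (\<lambda>y. c) x = 0"
  by (simp add: pd_def)

lemma pd_cong:
  assumes "open S" "x \<in> S" "f differentiable (at x)" "\<And>y. y \<in> S \<Longrightarrow> f y = g y"
  shows "pd i f x = pd i g x"
  unfolding pd_def using frechet_derivative_transform_within_open[OF assms(3,1,2)] assms(4) by simp

lemma differentiable_cong:
  assumes "open S" "x \<in> S" "f differentiable (at x)" "\<And>y. y \<in> S \<Longrightarrow> f y = g y"
  shows "g differentiable (at x)"
  using assms unfolding differentiable_def by (metis has_derivative_transform_within_open)

text \<open>Symmetry of second derivatives\<close>

lemma second_difference:
  fixes f :: "'v::real_normed_vector \<Rightarrow> real"
  assumes "smooth_on S f" "open S" "ball x r \<subseteq> S" "e > 0" "e * norm u + e * norm v < r"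
  shows "\<exists>p\<in>ball x r. f (x + e *\<^sub>R u + e *\<^sub>R v) - f (x + e *\<^sub>R u) - f (x + e *\<^sub>R v) + f x
      = e * e * frechet_derivative (\<lambda>y. frechet_derivative f (at y) u) (at p) v"
proof -
  let ?D = "\<lambda>y. frechet_derivative f (at y) u"
  have inb: "x + s *\<^sub>R u + t *\<^sub>R v \<in> ball x r" if "0 \<le> s" "s \<le> e" "0 \<le> t" "t \<le> e" for s t
  proof -
    have "norm (s *\<^sub>R u + t *\<^sub>R v) \<le> s * norm u + t * norm v"
      using norm_triangle_ineq[of "s *\<^sub>R u" "t *\<^sub>R v"] that by simp
    also have "\<dots> \<le> e * norm u + e * norm v" using that by (intro add_mono mult_right_mono) auto
    finally have "norm (s *\<^sub>R u + t *\<^sub>R v) < r" using assms(5) by simp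
    then show ?thesis by (simp add: dist_norm algebra_simps norm_minus_commute)
  qed
  have fd: "((\<lambda>s. f (x + s *\<^sub>R u + t *\<^sub>R v)) has_real_derivative ?D (x + s *\<^sub>R u + t *\<^sub>R v)) (at s)"
    if "0 \<le> s" "s \<le> e" "0 \<le> t" "t \<le> e" for s t
  proof -
    let ?y = "x + s *\<^sub>R u + t *\<^sub>R v"
    have d: "f differentiable (at ?y)" using smooth_on_D[OF assms(1)] inb[OF that] assms(3) by blast
    have "((\<lambda>s. x + s *\<^sub>R u + t *\<^sub>R v) has_derivative (\<lambda>h. h *\<^sub>R u)) (at s)"
      by (auto intro!: derivative_eq_intros)
    from has_derivative_compose[OF this] d
    have "((\<lambda>s. f (x + s *\<^sub>R u + t *\<^sub>R v)) has_derivative (\<lambda>h. frechet_derivative f (at ?y) (h *\<^sub>R u))) (at s)"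
      by (simp add: frechet_derivative_works)
    then show ?thesis
      by (simp add: has_field_derivative_def linear_scale[OF linear_frechet_derivative[OF d]] mult.commute[of _ "frechet_derivative f (at ?y) u"] has_derivative_eq_rhs)
  qed
  have "\<exists>s>0. s < e \<and> (f (x + e *\<^sub>R u + e *\<^sub>R v) - f (x + e *\<^sub>R u + 0 *\<^sub>R v)) - (f (x + 0 *\<^sub>R u + e *\<^sub>R v) - f (x + 0 *\<^sub>R u + 0 *\<^sub>R v))
      = (e - 0) * (?D (x + s *\<^sub>R u + e *\<^sub>R v) - ?D (x + s *\<^sub>R u + 0 *\<^sub>R v))"
    by (rule MVT2[where f = "\<lambda>s. f (x + s *\<^sub>R u + e *\<^sub>R v) - f (x + s *\<^sub>R u + 0 *\<^sub>R v)"])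
       (use assms(4) fd[where t = 0] in \<open>auto intro!: DERIV_diff fd\<close>)
  then obtain s where s: "0 < s" "s < e" and eq1: "f (x + e *\<^sub>R u + e *\<^sub>R v) - f (x + e *\<^sub>R u) - f (x + e *\<^sub>R v) + f x
      = e * (?D (x + s *\<^sub>R u + e *\<^sub>R v) - ?D (x + s *\<^sub>R u + 0 *\<^sub>R v))" by auto
  have fd2: "((\<lambda>t. ?D (x + s *\<^sub>R u + t *\<^sub>R v)) has_real_derivative frechet_derivative ?D (at (x + s *\<^sub>R u + t *\<^sub>R v)) v) (at t)"
    if "0 \<le> t" "t \<le> e" for t
  proof -
    let ?y = "x + s *\<^sub>R u + t *\<^sub>R v"
    have d: "?D differentiable (at ?y)"
      using smooth_on_D[OF smooth_on_fd[OF assms(1)]] inb[of s t] that s assms(3) by auto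
    have "((\<lambda>t. x + s *\<^sub>R u + t *\<^sub>R v) has_derivative (\<lambda>h. h *\<^sub>R v)) (at t)"
      by (auto intro!: derivative_eq_intros)
    from has_derivative_compose[OF this] d
    have "((\<lambda>t. ?D (x + s *\<^sub>R u + t *\<^sub>R v)) has_derivative (\<lambda>h. frechet_derivative ?D (at ?y) (h *\<^sub>R v))) (at t)"
      by (simp add: frechet_derivative_works)
    then show ?thesis
      by (simp add: has_field_derivative_def linear_scale[OF linear_frechet_derivative[OF d]] mult.commute[of _ "frechet_derivative ?D (at ?y) v"] has_derivative_eq_rhs)
  qed
  have "\<exists>t>0. t < e \<and> ?D (x + s *\<^sub>R u + e *\<^sub>R v) - ?D (x + s *\<^sub>R u + 0 *\<^sub>R v)
      = (e - 0) * frechet_derivative ?D (at (x + s *\<^sub>R u + t *\<^sub>R v)) v"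
    by (rule MVT2) (use assms(4) in \<open>auto intro!: fd2\<close>)
  then obtain t where t: "0 < t" "t < e" and eq2: "?D (x + s *\<^sub>R u + e *\<^sub>R v) - ?D (x + s *\<^sub>R u + 0 *\<^sub>R v)
      = e * frechet_derivative ?D (at (x + s *\<^sub>R u + t *\<^sub>R v)) v" by auto
  show ?thesis
    using inb[of s t] s t eq1 eq2 by (intro bexI[of _ "x + s *\<^sub>R u + t *\<^sub>R v"]) auto
qed

lemma second_derivative_symmetric:
  fixes f :: "'v::real_normed_vector \<Rightarrow> real"
  assumes "smooth_on S f" "open S" "x \<in> S"
  shows "frechet_derivative (\<lambda>y. frechet_derivative f (at y) u) (at x) v
       = frechet_derivative (\<lambda>y. frechet_derivative f (at y) v) (at x) u" (is "?A x = ?B x")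
proof (rule ccontr)
  assume ne: "?A x \<noteq> ?B x"
  define \<epsilon> where "\<epsilon> = \<bar>?A x - ?B x\<bar> / 2"
  have \<epsilon>: "\<epsilon> > 0" using ne by (simp add: \<epsilon>_def)
  have cA: "continuous_on S ?A" and cB: "continuous_on S ?B"
    by (intro smooth_on_cont smooth_on_fd assms(1))+
  obtain r1 where r1: "r1 > 0" "\<And>y. y \<in> S \<Longrightarrow> dist y x < r1 \<Longrightarrow> dist (?A y) (?A x) < \<epsilon>"
    using cA assms(3) \<epsilon> unfolding continuous_on_iff by meson
  obtain r2 where r2: "r2 > 0" "\<And>y. y \<in> S \<Longrightarrow> dist y x < r2 \<Longrightarrow> dist (?B y) (?B x) < \<epsilon>"
    using cB assms(3) \<epsilon> unfolding continuous_on_iff by meson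
  obtain r3 where r3: "r3 > 0" "ball x r3 \<subseteq> S" using assms(2,3) open_contains_ball by blast
  define r where "r = min r1 (min r2 r3)"
  have r: "r > 0" "ball x r \<subseteq> S" using r1 r2 r3 by (auto simp: r_def)
  define e where "e = r / (2 * (norm u + norm v + 1))"
  have pos: "norm u + norm v + 1 > 0" by (simp add: add_nonneg_pos)
  have e: "e > 0" using r pos by (simp add: e_def)
  have "e * (norm u + norm v + 1) = r / 2" using pos by (simp add: e_def field_simps)
  then have small: "e * norm u + e * norm v < r" using r e by (simp add: algebra_simps)
  obtain p where p: "p \<in> ball x r" "f (x + e *\<^sub>R u + e *\<^sub>R v) - f (x + e *\<^sub>R u) - f (x + e *\<^sub>R v) + f x = e * e * ?A p"
    using second_difference[OF assms(1,2) r(2) e small] by blast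
  obtain q where q: "q \<in> ball x r" "f (x + e *\<^sub>R v + e *\<^sub>R u) - f (x + e *\<^sub>R v) - f (x + e *\<^sub>R u) + f x = e * e * ?B q"
    using second_difference[OF assms(1,2) r(2) e, of v u] small by (auto simp: add.commute)
  have "e * e * ?A p = e * e * ?B q"
    unfolding p(2)[symmetric] q(2)[symmetric] by (simp add: algebra_simps)
  then have "?A p = ?B q" using e by simp
  moreover have "dist (?A p) (?A x) < \<epsilon>" using p(1) r by (intro r1) (auto simp: r_def dist_commute)
  moreover have "dist (?B q) (?B x) < \<epsilon>" using q(1) r by (intro r2) (auto simp: r_def dist_commute)
  ultimately show False unfolding \<epsilon>_def dist_real_def by (simp add: field_simps abs_if split: if_splits)
qed

lemma pd_commute: "smooth_on S f \<Longrightarrow> open S \<Longrightarrow> x \<in> S \<Longrightarrow> pd i (pd j f) x = pd j (pd i f) x"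
  unfolding pd_def using second_derivative_symmetric[of S f x "axis j 1" "axis i 1"] by simp

context
  fixes G :: "real^'n::finite \<Rightarrow> real^'n^'n" and V :: "(real^'n) set"
  assumes V: "open V" and Gs: "smooth_on V G"
    and sym: "\<And>x i j. x \<in> V \<Longrightarrow> G x $ i $ j = G x $ j $ i"
    and pos: "\<And>x v. x \<in> V \<Longrightarrow> v \<noteq> 0 \<Longrightarrow> 0 < v \<bullet> (G x *v v)"
begin

lemma G_smooth: "smooth_on V (\<lambda>y. G y $ i $ j)"
  using smooth_on_comp_nth[OF V smooth_on_comp_nth[OF V Gs]] .

lemma G_diff: "x \<in> V \<Longrightarrow> (\<lambda>y. G y $ i $ j) differentiable (at x)"
  by (rule smooth_on_D[OF G_smooth])

lemma dG_diff: "x \<in> V \<Longrightarrow> pd k (\<lambda>y. G y $ i $ j) differentiable (at x)"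
  by (rule smooth_on_D[OF smooth_on_pd[OF G_smooth]])

lemma G_inv: assumes "x \<in> V" shows "invertible (G x)"
proof -
  have "v = 0" if "G x *v v = 0" for v
    using pos[OF assms, of v] that by auto
  then show ?thesis
    using invertible_left_inverse matrix_left_invertible_ker by blast
qed

lemma matrix_inv_props:
  assumes "x \<in> V" shows "G x ** matrix_inv (G x) = mat 1" "matrix_inv (G x) ** G x = mat 1"
  using someI_ex[OF G_inv[OF assms, unfolded invertible_def]] unfolding matrix_inv_def by auto

lemma ginv_G: assumes "x \<in> V" shows "(\<Sum>a\<in>UNIV. ginv G i a x * G x $ a $ j) = (if i = j then 1 else 0)"
  using arg_cong[OF matrix_inv_props(2)[OF assms], of "\<lambda>M. M $ i $ j"]
  by (simp add: ginv_def matrix_matrix_mult_def mat_def)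

lemma G_ginv: assumes "x \<in> V" shows "(\<Sum>a\<in>UNIV. G x $ i $ a * ginv G a j x) = (if i = j then 1 else 0)"
  using arg_cong[OF matrix_inv_props(1)[OF assms], of "\<lambda>M. M $ i $ j"]
  by (simp add: ginv_def matrix_matrix_mult_def mat_def)

lemma ginv_sym: assumes "x \<in> V" shows "ginv G i j x = ginv G j i x"
proof -
  let ?B = "matrix_inv (G x)"
  have G: "transpose (G x) = G x" using sym[OF assms] by (simp add: transpose_def vec_eq_iff)
  have "transpose ?B = transpose ?B ** (G x ** ?B)" by (simp add: matrix_inv_props[OF assms])
  also have "\<dots> = transpose (G x ** ?B) ** ?B" by (simp add: matrix_transpose_mul G matrix_mul_assoc)
  also have "\<dots> = ?B" by (simp add: matrix_inv_props[OF assms])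
  finally have "transpose ?B = ?B" .
  then have "transpose ?B $ j $ i = ?B $ j $ i" by simp
  then show ?thesis by (simp add: ginv_def transpose_def)
qed

lemma differentiable_prod':
  "finite I \<Longrightarrow> (\<And>i. i \<in> I \<Longrightarrow> (f i :: 'v::real_normed_vector \<Rightarrow> real) differentiable (at x)) \<Longrightarrow> (\<lambda>y. \<Prod>i\<in>I. f i y) differentiable (at x)"
  by (induction rule: finite_induct) auto

lemma det_differentiable:
  assumes "\<And>i j. (\<lambda>y. F y $ i $ j) differentiable (at x)"
  shows "(\<lambda>y. det (F y :: real^'m::finite^'m)) differentiable (at x)"
  unfolding det_def
  by (intro differentiable_sum differentiable_mult differentiable_const differentiable_prod' ballI)
     (auto simp: assms finite_permutations)

lemma ginv_diff: assumes "x \<in> V" shows "ginv G i j differentiable (at x)"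
proof -
  let ?M = "\<lambda>y. \<chi> r s. if s = i then axis j 1 $ r else G y $ r $ s"
  have eq: "det (?M y) / det (G y) = ginv G i j y" if "y \<in> V" for y
  proof -
    have d: "det (G y) \<noteq> 0" using G_inv[OF that] by (simp add: invertible_det_nz)
    have "G y *v (matrix_inv (G y) *v axis j 1) = axis j 1"
      by (simp add: matrix_vector_mul_assoc matrix_inv_props[OF that])
    then have "(matrix_inv (G y) *v axis j 1) $ i = det (?M y) / det (G y)"
      unfolding cramer[OF d] by simp
    moreover have "(matrix_inv (G y) *v axis j 1) $ i = ginv G i j y"
      by (simp add: matrix_vector_mult_def axis_def ginv_def if_distrib cong: if_cong)
    ultimately show ?thesis by simp
  qed
  have "(\<lambda>y. det (?M y) / det (G y)) differentiable (at x)"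
  proof (intro differentiable_divide det_differentiable)
    show "(\<lambda>y. ?M y $ r $ s) differentiable (at x)" for r s
      using G_diff[OF assms] by (cases "s = i") auto
  qed (use G_diff[OF assms] G_inv[OF assms] in \<open>auto simp: invertible_det_nz\<close>)
  then show ?thesis by (rule differentiable_cong[OF V assms]) (rule eq)
qed

lemma chr_diff: assumes "x \<in> V" shows "christoffel G k i j differentiable (at x)"
  unfolding christoffel_def[abs_def]
  by (rule differentiable_mult[OF differentiable_const])
     (use assms in \<open>auto intro!: ginv_diff dG_diff differentiable_mult differentiable_sum differentiable_add differentiable_diff\<close>)

lemma chr_sym: assumes "x \<in> V" shows "christoffel G k i j x = christoffel G k j i x"
proof -
  have "pd l (\<lambda>y. G y $ i $ j) x = pd l (\<lambda>y. G y $ j $ i) x" for l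
    by (rule pd_cong[OF V assms G_diff[OF assms]]) (rule sym)
  then show ?thesis by (simp add: christoffel_def add.commute)
qed

lemma chr_lower: assumes "x \<in> V"
  shows "(\<Sum>k\<in>UNIV. G x $ m $ k * christoffel G k i j x) = 
    (1/2) * (pd i (\<lambda>y. G y $ j $ m) x + pd j (\<lambda>y. G y $ i $ m) x - pd m (\<lambda>y. G y $ i $ j) x)"
proof -
  let ?c = "\<lambda>l. pd i (\<lambda>y. G y $ j $ l) x + pd j (\<lambda>y. G y $ i $ l) x - pd l (\<lambda>y. G y $ i $ j) x"
  have "(\<Sum>k\<in>UNIV. G x $ m $ k * christoffel G k i j x) = (\<Sum>k\<in>UNIV. \<Sum>l\<in>UNIV. (1/2) * (G x $ m $ k * ginv G k l x) * ?c l)"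
    by (simp add: christoffel_def sum_distrib_left sum_divide_distrib algebra_simps)
  also have "\<dots> = (\<Sum>l\<in>UNIV. (1/2) * (\<Sum>k\<in>UNIV. G x $ m $ k * ginv G k l x) * ?c l)"
    by (subst sum.swap) (simp add: sum_distrib_left sum_distrib_right)
  also have "\<dots> = (1/2) * ?c m"
    by (simp add: G_ginv[OF assms] if_distrib if_distribR cong: if_cong)
  finally show ?thesis .
qed

text \<open>The Levi-Civita connection is metric.\<close>

lemma metric_compat: assumes "x \<in> V"
  shows "pd i (\<lambda>y. G y $ j $ k) x =
    (\<Sum>a\<in>UNIV. christoffel G a i j x * G x $ a $ k) + (\<Sum>a\<in>UNIV. christoffel G a i k x * G x $ j $ a)"
proof -
  have s: "pd l (\<lambda>y. G y $ a $ b) x = pd l (\<lambda>y. G y $ b $ a) x" for l a b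
    by (rule pd_cong[OF V assms G_diff[OF assms]]) (rule sym)
  have "(\<Sum>a\<in>UNIV. christoffel G a i j x * G x $ a $ k) = (\<Sum>a\<in>UNIV. G x $ k $ a * christoffel G a i j x)"
    by (simp add: sym[OF assms, of k] mult.commute)
  moreover have "(\<Sum>a\<in>UNIV. christoffel G a i k x * G x $ j $ a) = (\<Sum>a\<in>UNIV. G x $ j $ a * christoffel G a i k x)"
    by (simp add: mult.commute)
  ultimately show ?thesis
    unfolding chr_lower[OF assms] s[of i k j] by (simp add: field_simps)
qed

lemma riemann_antisym: assumes x: "x \<in> V"
  shows "(\<Sum>a\<in>UNIV. G x $ p $ a * riemann G a k i j x) = - (\<Sum>a\<in>UNIV. G x $ k $ a * riemann G a p i j x)"
proof -
  let ?\<Gamma> = "\<lambda>a i j. christoffel G a i j x" and ?g = "\<lambda>i j. G x $ i $ j"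
  have second: "pd m (pd i (\<lambda>y. G y $ k $ p)) x =
     (\<Sum>a\<in>UNIV. pd m (christoffel G a i k) x * ?g a p + pd m (christoffel G a i p) x * ?g k a)
     + (\<Sum>a\<in>UNIV. \<Sum>b\<in>UNIV. ?\<Gamma> a i k * ?\<Gamma> b m a * ?g b p + ?\<Gamma> a i p * ?\<Gamma> b m a * ?g k b)
     + (\<Sum>a\<in>UNIV. \<Sum>b\<in>UNIV. ?\<Gamma> a i k * ?\<Gamma> b m p * ?g a b + ?\<Gamma> a i p * ?\<Gamma> b m k * ?g b a)" for m i
  proof -
    have "pd m (pd i (\<lambda>y. G y $ k $ p)) x = pd m (\<lambda>y. (\<Sum>a\<in>UNIV. christoffel G a i k y * G y $ a $ p) + (\<Sum>a\<in>UNIV. christoffel G a i p y * G y $ k $ a)) x"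
      by (rule pd_cong[OF V x dG_diff[OF x]]) (rule metric_compat)
    also have "\<dots> = (\<Sum>a\<in>UNIV. pd m (christoffel G a i k) x * ?g a p + ?\<Gamma> a i k * pd m (\<lambda>y. G y $ a $ p) x)
                  + (\<Sum>a\<in>UNIV. pd m (christoffel G a i p) x * ?g k a + ?\<Gamma> a i p * pd m (\<lambda>y. G y $ k $ a) x)"
      using x by (simp add: pd_add pd_sum pd_mult chr_diff G_diff differentiable_mult differentiable_sum)
    also have "\<dots> = (\<Sum>a\<in>UNIV. pd m (christoffel G a i k) x * ?g a p + pd m (christoffel G a i p) x * ?g k a)
                  + (\<Sum>a\<in>UNIV. ?\<Gamma> a i k * pd m (\<lambda>y. G y $ a $ p) x + ?\<Gamma> a i p * pd m (\<lambda>y. G y $ k $ a) x)"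
      by (simp add: sum.distrib)
    also have "(\<Sum>a\<in>UNIV. ?\<Gamma> a i k * pd m (\<lambda>y. G y $ a $ p) x + ?\<Gamma> a i p * pd m (\<lambda>y. G y $ k $ a) x)
       = (\<Sum>a\<in>UNIV. \<Sum>b\<in>UNIV. ?\<Gamma> a i k * ?\<Gamma> b m a * ?g b p + ?\<Gamma> a i p * ?\<Gamma> b m a * ?g k b)
       + (\<Sum>a\<in>UNIV. \<Sum>b\<in>UNIV. ?\<Gamma> a i k * ?\<Gamma> b m p * ?g a b + ?\<Gamma> a i p * ?\<Gamma> b m k * ?g b a)"
      by (simp add: metric_compat[OF x] sum_distrib_left sum.distrib distrib_left mult.assoc)
    finally show ?thesis by (simp add: add.assoc)
  qed
  have cross: "(\<Sum>a\<in>UNIV. \<Sum>b\<in>UNIV. ?\<Gamma> a i k * ?\<Gamma> b j p * ?g a b + ?\<Gamma> a i p * ?\<Gamma> b j k * ?g b a)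
      = (\<Sum>a\<in>UNIV. \<Sum>b\<in>UNIV. ?\<Gamma> a j k * ?\<Gamma> b i p * ?g a b + ?\<Gamma> a j p * ?\<Gamma> b i k * ?g b a)"
  proof -
    have "(\<Sum>a\<in>UNIV. \<Sum>b\<in>UNIV. ?\<Gamma> a i k * ?\<Gamma> b j p * ?g a b) = (\<Sum>a\<in>UNIV. \<Sum>b\<in>UNIV. ?\<Gamma> a j p * ?\<Gamma> b i k * ?g b a)"
      by (subst sum.swap) (simp add: mult_ac)
    moreover have "(\<Sum>a\<in>UNIV. \<Sum>b\<in>UNIV. ?\<Gamma> a i p * ?\<Gamma> b j k * ?g b a) = (\<Sum>a\<in>UNIV. \<Sum>b\<in>UNIV. ?\<Gamma> a j k * ?\<Gamma> b i p * ?g a b)"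
      by (subst sum.swap) (simp add: mult_ac)
    ultimately show ?thesis by (simp add: sum.distrib)
  qed
  have low: "(\<Sum>a\<in>UNIV. ?g q a * riemann G a r i j x) =
      (\<Sum>a\<in>UNIV. pd i (christoffel G a j r) x * ?g q a) - (\<Sum>a\<in>UNIV. pd j (christoffel G a i r) x * ?g q a)
      + (\<Sum>a\<in>UNIV. \<Sum>b\<in>UNIV. ?\<Gamma> a j r * ?\<Gamma> b i a * ?g q b) - (\<Sum>a\<in>UNIV. \<Sum>b\<in>UNIV. ?\<Gamma> a i r * ?\<Gamma> b j a * ?g q b)" for q r
  proof -
    have sw: "(\<Sum>a\<in>UNIV. \<Sum>m\<in>UNIV. ?g q a * (?\<Gamma> a u m * ?\<Gamma> m w r)) = (\<Sum>a\<in>UNIV. \<Sum>b\<in>UNIV. ?\<Gamma> a w r * ?\<Gamma> b u a * ?g q b)" for u w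
      by (subst sum.swap) (simp add: mult_ac)
    have "(\<Sum>a\<in>UNIV. ?g q a * riemann G a r i j x) =
       (\<Sum>a\<in>UNIV. pd i (christoffel G a j r) x * ?g q a) - (\<Sum>a\<in>UNIV. pd j (christoffel G a i r) x * ?g q a)
      + (\<Sum>a\<in>UNIV. \<Sum>m\<in>UNIV. ?g q a * (?\<Gamma> a i m * ?\<Gamma> m j r)) - (\<Sum>a\<in>UNIV. \<Sum>m\<in>UNIV. ?g q a * (?\<Gamma> a j m * ?\<Gamma> m i r))"
      by (simp add: riemann_def distrib_left right_diff_distrib sum.distrib sum_subtractf sum_distrib_left mult.commute[of "?g q _" "pd _ _ _"])
    then show ?thesis by (simp only: sw)
  qed
  have gs: "?g p a = ?g a p" for a by (rule sym[OF x])
  have lowp: "(\<Sum>a\<in>UNIV. ?g p a * riemann G a k i j x) =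
      (\<Sum>a\<in>UNIV. pd i (christoffel G a j k) x * ?g a p) - (\<Sum>a\<in>UNIV. pd j (christoffel G a i k) x * ?g a p)
      + (\<Sum>a\<in>UNIV. \<Sum>b\<in>UNIV. ?\<Gamma> a j k * ?\<Gamma> b i a * ?g b p) - (\<Sum>a\<in>UNIV. \<Sum>b\<in>UNIV. ?\<Gamma> a i k * ?\<Gamma> b j a * ?g b p)"
    unfolding low unfolding gs ..
  have "pd i (pd j (\<lambda>y. G y $ k $ p)) x = pd j (pd i (\<lambda>y. G y $ k $ p)) x"
    by (rule pd_commute[OF G_smooth V x])
  then show ?thesis
    using cross unfolding second lowp low[of k p] sum.distrib by linarith
qed


context
  fixes X :: "real^'n \<Rightarrow> real^'n"
  assumes Xs: "smooth_on V X"
begin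

lemma X_smooth: "smooth_on V (\<lambda>y. X y $ k)"
  by (rule smooth_on_comp_nth[OF V Xs])

lemma X_diff: "x \<in> V \<Longrightarrow> (\<lambda>y. X y $ k) differentiable (at x)"
  by (rule smooth_on_D[OF X_smooth])

lemma dX_diff: "x \<in> V \<Longrightarrow> pd j (\<lambda>y. X y $ k) differentiable (at x)"
  by (rule smooth_on_D[OF smooth_on_pd[OF X_smooth]])

lemma nabla_vec_diff: "x \<in> V \<Longrightarrow> (\<lambda>y. nabla_vec G X y $ j $ k) differentiable (at x)"
  unfolding nabla_vec_def by (auto intro!: X_diff dX_diff chr_diff differentiable_mult differentiable_sum differentiable_add)

lemma lower_derivative:
  assumes x: "x \<in> V" and W: "\<And>a. W a differentiable (at x)"
  shows "pd i (\<lambda>y. \<Sum>a\<in>UNIV. G y $ k $ a * W a y) x - (\<Sum>b\<in>UNIV. christoffel G b i k x * (\<Sum>a\<in>UNIV. G x $ b $ a * W a x))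
     = (\<Sum>a\<in>UNIV. G x $ k $ a * (pd i (W a) x + (\<Sum>b\<in>UNIV. christoffel G a i b x * W b x)))"
proof -
  have "pd i (\<lambda>y. \<Sum>a\<in>UNIV. G y $ k $ a * W a y) x = (\<Sum>a\<in>UNIV. pd i (\<lambda>y. G y $ k $ a) x * W a x + G x $ k $ a * pd i (W a) x)"
    using x by (simp add: pd_sum pd_mult G_diff W differentiable_mult)
  also have "\<dots> = (\<Sum>a\<in>UNIV. \<Sum>b\<in>UNIV. christoffel G b i k x * (G x $ b $ a * W a x))
      + (\<Sum>a\<in>UNIV. \<Sum>b\<in>UNIV. christoffel G b i a x * G x $ k $ b * W a x) + (\<Sum>a\<in>UNIV. G x $ k $ a * pd i (W a) x)"
    by (simp add: metric_compat[OF x] sum.distrib distrib_right sum_distrib_right mult.assoc)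
  finally have 1: "pd i (\<lambda>y. \<Sum>a\<in>UNIV. G y $ k $ a * W a y) x = (\<Sum>a\<in>UNIV. \<Sum>b\<in>UNIV. christoffel G b i k x * (G x $ b $ a * W a x))
      + (\<Sum>a\<in>UNIV. \<Sum>b\<in>UNIV. christoffel G b i a x * G x $ k $ b * W a x) + (\<Sum>a\<in>UNIV. G x $ k $ a * pd i (W a) x)" .
  have "(\<Sum>a\<in>UNIV. \<Sum>b\<in>UNIV. christoffel G b i k x * (G x $ b $ a * W a x)) = (\<Sum>b\<in>UNIV. christoffel G b i k x * (\<Sum>a\<in>UNIV. G x $ b $ a * W a x))"
    by (subst sum.swap) (simp add: sum_distrib_left)
  moreover have "(\<Sum>a\<in>UNIV. \<Sum>b\<in>UNIV. christoffel G b i a x * G x $ k $ b * W a x) = (\<Sum>a\<in>UNIV. G x $ k $ a * (\<Sum>b\<in>UNIV. christoffel G a i b x * W b x))"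
    by (subst sum.swap) (simp add: sum_distrib_left mult_ac)
  moreover have "(\<Sum>a\<in>UNIV. G x $ k $ a * (pd i (W a) x + (\<Sum>b\<in>UNIV. christoffel G a i b x * W b x)))
     = (\<Sum>a\<in>UNIV. G x $ k $ a * pd i (W a) x) + (\<Sum>a\<in>UNIV. G x $ k $ a * (\<Sum>b\<in>UNIV. christoffel G a i b x * W b x))"
    by (simp only: sum.distrib distrib_left)
  ultimately show ?thesis using 1 by linarith
qed

lemma nabla_form_flat: assumes x: "x \<in> V"
  shows "nabla_form G (flat G X) x $ j $ k = (\<Sum>a\<in>UNIV. G x $ k $ a * nabla_vec G X x $ j $ a)"
  using lower_derivative[OF x X_diff[OF x], of j k]
  by (simp add: nabla_form_def flat_def nabla_vec_def)

definition nabla2 where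
  "nabla2 i j k x = pd i (\<lambda>y. nabla_vec G X y $ j $ k) x - (\<Sum>a\<in>UNIV. christoffel G a i j x * nabla_vec G X x $ a $ k)
     + (\<Sum>a\<in>UNIV. christoffel G k i a x * nabla_vec G X x $ j $ a)"

lemma nabla_two_flat: assumes x: "x \<in> V"
  shows "nabla_two G (nabla_form G (flat G X)) x $ i $ j $ k = (\<Sum>a\<in>UNIV. G x $ k $ a * nabla2 i j a x)"
proof -
  have "(\<lambda>y. \<Sum>a\<in>UNIV. G y $ k $ a * nabla_vec G X y $ j $ a) differentiable (at x)"
    using x by (auto intro!: differentiable_sum differentiable_mult G_diff nabla_vec_diff)
  then have 1: "pd i (\<lambda>y. nabla_form G (flat G X) y $ j $ k) x = pd i (\<lambda>y. \<Sum>a\<in>UNIV. G y $ k $ a * nabla_vec G X y $ j $ a) x"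
    by (rule pd_cong[OF V x, symmetric]) (simp add: nabla_form_flat)
  have 2: "(\<Sum>a\<in>UNIV. christoffel G a i j x * (\<Sum>b\<in>UNIV. G x $ k $ b * nabla_vec G X x $ a $ b))
     = (\<Sum>b\<in>UNIV. G x $ k $ b * (\<Sum>a\<in>UNIV. christoffel G a i j x * nabla_vec G X x $ a $ b))"
  proof -
    have "(\<Sum>a\<in>UNIV. christoffel G a i j x * (\<Sum>b\<in>UNIV. G x $ k $ b * nabla_vec G X x $ a $ b))
      = (\<Sum>a\<in>UNIV. \<Sum>b\<in>UNIV. G x $ k $ b * (christoffel G a i j x * nabla_vec G X x $ a $ b))"
      by (simp only: sum_distrib_left mult.left_commute)
    also have "\<dots> = (\<Sum>b\<in>UNIV. G x $ k $ b * (\<Sum>a\<in>UNIV. christoffel G a i j x * nabla_vec G X x $ a $ b))"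
      by (subst sum.swap) (simp only: sum_distrib_left)
    finally show ?thesis .
  qed
  have 3: "(\<Sum>a\<in>UNIV. G x $ k $ a * nabla2 i j a x) = 
      (\<Sum>a\<in>UNIV. G x $ k $ a * (pd i (\<lambda>y. nabla_vec G X y $ j $ a) x + (\<Sum>b\<in>UNIV. christoffel G a i b x * nabla_vec G X x $ j $ b)))
      - (\<Sum>b\<in>UNIV. G x $ k $ b * (\<Sum>a\<in>UNIV. christoffel G a i j x * nabla_vec G X x $ a $ b))"
  proof -
    have "u * (p - q + r) = u * (p + r) - u * q" for u p q r :: real by (simp add: algebra_simps)
    then show ?thesis unfolding nabla2_def sum_subtractf[symmetric] by (simp only:)
  qed
  have 4: "nabla_two G (nabla_form G (flat G X)) x $ i $ j $ k =
      pd i (\<lambda>y. nabla_form G (flat G X) y $ j $ k) x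
      - (\<Sum>a\<in>UNIV. christoffel G a i j x * (\<Sum>b\<in>UNIV. G x $ k $ b * nabla_vec G X x $ a $ b))
      - (\<Sum>a\<in>UNIV. christoffel G a i k x * (\<Sum>b\<in>UNIV. G x $ a $ b * nabla_vec G X x $ j $ b))"
    by (simp add: nabla_two_def nabla_form_flat[OF x])
  show ?thesis
    using lower_derivative[where W = "\<lambda>a y. nabla_vec G X y $ j $ a", OF x nabla_vec_diff[OF x], of i k] by (simp only: 1 2 3 4)
qed

lemma nabla2_eq: assumes x: "x \<in> V"
  shows "pd i (pd j (\<lambda>y. X y $ k)) x - (\<Sum>l\<in>UNIV. christoffel G l i j x * pd l (\<lambda>y. X y $ k) x)
      + (\<Sum>m\<in>UNIV. X x $ m * pd m (christoffel G k i j) x)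
      + (\<Sum>a\<in>UNIV. christoffel G k a j x * pd i (\<lambda>y. X y $ a) x)
      + (\<Sum>b\<in>UNIV. christoffel G k i b x * pd j (\<lambda>y. X y $ b) x)
    = nabla2 i j k x + (\<Sum>m\<in>UNIV. X x $ m * riemann G k j m i x)"
proof -
  let ?\<Gamma> = "\<lambda>a i j. christoffel G a i j x" and ?X = "\<lambda>m. X x $ m"
  have ps: "pd i (christoffel G k m j) x = pd i (christoffel G k j m) x" for m
    by (rule pd_cong[OF V x chr_diff[OF x]]) (rule chr_sym)
  have 1: "pd i (\<lambda>y. nabla_vec G X y $ j $ k) x = pd i (pd j (\<lambda>y. X y $ k)) x
     + (\<Sum>m\<in>UNIV. ?X m * pd i (christoffel G k j m) x) + (\<Sum>a\<in>UNIV. ?\<Gamma> k a j * pd i (\<lambda>y. X y $ a) x)"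
    using x by (simp add: nabla_vec_def pd_add pd_sum pd_mult chr_diff X_diff dX_diff differentiable_mult differentiable_sum
       sum.distrib mult.commute chr_sym[OF x, of k _ j])
  have 2: "(\<Sum>a\<in>UNIV. ?\<Gamma> a i j * nabla_vec G X x $ a $ k) = (\<Sum>l\<in>UNIV. ?\<Gamma> l i j * pd l (\<lambda>y. X y $ k) x)
     + (\<Sum>m\<in>UNIV. ?X m * (\<Sum>b\<in>UNIV. ?\<Gamma> k m b * ?\<Gamma> b i j))"
  proof -
    have "(\<Sum>a\<in>UNIV. ?\<Gamma> a i j * (\<Sum>m\<in>UNIV. ?\<Gamma> k a m * ?X m)) = (\<Sum>m\<in>UNIV. ?X m * (\<Sum>b\<in>UNIV. ?\<Gamma> k m b * ?\<Gamma> b i j))"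
      by (simp add: sum_distrib_left mult_ac chr_sym[OF x, of k]) (subst sum.swap, simp add: chr_sym[OF x, of k] mult_ac)
    then show ?thesis by (simp add: nabla_vec_def distrib_left sum.distrib)
  qed
  have 3: "(\<Sum>a\<in>UNIV. ?\<Gamma> k i a * nabla_vec G X x $ j $ a) = (\<Sum>b\<in>UNIV. ?\<Gamma> k i b * pd j (\<lambda>y. X y $ b) x)
     + (\<Sum>m\<in>UNIV. ?X m * (\<Sum>b\<in>UNIV. ?\<Gamma> k i b * ?\<Gamma> b m j))"
  proof -
    have "(\<Sum>a\<in>UNIV. ?\<Gamma> k i a * (\<Sum>m\<in>UNIV. ?\<Gamma> a j m * ?X m)) = (\<Sum>a\<in>UNIV. \<Sum>m\<in>UNIV. ?X m * (?\<Gamma> k i a * ?\<Gamma> a m j))"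
      by (simp add: sum_distrib_left mult_ac chr_sym[OF x, of _ j])
    also have "\<dots> = (\<Sum>m\<in>UNIV. ?X m * (\<Sum>b\<in>UNIV. ?\<Gamma> k i b * ?\<Gamma> b m j))"
      by (subst sum.swap) (simp add: sum_distrib_left)
    finally show ?thesis by (simp add: nabla_vec_def distrib_left sum.distrib)
  qed
  have 4: "(\<Sum>m\<in>UNIV. ?X m * riemann G k j m i x) = (\<Sum>m\<in>UNIV. ?X m * pd m (christoffel G k i j) x)
     - (\<Sum>m\<in>UNIV. ?X m * pd i (christoffel G k j m) x) + (\<Sum>m\<in>UNIV. ?X m * (\<Sum>b\<in>UNIV. ?\<Gamma> k m b * ?\<Gamma> b i j))
     - (\<Sum>m\<in>UNIV. ?X m * (\<Sum>b\<in>UNIV. ?\<Gamma> k i b * ?\<Gamma> b m j))"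
    by (simp add: riemann_def ps distrib_left right_diff_distrib sum.distrib sum_subtractf)
  show ?thesis unfolding nabla2_def 1 2 3 4 by simp
qed

definition jac where
  "jac k x = (\<Sum>i\<in>UNIV. \<Sum>j\<in>UNIV. ginv G i j x * (nabla2 i j k x + (\<Sum>m\<in>UNIV. X x $ m * riemann G k j m i x)))"

lemma jac_lower: assumes x: "x \<in> V"
  shows "(\<Sum>k\<in>UNIV. G x $ p $ k * jac k x) = (X x v* ricci G x) $ p - rough_laplacian G (flat G X) x $ p"
proof -
  let ?g = "\<lambda>i j. G x $ i $ j" and ?h = "\<lambda>i j. ginv G i j x" and ?R = "\<lambda>k j m i. riemann G k j m i x"
  have sw: "(\<Sum>k\<in>UNIV. ?g p k * (\<Sum>i\<in>UNIV. \<Sum>j\<in>UNIV. ?h i j * F i j k)) = (\<Sum>i\<in>UNIV. \<Sum>j\<in>UNIV. ?h i j * (\<Sum>k\<in>UNIV. ?g p k * F i j k))" for F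
  proof -
    have "(\<Sum>k\<in>UNIV. ?g p k * (\<Sum>i\<in>UNIV. \<Sum>j\<in>UNIV. ?h i j * F i j k)) = (\<Sum>k\<in>UNIV. \<Sum>i\<in>UNIV. \<Sum>j\<in>UNIV. ?h i j * (?g p k * F i j k))"
      by (simp add: sum_distrib_left mult_ac)
    also have "\<dots> = (\<Sum>i\<in>UNIV. \<Sum>k\<in>UNIV. \<Sum>j\<in>UNIV. ?h i j * (?g p k * F i j k))" by (rule sum.swap)
    also have "\<dots> = (\<Sum>i\<in>UNIV. \<Sum>j\<in>UNIV. \<Sum>k\<in>UNIV. ?h i j * (?g p k * F i j k))" by (intro sum.cong refl sum.swap)
    finally show ?thesis by (simp add: sum_distrib_left)
  qed
  have "(\<Sum>i\<in>UNIV. \<Sum>j\<in>UNIV. ?h i j * (\<Sum>k\<in>UNIV. ?g p k * nabla2 i j k x)) = - rough_laplacian G (flat G X) x $ p"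
    by (simp add: rough_laplacian_def nabla_two_flat[OF x])
  moreover have "(\<Sum>i\<in>UNIV. \<Sum>j\<in>UNIV. ?h i j * (\<Sum>k\<in>UNIV. ?g p k * (\<Sum>m\<in>UNIV. X x $ m * ?R k j m i))) = (X x v* ricci G x) $ p"
  proof -
    have anti: "?R k j m i = - ?R k j i m" for k j m i by (simp add: riemann_def)
    have contr: "(\<Sum>i\<in>UNIV. \<Sum>j\<in>UNIV. ?h i j * (\<Sum>k\<in>UNIV. ?g p k * ?R k j m i)) = ricci G x $ m $ p" for m
    proof -
      have "(\<Sum>j\<in>UNIV. ?h i j * (\<Sum>k\<in>UNIV. ?g p k * ?R k j m i)) = ?R i p i m" for i
      proof -
        have "(\<Sum>j\<in>UNIV. ?h i j * (\<Sum>k\<in>UNIV. ?g p k * ?R k j m i)) = (\<Sum>j\<in>UNIV. ?h i j * (\<Sum>k\<in>UNIV. ?g j k * ?R k p i m))"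
          by (subst riemann_antisym[OF x]) (simp add: anti[of _ _ m i] sum_negf)
        also have "\<dots> = (\<Sum>k\<in>UNIV. (\<Sum>j\<in>UNIV. ?h i j * ?g j k) * ?R k p i m)"
          by (simp add: sum_distrib_left sum_distrib_right mult.assoc) (rule sum.swap)
        also have "\<dots> = ?R i p i m" by (simp add: ginv_G[OF x] if_distrib if_distribR cong: if_cong)
        finally show ?thesis .
      qed
      then show ?thesis by (simp add: ricci_def)
    qed
    have "(\<Sum>k\<in>UNIV. ?g p k * (\<Sum>m\<in>UNIV. X x $ m * ?R k j m i)) = (\<Sum>m\<in>UNIV. X x $ m * (\<Sum>k\<in>UNIV. ?g p k * ?R k j m i))" for i j
      by (simp add: sum_distrib_left mult_ac) (rule sum.swap)
    then have "(\<Sum>i\<in>UNIV. \<Sum>j\<in>UNIV. ?h i j * (\<Sum>k\<in>UNIV. ?g p k * (\<Sum>m\<in>UNIV. X x $ m * ?R k j m i)))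
       = (\<Sum>i\<in>UNIV. \<Sum>j\<in>UNIV. \<Sum>m\<in>UNIV. X x $ m * (?h i j * (\<Sum>k\<in>UNIV. ?g p k * ?R k j m i)))"
      by (simp add: sum_distrib_left mult_ac)
    also have "\<dots> = (\<Sum>i\<in>UNIV. \<Sum>m\<in>UNIV. \<Sum>j\<in>UNIV. X x $ m * (?h i j * (\<Sum>k\<in>UNIV. ?g p k * ?R k j m i)))"
      by (intro sum.cong refl sum.swap)
    also have "\<dots> = (\<Sum>m\<in>UNIV. \<Sum>i\<in>UNIV. \<Sum>j\<in>UNIV. X x $ m * (?h i j * (\<Sum>k\<in>UNIV. ?g p k * ?R k j m i)))"
      by (rule sum.swap)
    also have "\<dots> = (\<Sum>m\<in>UNIV. X x $ m * ricci G x $ m $ p)"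
      by (simp add: contr[symmetric] sum_distrib_left)
    finally show ?thesis by (simp add: vector_matrix_mult_def mult.commute)
  qed
  ultimately show ?thesis
    unfolding jac_def sw by (simp add: distrib_left sum.distrib)
qed

lemma tension_derivative: assumes x: "x \<in> V"
  shows "((\<lambda>t. tension G (\<lambda>y. y + t *\<^sub>R X y) x) has_vector_derivative (\<chi> k. jac k x)) (at 0)"
proof -
  let ?F = "\<lambda>t y. y + t *\<^sub>R X y"
  let ?d = "\<lambda>j k. if j = k then 1 else (0::real)"
  have id: "((\<lambda>y. y $ k) has_derivative (\<lambda>v. v $ k)) (at y)" for k and y :: "real^'n"
    by (rule bounded_linear.has_derivative[OF bounded_linear_vec_nth has_derivative_ident])
  have idd: "(\<lambda>y. y $ k) differentiable (at y)" for k and y :: "real^'n"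
    using id differentiable_def by blast
  have pid: "pd j (\<lambda>y. y $ k) y = ?d j k" for j k and y :: "real^'n"
    by (rule trans[OF pd_eqI[OF id]]) (simp add: axis_def)
  have p1: "pd j (\<lambda>y. ?F t y $ k) y = ?d j k + t * pd j (\<lambda>y. X y $ k) y" if "y \<in> V" for j k t y
    using that by (simp add: pd_add pd_mult idd X_diff pid)
  have p2: "pd i (pd j (\<lambda>y. ?F t y $ k)) x = t * pd i (pd j (\<lambda>y. X y $ k)) x" for i j k t
  proof -
    have "pd i (pd j (\<lambda>y. ?F t y $ k)) x = pd i (\<lambda>y. ?d j k + t * pd j (\<lambda>y. X y $ k) y) x"
      by (rule pd_cong[OF V x, symmetric]) (simp_all only: p1, intro differentiable_add differentiable_mult differentiable_const dX_diff x)
    then show ?thesis using dX_diff[OF x] by (simp add: pd_add pd_mult)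
  qed
  have chr: "((\<lambda>t. christoffel G k a b (?F t x)) has_real_derivative (\<Sum>m\<in>UNIV. X x $ m * pd m (christoffel G k a b) x)) (at 0)" for k a b
  proof -
    have "((\<lambda>t. ?F t x) has_derivative (\<lambda>h. h *\<^sub>R X x)) (at 0)" by (auto intro!: derivative_eq_intros)
    moreover have "(christoffel G k a b has_derivative (\<lambda>v. \<Sum>m\<in>UNIV. v $ m * pd m (christoffel G k a b) x)) (at (?F 0 x))"
      using pd_has_derivative[OF chr_diff[OF x, of k a b]] by simp
    ultimately have "((\<lambda>t. christoffel G k a b (?F t x)) has_derivative (\<lambda>h. \<Sum>m\<in>UNIV. (h *\<^sub>R X x) $ m * pd m (christoffel G k a b) x)) (at 0)"
      by (rule has_derivative_compose)
    moreover have "(\<lambda>h. \<Sum>m\<in>UNIV. (h *\<^sub>R X x) $ m * pd m (christoffel G k a b) x)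
        = (*) (\<Sum>m\<in>UNIV. X x $ m * pd m (christoffel G k a b) x)"
      by (simp add: fun_eq_iff sum_distrib_right sum_distrib_left mult_ac)
    ultimately show ?thesis by (simp only: has_field_derivative_def)
  qed
  have t: "tension G (?F t) x $ k = (\<Sum>i\<in>UNIV. \<Sum>j\<in>UNIV. ginv G i j x *
     (t * pd i (pd j (\<lambda>y. X y $ k)) x - (\<Sum>l\<in>UNIV. christoffel G l i j x * (?d l k + t * pd l (\<lambda>y. X y $ k) x))
      + (\<Sum>a\<in>UNIV. \<Sum>b\<in>UNIV. christoffel G k a b (?F t x) * (?d i a + t * pd i (\<lambda>y. X y $ a) x) * (?d j b + t * pd j (\<lambda>y. X y $ b) x))))" for t k
    by (simp only: tension_def vec_lambda_beta p1[OF x] p2)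
  have D: "((\<lambda>t. tension G (?F t) x $ k) has_real_derivative jac k x) (at 0)" for k
  proof -
    let ?S = "\<lambda>a b. \<Sum>m\<in>UNIV. X x $ m * pd m (christoffel G k a b) x"
    let ?C = "\<lambda>a b. christoffel G k a b x"
    let ?u = "\<lambda>i a. pd i (\<lambda>y. X y $ a) x"
    let ?P = "\<lambda>i j. pd i (pd j (\<lambda>y. X y $ k)) x"
    have lin: "((\<lambda>t. c * (e + t * d)) has_real_derivative c * d) (at 0)" for c d e :: real
      by (auto intro!: derivative_eq_intros)
    have lin1: "((\<lambda>t. e + t * d) has_real_derivative d) (at 0)" for d e :: real
      by (auto intro!: derivative_eq_intros)
    have lin0: "((\<lambda>t. t * d) has_real_derivative d) (at 0)" for d :: real
      by (auto intro!: derivative_eq_intros)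
    have prod: "((\<lambda>t. christoffel G k a b (?F t x) * (?d i a + t * ?u i a) * (?d j b + t * ?u j b))
        has_real_derivative ?S a b * ?d i a * ?d j b + ?C a b * ?u i a * ?d j b + ?C a b * ?d i a * ?u j b) (at 0)" for i j a b
    proof -
      have alg: "(s * (p + 0 * u) + u * c) * (q + 0 * v) + v * (c * (p + 0 * u)) = s * p * q + c * u * q + c * p * v"
        for s p q u v c :: real by (simp add: algebra_simps)
      have F0: "?F 0 x = x" by simp
      show ?thesis
        by (rule DERIV_cong, rule DERIV_mult, rule DERIV_mult, rule chr, rule lin1, rule lin1) (simp only: F0 alg)
    qed
    have 1: "((\<lambda>t. tension G (?F t) x $ k) has_real_derivative
       (\<Sum>i\<in>UNIV. \<Sum>j\<in>UNIV. ginv G i j x * (?P i j - (\<Sum>l\<in>UNIV. christoffel G l i j x * ?u l k)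
        + (\<Sum>a\<in>UNIV. \<Sum>b\<in>UNIV. ?S a b * ?d i a * ?d j b + ?C a b * ?u i a * ?d j b + ?C a b * ?d i a * ?u j b)))) (at 0)"
      unfolding t by (intro DERIV_sum DERIV_cmult DERIV_add DERIV_diff prod lin lin0)
    have contr: "(\<Sum>b\<in>UNIV. f b * ?d j b) = f j" for f :: "'n \<Rightarrow> real" and j
      by (simp add: if_distrib cong: if_cong)
    have 2: "(\<Sum>a\<in>UNIV. \<Sum>b\<in>UNIV. ?S a b * ?d i a * ?d j b + ?C a b * ?u i a * ?d j b + ?C a b * ?d i a * ?u j b)
       = ?S i j + (\<Sum>a\<in>UNIV. ?C a j * ?u i a) + (\<Sum>b\<in>UNIV. ?C i b * ?u j b)" for i j
    proof -
      have "(\<Sum>a\<in>UNIV. \<Sum>b\<in>UNIV. ?C a b * ?d i a * ?u j b) = (\<Sum>a\<in>UNIV. (\<Sum>b\<in>UNIV. ?C a b * ?u j b) * ?d i a)"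
        unfolding sum_distrib_right by (simp only: mult_ac)
      then show ?thesis by (simp only: sum.distrib contr)
    qed
    have 3: "?P i j - (\<Sum>l\<in>UNIV. christoffel G l i j x * ?u l k) + (?S i j + (\<Sum>a\<in>UNIV. ?C a j * ?u i a) + (\<Sum>b\<in>UNIV. ?C i b * ?u j b))
       = nabla2 i j k x + (\<Sum>m\<in>UNIV. X x $ m * riemann G k j m i x)" for i j
      unfolding nabla2_eq[OF x, symmetric] by (simp only: add.assoc)
    show ?thesis using 1 unfolding 2 3 jac_def .
  qed
  show ?thesis
    unfolding has_vector_derivative_def
  proof (subst has_derivative_componentwise_within, safe)
    fix b :: "real^'n" assume "b \<in> Basis"
    then obtain k where "b = axis k 1" by (auto simp: Basis_vec_def)
    then show "((\<lambda>t. tension G (?F t) x \<bullet> b) has_derivative (\<lambda>h. (h *\<^sub>R (\<chi> k. jac k x)) \<bullet> b)) (at 0)"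
      using D[of k] by (simp add: inner_axis has_field_derivative_def mult.commute mult_commute_abs)
  qed
qed

lemma tension_derivative_zero_iff: assumes x: "x \<in> V"
  shows "((\<lambda>t. tension G (\<lambda>y. y + t *\<^sub>R X y) x) has_vector_derivative 0) (at 0) \<longleftrightarrow>
     rough_laplacian G (flat G X) x = X x v* ricci G x"
proof -
  let ?J = "\<chi> k. jac k x"
  have 1: "((\<lambda>t. tension G (\<lambda>y. y + t *\<^sub>R X y) x) has_vector_derivative 0) (at 0) \<longleftrightarrow> ?J = 0"
  proof
    assume "((\<lambda>t. tension G (\<lambda>y. y + t *\<^sub>R X y) x) has_vector_derivative 0) (at 0)"
    with tension_derivative[OF x] show "?J = 0" by (rule vector_derivative_unique_at)
  next
    assume "?J = 0"
    with tension_derivative[OF x] show "((\<lambda>t. tension G (\<lambda>y. y + t *\<^sub>R X y) x) has_vector_derivative 0) (at 0)" by (simp only:)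
  qed
  have 2: "v = 0 \<longleftrightarrow> G x *v v = 0" for v
    using pos[OF x, of v] by (metis inner_zero_right less_irrefl matrix_vector_mult_0_right)
  have 3: "G x *v ?J = X x v* ricci G x - rough_laplacian G (flat G X) x"
    by (simp only: vec_eq_iff matrix_vector_mult_def vec_lambda_beta jac_lower[OF x] vector_minus_component simp_thms)
  show ?thesis unfolding 1 2[of ?J] 3 by (simp only: right_minus_eq) (rule eq_commute)
qed

end

end

text \<open>\<open>\<xi>\<close> is an infinitesimal harmonic transformation iff \<open>\<nabla>\<^sup>*\<nabla>\<theta> = Ric(\<xi>, \<cdot>)\<close>, where \<open>\<theta>\<close> is dual to \<open>\<xi>\<close>.\<close>

lemma infinitesimal_harmonic_iff:
  assumes "smooth_atlas A" "riemannian_metric A g" "smooth_vector_field A \<xi>"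
  shows "infinitesimal_harmonic A g \<xi> \<longleftrightarrow>
    (\<forall>c\<in>A. \<forall>x\<in>chart_img c. rough_laplacian (g c) (flat (g c) (\<xi> c)) x = \<xi> c x v* ricci (g c) x)"
  unfolding infinitesimal_harmonic_def
proof (intro ball_cong refl)
  fix c x assume c: "c \<in> A" and x: "x \<in> chart_img c"
  have "open (chart_img c)" using assms(1) c unfolding smooth_atlas_def by blast
  moreover have "smooth_on (chart_img c) (g c)"
    using assms(2) c unfolding riemannian_metric_def smooth_sym_tensor_def by blast
  moreover have "g c y $ i $ j = g c y $ j $ i" if "y \<in> chart_img c" for y i j
    using assms(2) c that unfolding riemannian_metric_def smooth_sym_tensor_def by blast
  moreover have "0 < v \<bullet> (g c y *v v)" if "y \<in> chart_img c" "v \<noteq> 0" for y v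
    using assms(2) c that unfolding riemannian_metric_def by blast
  moreover have "smooth_on (chart_img c) (\<xi> c)"
    using assms(3) c unfolding smooth_vector_field_def by blast
  ultimately show "((\<lambda>t. tension (g c) (\<lambda>y. y + t *\<^sub>R \<xi> c y) x) has_vector_derivative 0) (at 0) \<longleftrightarrow>
     rough_laplacian (g c) (flat (g c) (\<xi> c)) x = \<xi> c x v* ricci (g c) x"
    using x by (rule tension_derivative_zero_iff)
qed

end

theory Submission
  imports Defs
begin

text \<open>
  Write \<open>n\<close> for the dimension, \<open>\<theta>\<close> for the one-form dual to \<open>\<xi>\<close>, \<open>s\<close> for the scalar curvature and \<open>\<lambda>\<close> for the function
  called \<open>l\<close> on the manifold and \<open>f\<close> in a chart.
  Both parts follow by applying the divergence \<open>\<delta>\<close> to the expansion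
  \<open>Ric = \<onehalf> L\<^sub>\<xi> g + \<lambda> g + \<phi>\<close>: the first from the resulting pointwise identity, the second by integration.

  First, \<open>\<delta> Ric = - \<onehalf> ds\<close> by the contracted Bianchi identity, \<open>\<delta>(\<lambda> g) = - d\<lambda>\<close>, \<open>\<delta>\<phi> = 0\<close>, and commuting
  covariant derivatives gives \<open>\<delta>(L\<^sub>\<xi> g) = \<nabla>\<^sup>*\<nabla>\<theta> - Ric(\<xi>, \<cdot>) - d(div \<xi>)\<close> (\<open>delta_lie_metric\<close>). The trace of the
  expansion is \<open>s = div \<xi> + n \<lambda>\<close>. Eliminating \<open>ds\<close> leaves
  \<open>\<nabla>\<^sup>*\<nabla>\<theta> - Ric(\<xi>, \<cdot>) = (2 - n) d\<lambda>\<close> (\<open>rough_laplacian_minus_ricci\<close>). The left-hand side vanishes iff \<open>\<xi>\<close> is an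
  infinitesimal harmonic transformation. So this is automatic for \<open>n = 2\<close>, and for \<open>n \<ge> 3\<close> it
  means \<open>d\<lambda> = 0\<close>, that is, \<open>\<lambda>\<close> is constant on the connected manifold.

  Secondly, let \<open>S = \<onehalf> L\<^sub>\<xi> g - (1/n) (div \<xi>) g\<close>, which vanishes iff \<open>\<xi>\<close> is conformal Killing. The expansion
  and its trace give \<open>S = Ric - (s/n) g - \<phi>\<close> (\<open>strain_eq\<close>), hence \<open>\<delta>S = - k ds\<close> with \<open>k = (n - 2)/(2n)\<close>. On the other
  hand, \<open>S\<close> is symmetric and trace-free, so \<open>div(S \<xi>) = |S|\<^sup>2 - (\<delta>S)(\<xi>) = |S|\<^sup>2 + k \<xi>(s)\<close>
  (\<open>divergence_strain_flux\<close>). By the divergence theorem \<open>\<integral> |S|\<^sup>2 = - k \<integral> \<xi>(s)\<close>, and if the last integral is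
  nonnegative then \<open>S = 0\<close>. Then \<open>\<xi>\<close> is conformal Killing, \<open>\<phi> = Ric - (s/n) g\<close>, and \<open>k ds = - \<delta>S = 0\<close> makes \<open>s\<close>
  constant for \<open>n \<ge> 3\<close>.

  The tensor identities are local and are proved in one chart. The integration needs more: the volume
  measure, which is given by a definite description, has to be shown to exist and to be unique
  (\<open>vol_is_riemannian_measure\<close>), for which the densities \<open>sqrt (det g)\<close> in overlapping charts are
  compared by the change of variables formula; the scalars \<open>div\<close>, \<open>s\<close> and \<open>\<xi>(s)\<close> have to be independent of
  the chart; and the divergence theorem on the compact manifold (\<open>divergence_theorem\<close>) is reduced by a partition of
  unity to fields with compact support in a chart, where it says that partial
  derivatives of compactly supported functions have integral \<open>0\<close>.
\<close>

section \<open>Differentiability of finite order and smoothness\<close>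

lemma C_diff_SucI:
  assumes "open S" "\<And>x. x \<in> S \<Longrightarrow> (f has_derivative f' x) (at x)" "\<And>v. C_diff k S (\<lambda>x. f' x v)"
  shows "C_diff (Suc k) S f"
proof -
  have "frechet_derivative f (at x) = f' x" if "x \<in> S" for x
    using assms(2)[OF that] by (metis frechet_derivative_at)
  then have "C_diff k S (\<lambda>x. frechet_derivative f (at x) v)" for v
    using C_diff_cong[OF assms(1) _ assms(3)[of v]] by simp
  with assms(2) show ?thesis by (auto simp: differentiable_def)
qed

lemma C_diff_has_derivative:
  "C_diff (Suc k) S f \<Longrightarrow> x \<in> S \<Longrightarrow> (f has_derivative frechet_derivative f (at x)) (at x)"
  by (simp add: frechet_derivative_works[symmetric])

lemma C_diff_frechet: "C_diff (Suc k) S f \<Longrightarrow> C_diff k S (\<lambda>x. frechet_derivative f (at x) v)"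
  by simp

lemma C_diff_pd: "C_diff (Suc k) S f \<Longrightarrow> C_diff k S (pd i f)"
  unfolding pd_def by (rule C_diff_frechet)

lemma C_diff_Suc_imp: "C_diff (Suc k) S f \<Longrightarrow> C_diff k S f"
proof (induction k arbitrary: f)
  case 0
  then show ?case
    by (auto intro!: continuous_at_imp_continuous_on differentiable_imp_continuous_within)
next
  case (Suc k)
  then show ?case by (metis C_diff.simps(2))
qed

lemma C_diff_const: "C_diff k S (\<lambda>x. c)"
  by (induction k arbitrary: c) simp_all

lemma C_diff_add: "open S \<Longrightarrow> C_diff k S f \<Longrightarrow> C_diff k S g \<Longrightarrow> C_diff k S (\<lambda>x. f x + g x)"
proof (induction k arbitrary: f g)
  case (Suc k)
  show ?case
    by (rule C_diff_SucI[OF Suc.prems(1) has_derivative_add])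
       (use Suc in \<open>auto intro: C_diff_has_derivative simp del: C_diff.simps(2) intro!: Suc.IH C_diff_frechet\<close>)
qed (auto intro: continuous_intros)

lemma C_diff_uminus: "open S \<Longrightarrow> C_diff k S f \<Longrightarrow> C_diff k S (\<lambda>x. - f x)"
  by (rule C_diff_linear[OF _ bounded_linear_minus[OF bounded_linear_ident]])

lemma C_diff_diff: "open S \<Longrightarrow> C_diff k S f \<Longrightarrow> C_diff k S g \<Longrightarrow> C_diff k S (\<lambda>x. f x - g x)"
  using C_diff_add[OF _ _ C_diff_uminus] by fastforce

lemma C_diff_sum:
  "open S \<Longrightarrow> (\<And>i. i \<in> I \<Longrightarrow> C_diff k S (f i)) \<Longrightarrow> C_diff k S (\<lambda>x. \<Sum>i\<in>I. f i x)"
  by (induction I rule: infinite_finite_induct) (auto intro: C_diff_const C_diff_add)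

lemma C_diff_mult:
  fixes f g :: "'v::real_normed_vector \<Rightarrow> real"
  shows "open S \<Longrightarrow> C_diff k S f \<Longrightarrow> C_diff k S g \<Longrightarrow> C_diff k S (\<lambda>x. f x * g x)"
proof (induction k arbitrary: f g)
  case (Suc k)
  note fg = Suc.prems(2,3)
  show ?case
  proof (rule C_diff_SucI[OF Suc.prems(1) has_derivative_mult])
    show "C_diff k S (\<lambda>x. f x * frechet_derivative g (at x) v + frechet_derivative f (at x) v * g x)" for v
      by (intro C_diff_add Suc.IH Suc.prems(1) C_diff_Suc_imp[OF fg(1)] C_diff_Suc_imp[OF fg(2)]
          C_diff_frechet[OF fg(1)] C_diff_frechet[OF fg(2)])
  qed (use fg in \<open>auto intro: C_diff_has_derivative simp del: C_diff.simps(2)\<close>)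
qed (auto intro: continuous_intros)

lemma C_diff_prod:
  fixes f :: "'i \<Rightarrow> 'v::real_normed_vector \<Rightarrow> real"
  shows "open S \<Longrightarrow> (\<And>i. i \<in> I \<Longrightarrow> C_diff k S (f i)) \<Longrightarrow> C_diff k S (\<lambda>x. \<Prod>i\<in>I. f i x)"
  by (induction I rule: infinite_finite_induct) (auto intro: C_diff_const C_diff_mult)

lemma C_diff_inverse:
  fixes f :: "'v::real_normed_vector \<Rightarrow> real"
  assumes "open S" "C_diff k S f" "\<And>x. x \<in> S \<Longrightarrow> f x \<noteq> 0"
  shows "C_diff k S (\<lambda>x. inverse (f x))"
  using assms(2)
proof (induction k)
  case (Suc k)
  have "((\<lambda>y. inverse (f y)) has_derivative (\<lambda>v. - (inverse (f x) * frechet_derivative f (at x) v * inverse (f x)))) (at x)"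
    if "x \<in> S" for x
    by (rule Deriv.has_derivative_inverse[OF assms(3)[OF that] C_diff_has_derivative[OF Suc.prems that]])
  then show ?case
    by (rule C_diff_SucI[OF assms(1)])
      (auto intro!: C_diff_uminus C_diff_mult assms(1) Suc.IH C_diff_Suc_imp[OF Suc.prems] C_diff_frechet[OF Suc.prems])
qed (use assms(3) in \<open>auto intro!: continuous_intros\<close>)

lemma C_diff_divide:
  fixes f g :: "'v::real_normed_vector \<Rightarrow> real"
  shows "open S \<Longrightarrow> C_diff k S f \<Longrightarrow> C_diff k S g \<Longrightarrow> (\<And>x. x \<in> S \<Longrightarrow> g x \<noteq> 0) \<Longrightarrow> C_diff k S (\<lambda>x. f x / g x)"
  by (simp add: divide_inverse C_diff_mult C_diff_inverse)

text \<open>The derivative of \<open>sqrt f\<close> contains \<open>sqrt f\<close> itself, so the order of differentiability is gained step by step.\<close>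

lemma C_diff_sqrt:
  fixes f :: "'v::real_normed_vector \<Rightarrow> real"
  assumes "open S" "C_diff k S f" "\<And>x. x \<in> S \<Longrightarrow> 0 < f x"
  shows "C_diff k S (\<lambda>x. sqrt (f x))"
  using assms(2)
proof (induction k)
  case (Suc k)
  have "((\<lambda>y. sqrt (f y)) has_derivative (\<lambda>v. inverse (sqrt (f x)) * (1/2) * frechet_derivative f (at x) v)) (at x)"
    if "x \<in> S" for x
    using has_derivative_compose[OF C_diff_has_derivative[OF Suc.prems that]
        DERIV_real_sqrt[OF assms(3)[OF that], unfolded has_field_derivative_def]] by simp
  moreover have "C_diff k S (\<lambda>x. inverse (sqrt (f x)) * (1/2) * frechet_derivative f (at x) v)" for v
  proof (intro C_diff_mult C_diff_inverse C_diff_const assms(1))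
    show "C_diff k S (\<lambda>x. sqrt (f x))" by (rule Suc.IH[OF C_diff_Suc_imp[OF Suc.prems]])
    show "sqrt (f x) \<noteq> 0" if "x \<in> S" for x using assms(3)[OF that] by simp
  qed (rule C_diff_frechet[OF Suc.prems])
  ultimately show ?case by (rule C_diff_SucI[OF assms(1)])
qed (use assms(3) in \<open>auto intro!: continuous_intros\<close>)

lemma smooth_on_sum:
  "open S \<Longrightarrow> (\<And>i. i \<in> I \<Longrightarrow> smooth_on S (f i)) \<Longrightarrow> smooth_on S (\<lambda>x. \<Sum>i\<in>I. f i x)"
  unfolding smooth_on_def by (auto intro: C_diff_sum)

lemma smooth_on_const: "smooth_on S (\<lambda>x. c)"
  unfolding smooth_on_def by (auto intro: C_diff_const)

lemma smooth_on_add: "open S \<Longrightarrow> smooth_on S f \<Longrightarrow> smooth_on S g \<Longrightarrow> smooth_on S (\<lambda>x. f x + g x)"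
  unfolding smooth_on_def by (auto intro: C_diff_add)

lemma smooth_on_diff: "open S \<Longrightarrow> smooth_on S f \<Longrightarrow> smooth_on S g \<Longrightarrow> smooth_on S (\<lambda>x. f x - g x)"
  unfolding smooth_on_def by (auto intro: C_diff_diff)

lemma smooth_on_mult:
  fixes f g :: "'v::real_normed_vector \<Rightarrow> real"
  shows "open S \<Longrightarrow> smooth_on S f \<Longrightarrow> smooth_on S g \<Longrightarrow> smooth_on S (\<lambda>x. f x * g x)"
  unfolding smooth_on_def by (auto intro: C_diff_mult)

lemma smooth_on_prod:
  fixes f :: "'i \<Rightarrow> 'v::real_normed_vector \<Rightarrow> real"
  shows "open S \<Longrightarrow> (\<And>i. i \<in> I \<Longrightarrow> smooth_on S (f i)) \<Longrightarrow> smooth_on S (\<lambda>x. \<Prod>i\<in>I. f i x)"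
  unfolding smooth_on_def by (auto intro: C_diff_prod)

lemma smooth_on_divide:
  fixes f g :: "'v::real_normed_vector \<Rightarrow> real"
  shows "open S \<Longrightarrow> smooth_on S f \<Longrightarrow> smooth_on S g \<Longrightarrow> (\<And>x. x \<in> S \<Longrightarrow> g x \<noteq> 0) \<Longrightarrow> smooth_on S (\<lambda>x. f x / g x)"
  unfolding smooth_on_def by (auto intro: C_diff_divide)

lemma smooth_on_cong: "open S \<Longrightarrow> (\<And>x. x \<in> S \<Longrightarrow> f x = g x) \<Longrightarrow> smooth_on S f \<Longrightarrow> smooth_on S g"
  unfolding smooth_on_def by (auto intro: C_diff_cong)

lemma smooth_on_C_diff: "smooth_on S f \<Longrightarrow> C_diff k S f"
  by (simp add: smooth_on_def)

lemma smooth_on_det: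
  fixes F :: "'v::real_normed_vector \<Rightarrow> real^'m::finite^'m"
  assumes "open S" "\<And>i j. smooth_on S (\<lambda>x. F x $ i $ j)"
  shows "smooth_on S (\<lambda>x. det (F x))"
  unfolding det_def using assms by (intro smooth_on_sum smooth_on_mult smooth_on_const smooth_on_prod) auto

section \<open>Partial derivatives of matrix-valued maps\<close>

lemma pd_uminus: "f differentiable (at x) \<Longrightarrow> pd i (\<lambda>y. - f y) x = - pd i f x"
  using pd_diff[of "\<lambda>y. 0" x f i] by simp

lemma pd_sum2:
  "finite A \<Longrightarrow> finite B \<Longrightarrow> (\<And>a b. f a b differentiable (at x)) \<Longrightarrow>
   pd i (\<lambda>y. \<Sum>a\<in>A. \<Sum>b\<in>B. f a b y) x = (\<Sum>a\<in>A. \<Sum>b\<in>B. pd i (f a b) x)"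
  by (subst pd_sum) (auto simp: pd_sum cong: sum.cong intro!: differentiable_sum sum.cong)

definition pd_mat :: "'n \<Rightarrow> (real^'n::finite \<Rightarrow> real^'n^'n) \<Rightarrow> real^'n \<Rightarrow> real^'n^'n" where
  "pd_mat i F x = (\<chi> a b. pd i (\<lambda>y. F y $ a $ b) x)"

lemma pd_mat_mult:
  assumes "\<And>a b. (\<lambda>y. F y $ a $ b) differentiable (at x)" "\<And>a b. (\<lambda>y. H y $ a $ b) differentiable (at x)"
  shows "pd_mat i (\<lambda>y. F y ** H y) x = pd_mat i F x ** H x + F x ** pd_mat i H x"
  using assms
  by (simp add: vec_eq_iff pd_mat_def matrix_matrix_mult_def pd_sum pd_mult differentiable_mult sum.distrib)

lemma matrix_mul_minus_left: "(- A) ** B = - (A ** (B :: real^'n^'n::finite))"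
  by (simp add: vec_eq_iff matrix_matrix_mult_def sum_negf)

lemma matrix_mul_minus_right: "A ** (- B) = - (A ** (B :: real^'n^'n::finite))"
  by (simp add: vec_eq_iff matrix_matrix_mult_def sum_negf)

lemma matrix_mul_add_left: "(A + B) ** C = A ** C + B ** (C :: real^'n^'n::finite)"
  by (simp add: vec_eq_iff matrix_matrix_mult_def distrib_right sum.distrib)

lemma matrix_mul_diff_left: "(A - B) ** C = A ** C - B ** (C :: real^'n^'n::finite)"
  by (simp add: vec_eq_iff matrix_matrix_mult_def left_diff_distrib sum_subtractf)

lemma matrix_mul_diff_right: "A ** (B - C) = A ** B - A ** (C :: real^'n^'n::finite)"
  by (simp add: vec_eq_iff matrix_matrix_mult_def right_diff_distrib sum_subtractf)

lemma matrix_mul_scaleR_left: "(c *\<^sub>R A) ** B = c *\<^sub>R (A ** (B :: real^'n^'n::finite))"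
  by (simp add: vec_eq_iff matrix_matrix_mult_def sum_distrib_left mult.assoc)

lemma matrix_mul_zero: "0 ** B = 0" "A ** 0 = (0 :: real^'n^'n::finite)"
  by (simp_all add: vec_eq_iff matrix_matrix_mult_def)

lemma matrix_mul_sum_left: "(\<Sum>i\<in>I. F i) ** B = (\<Sum>i\<in>I. F i ** (B :: real^'n^'n::finite))"
  by (induction I rule: infinite_finite_induct) (simp_all add: matrix_mul_add_left matrix_mul_zero)

lemma matrix_mul_sum_right: "A ** (\<Sum>i\<in>I. F i) = (\<Sum>i\<in>I. A ** (F i :: real^'n^'n::finite))"
  by (induction I rule: infinite_finite_induct) (simp_all add: matrix_add_ldistrib matrix_mul_zero)

lemma matrix_mul_scaleR_right: "A ** (c *\<^sub>R B) = c *\<^sub>R (A ** (B :: real^'n^'n::finite))"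
  by (simp add: vec_eq_iff matrix_matrix_mult_def sum_distrib_left mult.left_commute)

lemma trace_scaleR: "trace (c *\<^sub>R (A :: real^'n^'n::finite)) = c * trace A"
  by (simp add: trace_def sum_distrib_left)

lemmas matrix_ring_simps = matrix_add_ldistrib matrix_mul_add_left matrix_mul_diff_left matrix_mul_diff_right
  matrix_mul_assoc

section \<open>Curvature identities in a chart\<close>

locale metric_chart =
  fixes G :: "real^'n::finite \<Rightarrow> real^'n^'n" and V :: "(real^'n) set"
  assumes open_V: "open V" and smooth_G: "smooth_on V G"
    and G_sym: "\<And>x i j. x \<in> V \<Longrightarrow> G x $ i $ j = G x $ j $ i"
    and G_pos: "\<And>x v. x \<in> V \<Longrightarrow> v \<noteq> 0 \<Longrightarrow> 0 < v \<bullet> (G x *v v)"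
begin

text \<open>The basic facts about a metric in one chart carry the hypotheses on \<open>G\<close> and \<open>V\<close> as premises; here they become
  facts of the locale. Instantiating the pointwise hypotheses leaves trivial premises such as
  \<open>v \<noteq> 0 \<Longrightarrow> v \<noteq> 0\<close>, which \<open>discharge\<close> rewrites to \<open>True\<close>.\<close>

lemmas metric = open_V smooth_G G_sym G_pos
lemmas discharge = True_implies_equals implies_True_equals triv_forall_equality not_False_eq_True
lemmas G_smooth = Defs.G_smooth[OF metric, simplified discharge]
lemmas G_diff = Defs.G_diff[OF metric, simplified discharge]
lemmas G_inv = Defs.G_inv[OF metric, simplified discharge]
lemmas matrix_inv_props = Defs.matrix_inv_props[OF metric, simplified discharge]
lemmas ginv_G = Defs.ginv_G[OF metric, simplified discharge]
lemmas ginv_sym = Defs.ginv_sym[OF metric, simplified discharge]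
lemmas metric_compat = Defs.metric_compat[OF metric, simplified discharge]
lemmas riemann_antisym = Defs.riemann_antisym[OF metric, simplified discharge]
lemmas chr_sym = Defs.chr_sym[OF metric, simplified discharge]
lemmas X_smooth = Defs.X_smooth[OF metric, simplified discharge]
lemmas X_diff = Defs.X_diff[OF metric, simplified discharge]
lemmas dX_diff = Defs.dX_diff[OF metric, simplified discharge]
lemmas nabla_vec_diff = Defs.nabla_vec_diff[OF metric, simplified discharge]
lemmas nabla_form_flat = Defs.nabla_form_flat[OF metric, simplified discharge]
lemmas nabla_two_flat = Defs.nabla_two_flat[OF metric, simplified discharge]
lemmas nabla2_eq = Defs.nabla2_eq[OF metric, simplified discharge]
lemmas nabla2_def = Defs.nabla2_def[OF metric, simplified discharge]

lemma inv_G: "x \<in> V \<Longrightarrow> matrix_inv (G x) ** G x = mat 1"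
  by (rule matrix_inv_props(2))

lemma mul_inv_G: "x \<in> V \<Longrightarrow> G x ** matrix_inv (G x) = mat 1"
  by (rule matrix_inv_props(1))

lemma smooth_ginv: "smooth_on V (ginv G i j)"
proof -
  \<comment> \<open>By Cramer's rule the entries of the inverse matrix are quotients of determinants.\<close>
  let ?M = "\<lambda>y. \<chi> r s. if s = i then axis j 1 $ r else G y $ r $ s"
  have d: "det (G y) \<noteq> 0" if "y \<in> V" for y
    using G_inv[OF that] by (simp add: invertible_det_nz)
  have eq: "det (?M y) / det (G y) = ginv G i j y" if "y \<in> V" for y
  proof -
    have "G y *v (matrix_inv (G y) *v axis j 1) = axis j 1"
      by (simp add: matrix_vector_mul_assoc mul_inv_G[OF that])
    then have "(matrix_inv (G y) *v axis j 1) $ i = det (?M y) / det (G y)"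
      unfolding cramer[OF d[OF that]] by simp
    moreover have "(matrix_inv (G y) *v axis j 1) $ i = ginv G i j y"
      by (simp add: matrix_vector_mult_def axis_def ginv_def if_distrib cong: if_cong)
    ultimately show ?thesis by simp
  qed
  have "smooth_on V (\<lambda>y. ?M y $ r $ s)" for r s
    by (cases "s = i") (simp_all add: smooth_on_const G_smooth)
  then have "smooth_on V (\<lambda>y. det (?M y) / det (G y))"
    by (intro smooth_on_divide smooth_on_det open_V d G_smooth)
  then show ?thesis
    by (rule smooth_on_cong[OF open_V _, rotated]) (rule eq)
qed

lemma smooth_christoffel: "smooth_on V (christoffel G k i j)"
  unfolding christoffel_def[abs_def]
  by (intro smooth_on_mult smooth_on_const smooth_on_sum smooth_on_add smooth_on_diff smooth_ginv
      smooth_on_pd G_smooth open_V)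

lemma smooth_riemann: "smooth_on V (riemann G l k i j)"
  unfolding riemann_def[abs_def]
  by (intro smooth_on_mult smooth_on_sum smooth_on_add smooth_on_diff smooth_on_pd smooth_christoffel open_V)

lemma smooth_ricci: "smooth_on V (\<lambda>x. ricci G x $ j $ k)"
  unfolding ricci_def by (simp add: smooth_on_sum open_V smooth_riemann)

lemma smooth_scalar: "smooth_on V (scalar G)"
  unfolding scalar_def metric_trace_def[abs_def]
  by (intro smooth_on_mult smooth_on_sum smooth_ginv smooth_ricci open_V)

lemmas differentiable_facts =
  smooth_on_D[OF smooth_ginv] smooth_on_D[OF smooth_christoffel] smooth_on_D[OF smooth_riemann]
  smooth_on_D[OF smooth_ricci] G_diff

text \<open>Matrix notation keeps the second Bianchi identity short. With the connection matrices
  \<open>\<Gamma>\<^sub>i = (\<Gamma>\<^sup>a\<^sub>i\<^sub>k)\<^sub>a\<^sub>k\<close> the covariant derivative of vector fields is \<open>\<partial>\<^sub>i + \<Gamma>\<^sub>i\<close>, and the endomorphism \<open>R(\<partial>\<^sub>i, \<partial>\<^sub>j)\<close> is the curvature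
  \<open>\<partial>\<^sub>i \<Gamma>\<^sub>j - \<partial>\<^sub>j \<Gamma>\<^sub>i + [\<Gamma>\<^sub>i, \<Gamma>\<^sub>j]\<close>.\<close>

definition Gam where "Gam i x = (\<chi> a k. christoffel G a i k x)"
definition Riem where "Riem i j x = (\<chi> l k. riemann G l k i j x)"

lemma transpose_G: "x \<in> V \<Longrightarrow> transpose (G x) = G x"
  by (simp add: transpose_def vec_eq_iff G_sym)

lemma pd_mat_G:
  assumes "x \<in> V" shows "pd_mat i G x = transpose (Gam i x) ** G x + G x ** Gam i x"
  by (simp add: vec_eq_iff pd_mat_def metric_compat[OF assms] matrix_matrix_mult_def transpose_def Gam_def mult.commute)

text \<open>Differentiate \<open>G G\<^sup>-\<^sup>1 = 1\<close>: the inverse metric is parallel as well.\<close>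

lemma pd_mat_inv:
  assumes x: "x \<in> V"
  shows "pd_mat i (\<lambda>y. matrix_inv (G y)) x
    = - (Gam i x ** matrix_inv (G x) + matrix_inv (G x) ** transpose (Gam i x))"
proof -
  let ?H = "\<lambda>y. matrix_inv (G y)"
  have dH: "(\<lambda>y. ?H y $ a $ b) differentiable (at x)" for a b
    using differentiable_facts(1)[OF x] by (simp add: ginv_def[abs_def])
  have dG: "(\<lambda>y. G y $ a $ b) differentiable (at x)" for a b
    by (rule G_diff[OF x])
  have "pd_mat i (\<lambda>y. G y ** ?H y) x = 0"
  proof -
    have "pd i (\<lambda>y. (G y ** ?H y) $ a $ b) x = 0" for a b
    proof -
      have "pd i (\<lambda>y. (G y ** ?H y) $ a $ b) x = pd i (\<lambda>y. (mat 1 :: real^'n^'n) $ a $ b) x"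
        by (rule pd_cong[OF open_V x, symmetric]) (simp_all add: mul_inv_G)
      then show ?thesis by simp
    qed
    then show ?thesis by (simp add: pd_mat_def vec_eq_iff)
  qed
  then have "pd_mat i G x ** ?H x + G x ** pd_mat i ?H x = 0"
    by (simp add: pd_mat_mult[OF dG dH])
  then have "?H x ** (pd_mat i G x ** ?H x + G x ** pd_mat i ?H x) = 0"
    by (simp add: matrix_matrix_mult_def vec_eq_iff)
  then have "?H x ** pd_mat i G x ** ?H x + pd_mat i ?H x = 0"
    by (simp add: matrix_add_ldistrib matrix_mul_assoc inv_G[OF x])
  moreover have "?H x ** pd_mat i G x ** ?H x = ?H x ** transpose (Gam i x) + Gam i x ** ?H x"
    by (simp add: pd_mat_G[OF x] matrix_add_ldistrib matrix_mul_add_left matrix_mul_assoc inv_G[OF x])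
      (simp add: matrix_mul_assoc[symmetric] mul_inv_G[OF x])
  ultimately show ?thesis by (simp add: add_eq_0_iff2 add.commute)
qed

lemma ginv_compat:
  assumes x: "x \<in> V"
  shows "pd m (ginv G i j) x = - (\<Sum>a\<in>UNIV. christoffel G i m a x * ginv G a j x)
     - (\<Sum>a\<in>UNIV. christoffel G j m a x * ginv G i a x)"
  using arg_cong[OF pd_mat_inv[OF x, of m], of "\<lambda>M. M $ i $ j"]
  by (simp add: pd_mat_def ginv_def[abs_def] matrix_matrix_mult_def transpose_def Gam_def mult.commute)

text \<open>As \<open>\<nabla>g\<^sup>-\<^sup>1 = 0\<close>, contraction commutes with covariant differentiation. The components are an
  arbitrary family of functions, so that \<open>T\<close> may carry further indices whose correction terms do not take part
  in the contraction.\<close>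

lemma pd_metric_trace:
  assumes x: "x \<in> V" and T: "\<And>k j. T k j differentiable (at x)"
  shows "(\<Sum>k\<in>UNIV. \<Sum>j\<in>UNIV. ginv G k j x * (pd m (T k j) x
      - (\<Sum>a\<in>UNIV. christoffel G a m k x * T a j x) - (\<Sum>a\<in>UNIV. christoffel G a m j x * T k a x)))
    = pd m (\<lambda>y. \<Sum>k\<in>UNIV. \<Sum>j\<in>UNIV. ginv G k j y * T k j y) x"
proof -
  let ?C = "\<lambda>a k. christoffel G a m k x" and ?h = "\<lambda>i j. ginv G i j x" and ?T = "\<lambda>k j. T k j x"
  have "pd m (\<lambda>y. \<Sum>k\<in>UNIV. \<Sum>j\<in>UNIV. ginv G k j y * T k j y) x
     = (\<Sum>k\<in>UNIV. \<Sum>j\<in>UNIV. pd m (ginv G k j) x * ?T k j + ?h k j * pd m (T k j) x)"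
    by (subst pd_sum2) (auto simp: pd_mult T differentiable_facts[OF x] intro!: differentiable_mult T differentiable_facts x)
  also have "\<dots> = (\<Sum>k\<in>UNIV. \<Sum>j\<in>UNIV. ?h k j * pd m (T k j) x)
      - (\<Sum>k\<in>UNIV. \<Sum>j\<in>UNIV. \<Sum>a\<in>UNIV. ?C k a * ?h a j * ?T k j) - (\<Sum>k\<in>UNIV. \<Sum>j\<in>UNIV. \<Sum>a\<in>UNIV. ?C j a * ?h k a * ?T k j)"
    by (simp add: ginv_compat[OF x] sum.distrib sum_subtractf left_diff_distrib sum_distrib_right sum_negf)
  also have "(\<Sum>k\<in>UNIV. \<Sum>j\<in>UNIV. \<Sum>a\<in>UNIV. ?C k a * ?h a j * ?T k j) = (\<Sum>k\<in>UNIV. \<Sum>j\<in>UNIV. ?h k j * (\<Sum>a\<in>UNIV. ?C a k * ?T a j))"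
  proof -
    have "(\<Sum>k\<in>UNIV. \<Sum>j\<in>UNIV. \<Sum>a\<in>UNIV. ?C k a * ?h a j * ?T k j) = (\<Sum>k\<in>UNIV. \<Sum>a\<in>UNIV. \<Sum>j\<in>UNIV. ?C k a * ?h a j * ?T k j)"
      by (intro sum.cong refl sum.swap)
    also have "\<dots> = (\<Sum>a\<in>UNIV. \<Sum>k\<in>UNIV. \<Sum>j\<in>UNIV. ?C k a * ?h a j * ?T k j)" by (rule sum.swap)
    also have "\<dots> = (\<Sum>a\<in>UNIV. \<Sum>j\<in>UNIV. \<Sum>k\<in>UNIV. ?C k a * ?h a j * ?T k j)" by (intro sum.cong refl sum.swap)
    finally show ?thesis by (simp add: sum_distrib_left mult_ac)
  qed
  also have "(\<Sum>k\<in>UNIV. \<Sum>j\<in>UNIV. \<Sum>a\<in>UNIV. ?C j a * ?h k a * ?T k j) = (\<Sum>k\<in>UNIV. \<Sum>j\<in>UNIV. ?h k j * (\<Sum>a\<in>UNIV. ?C a j * ?T k a))"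
  proof -
    have "(\<Sum>k\<in>UNIV. \<Sum>j\<in>UNIV. \<Sum>a\<in>UNIV. ?C j a * ?h k a * ?T k j) = (\<Sum>k\<in>UNIV. \<Sum>a\<in>UNIV. \<Sum>j\<in>UNIV. ?C j a * ?h k a * ?T k j)"
      by (intro sum.cong refl sum.swap)
    then show ?thesis by (simp add: sum_distrib_left mult_ac)
  qed
  finally show ?thesis by (simp add: right_diff_distrib sum_subtractf)
qed

text \<open>The same principle for raising one index: \<open>\<nabla>\<^sub>m (g\<^sup>k\<^sup>p T\<^sub>p) = g\<^sup>k\<^sup>p \<nabla>\<^sub>m T\<^sub>p\<close>.\<close>

lemma pd_raise:
  assumes x: "x \<in> V" and T: "\<And>p. T p differentiable (at x)"
  shows "pd m (\<lambda>y. \<Sum>p\<in>UNIV. ginv G k p y * T p y) x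
      + (\<Sum>a\<in>UNIV. christoffel G k m a x * (\<Sum>p\<in>UNIV. ginv G a p x * T p x))
    = (\<Sum>p\<in>UNIV. ginv G k p x * (pd m (T p) x - (\<Sum>a\<in>UNIV. christoffel G a m p x * T a x)))"
proof -
  let ?C = "\<lambda>a k. christoffel G a m k x" and ?h = "\<lambda>i j. ginv G i j x" and ?T = "\<lambda>k. T k x"
  have "pd m (\<lambda>y. \<Sum>p\<in>UNIV. ginv G k p y * T p y) x = (\<Sum>p\<in>UNIV. pd m (ginv G k p) x * ?T p + ?h k p * pd m (T p) x)"
    by (subst pd_sum) (auto simp: pd_mult T differentiable_facts[OF x] intro!: differentiable_mult T differentiable_facts x)
  also have "\<dots> = (\<Sum>p\<in>UNIV. ?h k p * pd m (T p) x) - (\<Sum>p\<in>UNIV. \<Sum>a\<in>UNIV. ?C k a * ?h a p * ?T p)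
      - (\<Sum>p\<in>UNIV. \<Sum>a\<in>UNIV. ?C p a * ?h k a * ?T p)"
    by (simp add: ginv_compat[OF x] sum.distrib sum_subtractf left_diff_distrib sum_distrib_right sum_negf)
  also have "(\<Sum>p\<in>UNIV. \<Sum>a\<in>UNIV. ?C k a * ?h a p * ?T p) = (\<Sum>a\<in>UNIV. ?C k a * (\<Sum>p\<in>UNIV. ?h a p * ?T p))"
    by (subst sum.swap) (simp add: sum_distrib_left mult_ac)
  also have "(\<Sum>p\<in>UNIV. \<Sum>a\<in>UNIV. ?C p a * ?h k a * ?T p) = (\<Sum>p\<in>UNIV. ?h k p * (\<Sum>a\<in>UNIV. ?C a p * ?T a))"
    by (subst sum.swap) (simp add: sum_distrib_left mult_ac)
  finally show ?thesis by (simp add: right_diff_distrib sum_subtractf)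
qed

lemma Riem_eq:
  "Riem i j x = pd_mat i (Gam j) x - pd_mat j (Gam i) x + Gam i x ** Gam j x - Gam j x ** Gam i x"
  by (simp add: vec_eq_iff Riem_def riemann_def pd_mat_def Gam_def matrix_matrix_mult_def)

lemma Riem_swap: "Riem j i x = - Riem i j x"
  by (simp add: Riem_eq)

lemma Riem_diff: "x \<in> V \<Longrightarrow> (\<lambda>y. Riem i j y $ a $ b) differentiable (at x)"
  by (simp add: Riem_def differentiable_facts)

text \<open>The metric skew-symmetry of \<open>R(\<partial>\<^sub>i, \<partial>\<^sub>j)\<close>, multiplied by \<open>G\<^sup>-\<^sup>1\<close> from both sides.\<close>

lemma Riem_inv:
  assumes x: "x \<in> V"
  shows "Riem i j x ** matrix_inv (G x) = - (matrix_inv (G x) ** transpose (Riem i j x))"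
proof -
  have "(\<Sum>a\<in>UNIV. G x $ p $ a * riemann G a k i j x) = - (\<Sum>a\<in>UNIV. riemann G a p i j x * G x $ a $ k)" for p k
    by (subst riemann_antisym[OF x]) (simp add: G_sym[OF x, of k] mult.commute)
  then have "G x ** Riem i j x = - (transpose (Riem i j x) ** G x)"
    by (simp add: vec_eq_iff matrix_matrix_mult_def Riem_def transpose_def)
  then have "matrix_inv (G x) ** (G x ** Riem i j x) ** matrix_inv (G x)
     = matrix_inv (G x) ** (- (transpose (Riem i j x) ** G x)) ** matrix_inv (G x)" by simp
  then show ?thesis
    by (simp add: matrix_mul_assoc inv_G[OF x] matrix_mul_minus_left matrix_mul_minus_right)
      (simp add: matrix_mul_assoc[symmetric] mul_inv_G[OF x])
qed

text \<open>A skew-symmetric endomorphism has trace \<open>0\<close>.\<close>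

lemma trace_Riem: assumes x: "x \<in> V" shows "(\<Sum>i\<in>UNIV. riemann G i i j k x) = 0"
proof -
  let ?R = "Riem j k x" and ?H = "matrix_inv (G x)"
  have "trace ?R = trace (?R ** ?H ** G x)"
    by (simp add: matrix_mul_assoc[symmetric] inv_G[OF x])
  also have "\<dots> = - trace (?H ** (transpose ?R ** G x))"
    by (simp add: Riem_inv[OF x] matrix_mul_minus_left matrix_mul_assoc trace_def sum_negf)
  also have "trace (?H ** (transpose ?R ** G x)) = trace ((transpose ?R ** G x) ** ?H)"
    by (rule trace_mul_sym)
  also have "\<dots> = trace ?R"
    by (simp add: matrix_mul_assoc[symmetric] mul_inv_G[OF x]) (simp add: trace_def transpose_def)
  finally show ?thesis by (simp add: trace_def Riem_def)
qed

text \<open>The Christoffel symbols are symmetric, so all terms of the cyclic sum cancel in pairs.\<close>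

lemma first_Bianchi:
  assumes x: "x \<in> V"
  shows "riemann G l k i j x + riemann G l i j k x + riemann G l j k i x = 0"
proof -
  have sym: "pd m (christoffel G l a b) x = pd m (christoffel G l b a) x" for m a b
    by (rule pd_cong[OF open_V x]) (auto simp: differentiable_facts x chr_sym)
  show ?thesis
    unfolding riemann_def chr_sym[OF x, of _ k j] chr_sym[OF x, of _ k i] chr_sym[OF x, of _ j i]
    using sym[of i j k] sym[of j k i] sym[of k i j] by linarith
qed

text \<open>Contract the first Bianchi identity; one of the three terms is the trace of \<open>R(\<partial>\<^sub>j, \<partial>\<^sub>k)\<close>, which vanishes.\<close>

lemma ricci_sym: assumes x: "x \<in> V" shows "ricci G x $ j $ k = ricci G x $ k $ j"
proof -
  have anti: "riemann G i j k i x = - riemann G i j i k x" for i by (simp add: riemann_def)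
  have "(\<Sum>i\<in>UNIV. riemann G i k i j x + riemann G i i j k x + riemann G i j k i x) = 0"
    by (simp add: first_Bianchi[OF x])
  then show ?thesis
    by (simp add: sum.distrib sum_subtractf trace_Riem[OF x] anti sum_negf ricci_def)
qed

lemma pd_mat_Riem:
  assumes x: "x \<in> V"
  shows "pd_mat m (Riem i j) x = pd_mat m (pd_mat i (Gam j)) x - pd_mat m (pd_mat j (Gam i)) x
     + (pd_mat m (Gam i) x ** Gam j x + Gam i x ** pd_mat m (Gam j) x)
     - (pd_mat m (Gam j) x ** Gam i x + Gam j x ** pd_mat m (Gam i) x)"
proof -
  have d: "(\<lambda>y. Gam i y $ a $ b) differentiable (at x)" for i a b
    by (simp add: Gam_def differentiable_facts x)
  have dd: "(\<lambda>y. pd_mat j (Gam i) y $ a $ b) differentiable (at x)" for i j a b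
    using smooth_on_D[OF smooth_on_pd[OF smooth_christoffel] x]
    by (simp add: pd_mat_def Gam_def)
  have dm: "(\<lambda>y. (Gam i y ** Gam j y) $ a $ b) differentiable (at x)" for i j a b
    by (simp add: matrix_matrix_mult_def d differentiable_mult)
  show ?thesis
    unfolding pd_mat_mult[OF d d, symmetric]
    by (simp add: pd_mat_def[of m] vec_eq_iff Riem_eq pd_add pd_diff d dd dm)
qed

lemma pd_mat_commute:
  assumes x: "x \<in> V" shows "pd_mat m (pd_mat i (Gam j)) x = pd_mat i (pd_mat m (Gam j)) x"
  using pd_commute[OF smooth_christoffel open_V x]
  by (simp add: pd_mat_def Gam_def vec_eq_iff)

text \<open>The endomorphism \<open>(\<nabla>\<^sub>m R)(\<partial>\<^sub>i, \<partial>\<^sub>j)\<close>.\<close>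

definition DRiem where
  "DRiem m i j x = pd_mat m (Riem i j) x + Gam m x ** Riem i j x - Riem i j x ** Gam m x
     - (\<Sum>a\<in>UNIV. christoffel G a m i x *\<^sub>R Riem a j x) - (\<Sum>a\<in>UNIV. christoffel G a m j x *\<^sub>R Riem i a x)"

text \<open>In the cyclic sum, the second derivatives of \<open>\<Gamma>\<close> cancel because they commute, the commutators
  cancel as in the Jacobi identity, and the corrections for the indices of \<open>\<partial>\<^sub>i\<close> and \<open>\<partial>\<^sub>j\<close> cancel by the symmetry of \<open>\<Gamma>\<close>.\<close>

lemma second_Bianchi:
  assumes x: "x \<in> V"
  shows "DRiem m i j x + DRiem i j m x + DRiem j m i x = 0"
proof -
  let ?E = "\<lambda>m i j. pd_mat m (Riem i j) x + Gam m x ** Riem i j x - Riem i j x ** Gam m x"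
  let ?S = "\<lambda>m i j. \<Sum>a\<in>UNIV. christoffel G a m i x *\<^sub>R Riem a j x"
  have 1: "?E m i j + ?E i j m + ?E j m i = 0"
    unfolding pd_mat_Riem[OF x] Riem_eq
    using pd_mat_commute[OF x, of m i j] pd_mat_commute[OF x, of m j i] pd_mat_commute[OF x, of j i m]
    by (simp add: matrix_ring_simps)
  have 2: "(\<Sum>a\<in>UNIV. christoffel G a m j x *\<^sub>R Riem i a x) = - ?S j m i" for m i j
    by (simp add: sum_negf[symmetric] Riem_swap[of _ i] chr_sym[OF x, of _ m j])
  show ?thesis unfolding DRiem_def 2 using 1 by (simp add: algebra_simps)
qed

lemma DRiem_swap:
  assumes x: "x \<in> V" shows "DRiem m j i x = - DRiem m i j x"
proof -
  have "pd_mat m (Riem j i) x = - pd_mat m (Riem i j) x"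
    by (simp add: pd_mat_def vec_eq_iff Riem_swap[of j i] pd_uminus[OF Riem_diff[OF x]])
  then show ?thesis
    by (simp add: DRiem_def Riem_swap[of j i] Riem_swap[of j] Riem_swap[of _ i] matrix_mul_minus_left matrix_mul_minus_right sum_negf)
qed

lemma DRiem_nth:
  "DRiem m i j x $ l $ k = pd m (riemann G l k i j) x + (\<Sum>a\<in>UNIV. christoffel G l m a x * riemann G a k i j x)
     - (\<Sum>a\<in>UNIV. christoffel G a m k x * riemann G l a i j x)
     - (\<Sum>a\<in>UNIV. christoffel G a m i x * riemann G l k a j x) - (\<Sum>a\<in>UNIV. christoffel G a m j x * riemann G l k i a x)"
  by (simp add: DRiem_def pd_mat_def Riem_def Gam_def matrix_matrix_mult_def mult.commute)

lemma contract_DRiem: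
  assumes x: "x \<in> V"
  shows "(\<Sum>i\<in>UNIV. DRiem m i j x $ i $ k) = nabla_two G (ricci G) x $ m $ j $ k"
proof -
  let ?C = "\<lambda>l m a. christoffel G l m a x" and ?R = "\<lambda>l k i j. riemann G l k i j x"
  have 1: "(\<Sum>i\<in>UNIV. \<Sum>a\<in>UNIV. ?C i m a * ?R a k i j) = (\<Sum>i\<in>UNIV. \<Sum>a\<in>UNIV. ?C a m i * ?R i k a j)"
    by (rule sum.swap)
  have 2: "(\<Sum>i\<in>UNIV. \<Sum>a\<in>UNIV. ?C a m k * ?R i a i j) = (\<Sum>a\<in>UNIV. ?C a m k * ricci G x $ j $ a)"
    by (subst sum.swap) (simp add: ricci_def sum_distrib_left)
  have 3: "(\<Sum>i\<in>UNIV. \<Sum>a\<in>UNIV. ?C a m j * ?R i k i a) = (\<Sum>a\<in>UNIV. ?C a m j * ricci G x $ a $ k)"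
    by (subst sum.swap) (simp add: ricci_def sum_distrib_left)
  have 4: "pd m (\<lambda>y. ricci G y $ j $ k) x = (\<Sum>i\<in>UNIV. pd m (riemann G i k i j) x)"
    by (simp add: ricci_def pd_sum differentiable_facts x)
  show ?thesis
    by (simp add: DRiem_nth sum.distrib sum_subtractf 1 2 3 nabla_two_def 4)
qed

text \<open>By the skew-symmetry of \<open>R(\<partial>\<^sub>j, \<partial>\<^sub>m)\<close> this contraction is the Ricci tensor again: \<open>g\<^sup>k\<^sup>j R\<^sup>i\<^sub>k\<^sub>j\<^sub>m = - g\<^sup>i\<^sup>p R\<^sub>m\<^sub>p\<close>.\<close>

lemma trace_riemann_ginv:
  assumes x: "x \<in> V"
  shows "(\<Sum>k\<in>UNIV. \<Sum>j\<in>UNIV. ginv G k j x * riemann G i k j m x) = - (\<Sum>p\<in>UNIV. ginv G i p x * ricci G x $ m $ p)"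
proof -
  have "(\<Sum>k\<in>UNIV. ginv G k j x * riemann G i k j m x) = - (\<Sum>p\<in>UNIV. ginv G i p x * riemann G j p j m x)" for j
    using arg_cong[OF Riem_inv[OF x, of j m], of "\<lambda>M. M $ i $ j"]
    by (simp add: matrix_matrix_mult_def Riem_def transpose_def ginv_def mult.commute)
  then have "(\<Sum>j\<in>UNIV. \<Sum>k\<in>UNIV. ginv G k j x * riemann G i k j m x) = - (\<Sum>j\<in>UNIV. \<Sum>p\<in>UNIV. ginv G i p x * riemann G j p j m x)"
    by (simp add: sum_negf)
  also have "\<dots> = - (\<Sum>p\<in>UNIV. ginv G i p x * ricci G x $ m $ p)"
    by (subst sum.swap) (simp add: ricci_def sum_distrib_left)
  finally show ?thesis by (subst sum.swap)
qed

text \<open>Contracting the second Bianchi identity over \<open>i\<close> turns it into \<open>\<nabla>\<^sub>m R\<^sub>j\<^sub>k + \<nabla>\<^sub>i R\<^sup>i\<^sub>k\<^sub>j\<^sub>m - \<nabla>\<^sub>j R\<^sub>m\<^sub>k = 0\<close>; the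
  contraction with \<open>g\<^sup>k\<^sup>j\<close> then gives \<open>\<partial>\<^sub>m s - 2 \<nabla>\<^sup>i R\<^sub>i\<^sub>m = 0\<close>.\<close>

lemma contracted_Bianchi:
  assumes x: "x \<in> V"
  shows "delta G (ricci G) x $ m = - (1/2) * pd m (scalar G) x"
proof -
  let ?C = "\<lambda>l m a. christoffel G l m a x" and ?R = "\<lambda>l k i j. riemann G l k i j x" and ?h = "\<lambda>k j. ginv G k j x"
  let ?N = "nabla_two G (ricci G) x"
  \<comment> \<open>The mixed tensor \<open>g\<^sup>k\<^sup>j R\<^sup>i\<^sub>k\<^sub>j\<^sub>m = - R\<^sup>i\<^sub>m\<close>: contracting before differentiating lets the middle term be computed from \<open>Ric\<close>.\<close>
  define Q where "Q i m y = (\<Sum>k\<in>UNIV. \<Sum>j\<in>UNIV. ginv G k j y * riemann G i k j m y)" for i m y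
  have N_sym: "?N $ i $ a $ b = ?N $ i $ b $ a" for i a b
  proof -
    have "pd i (\<lambda>y. ricci G y $ a $ b) x = pd i (\<lambda>y. ricci G y $ b $ a) x"
      by (rule pd_cong[OF open_V x]) (auto simp: differentiable_facts x ricci_sym)
    then show ?thesis by (simp add: nabla_two_def ricci_sym[OF x])
  qed
  have contr: "?N $ m $ j $ k + (\<Sum>i\<in>UNIV. DRiem i j m x $ i $ k) - ?N $ j $ m $ k = 0" for k j
  proof -
    have "(\<Sum>i\<in>UNIV. (DRiem m i j x + DRiem i j m x + DRiem j m i x) $ i $ k) = 0"
      unfolding second_Bianchi[OF x] by simp
    then show ?thesis
      by (simp add: sum.distrib sum_subtractf DRiem_swap[OF x, of j m] sum_negf contract_DRiem[OF x])
  qed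
  have 1: "(\<Sum>k\<in>UNIV. \<Sum>j\<in>UNIV. ?h k j * ?N $ m $ j $ k) = pd m (scalar G) x"
  proof -
    have "(\<Sum>k\<in>UNIV. \<Sum>j\<in>UNIV. ?h k j * ?N $ m $ j $ k) = (\<Sum>k\<in>UNIV. \<Sum>j\<in>UNIV. ?h k j * ?N $ m $ k $ j)"
      by (simp add: N_sym[of m])
    also have "\<dots> = pd m (scalar G) x"
      using pd_metric_trace[OF x, of "\<lambda>k j y. ricci G y $ k $ j" m]
      by (simp add: differentiable_facts x nabla_two_def scalar_def metric_trace_def[abs_def])
    finally show ?thesis .
  qed
  have 2: "(\<Sum>k\<in>UNIV. \<Sum>j\<in>UNIV. ?h k j * ?N $ j $ m $ k) = - delta G (ricci G) x $ m"
    by (subst sum.swap) (simp add: delta_def ginv_sym[OF x] N_sym[of _ m])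
  have Qr: "Q i m y = - (\<Sum>p\<in>UNIV. ginv G i p y * ricci G y $ m $ p)" if "y \<in> V" for i m y
    unfolding Q_def by (rule trace_riemann_ginv[OF that])
  have 3: "(\<Sum>k\<in>UNIV. \<Sum>j\<in>UNIV. ?h k j * DRiem i j m x $ i $ k)
      = pd i (Q i m) x + (\<Sum>a\<in>UNIV. ?C i i a * Q a m x) - (\<Sum>a\<in>UNIV. ?C a i m * Q i a x)" for i
  proof -
    have "pd i (Q i m) x = (\<Sum>k\<in>UNIV. \<Sum>j\<in>UNIV. ?h k j * (pd i (riemann G i k j m) x
      - (\<Sum>a\<in>UNIV. ?C a i k * ?R i a j m) - (\<Sum>a\<in>UNIV. ?C a i j * ?R i k a m)))"
      unfolding Q_def[abs_def] by (rule pd_metric_trace[OF x, symmetric]) (simp add: differentiable_facts x)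
    moreover have sw: "(\<Sum>a\<in>UNIV. D a * (\<Sum>k\<in>UNIV. \<Sum>j\<in>UNIV. ?h k j * W a k j))
      = (\<Sum>k\<in>UNIV. \<Sum>j\<in>UNIV. ?h k j * (\<Sum>a\<in>UNIV. D a * W a k j))" for D W
    proof -
      have "(\<Sum>a\<in>UNIV. D a * (\<Sum>k\<in>UNIV. \<Sum>j\<in>UNIV. ?h k j * W a k j)) = (\<Sum>a\<in>UNIV. \<Sum>k\<in>UNIV. \<Sum>j\<in>UNIV. ?h k j * (D a * W a k j))"
        by (simp add: sum_distrib_left mult_ac)
      also have "\<dots> = (\<Sum>k\<in>UNIV. \<Sum>a\<in>UNIV. \<Sum>j\<in>UNIV. ?h k j * (D a * W a k j))" by (rule sum.swap)
      also have "\<dots> = (\<Sum>k\<in>UNIV. \<Sum>j\<in>UNIV. \<Sum>a\<in>UNIV. ?h k j * (D a * W a k j))" by (intro sum.cong refl sum.swap)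
      finally show ?thesis by (simp add: sum_distrib_left)
    qed
    ultimately show ?thesis
      unfolding Q_def[of _ _ x] sw
      by (simp add: DRiem_nth distrib_left right_diff_distrib sum.distrib sum_subtractf)
  qed
  have 4: "pd i (Q i m) x + (\<Sum>a\<in>UNIV. ?C i i a * Q a m x) - (\<Sum>a\<in>UNIV. ?C a i m * Q i a x)
     = - (\<Sum>p\<in>UNIV. ?h i p * ?N $ i $ m $ p)" for i
  proof -
    have dS: "(\<lambda>y. \<Sum>p\<in>UNIV. ginv G i p y * ricci G y $ m $ p) differentiable (at x)"
      by (auto intro!: differentiable_sum differentiable_mult differentiable_facts x)
    have "pd i (Q i m) x = pd i (\<lambda>y. - (\<Sum>p\<in>UNIV. ginv G i p y * ricci G y $ m $ p)) x"
      by (rule pd_cong[OF open_V x, symmetric]) (auto simp: Qr intro!: differentiable_minus dS)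
    also have "\<dots> = - pd i (\<lambda>y. \<Sum>p\<in>UNIV. ginv G i p y * ricci G y $ m $ p) x"
      by (rule pd_uminus[OF dS])
    finally have a: "pd i (Q i m) x + (\<Sum>a\<in>UNIV. ?C i i a * Q a m x)
      = - (\<Sum>p\<in>UNIV. ?h i p * (pd i (\<lambda>y. ricci G y $ m $ p) x - (\<Sum>a\<in>UNIV. ?C a i p * ricci G x $ m $ a)))"
      using pd_raise[OF x, of "\<lambda>p y. ricci G y $ m $ p" i i]
      by (simp add: Qr[OF x] sum_negf differentiable_facts x)
    have b: "(\<Sum>a\<in>UNIV. ?C a i m * Q i a x) = - (\<Sum>p\<in>UNIV. ?h i p * (\<Sum>a\<in>UNIV. ?C a i m * ricci G x $ a $ p))"
      by (simp add: Qr[OF x] sum_negf sum_distrib_left mult_ac) (subst sum.swap, simp)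
    show ?thesis
      unfolding a b by (simp add: nabla_two_def right_diff_distrib sum_subtractf)
  qed
  have 5: "(\<Sum>k\<in>UNIV. \<Sum>j\<in>UNIV. ?h k j * (\<Sum>i\<in>UNIV. DRiem i j m x $ i $ k)) = delta G (ricci G) x $ m"
  proof -
    have "(\<Sum>k\<in>UNIV. \<Sum>j\<in>UNIV. ?h k j * (\<Sum>i\<in>UNIV. DRiem i j m x $ i $ k))
       = (\<Sum>k\<in>UNIV. \<Sum>i\<in>UNIV. \<Sum>j\<in>UNIV. ?h k j * DRiem i j m x $ i $ k)"
      by (simp add: sum_distrib_left) (intro sum.cong refl sum.swap)
    also have "\<dots> = (\<Sum>i\<in>UNIV. \<Sum>k\<in>UNIV. \<Sum>j\<in>UNIV. ?h k j * DRiem i j m x $ i $ k)" by (rule sum.swap)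
    also have "\<dots> = delta G (ricci G) x $ m"
      unfolding 3 4 by (simp add: delta_def sum_negf N_sym[of _ m])
    finally show ?thesis .
  qed
  have "(\<Sum>k\<in>UNIV. \<Sum>j\<in>UNIV. ?h k j * (?N $ m $ j $ k + (\<Sum>i\<in>UNIV. DRiem i j m x $ i $ k) - ?N $ j $ m $ k)) = 0"
    by (simp add: contr)
  then have "pd m (scalar G) x + delta G (ricci G) x $ m + delta G (ricci G) x $ m = 0"
    unfolding distrib_left right_diff_distrib sum.distrib sum_subtractf 1 2 5 by simp
  then show ?thesis by simp
qed

end

section \<open>Positive definite matrices\<close>

text \<open>The Gram-Schmidt process for the scalar product \<open>u \<bullet> A v\<close>.\<close>

lemma pos_def_orthonormal_family:
  fixes A :: "real^'n::finite^'n"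
  assumes sym: "transpose A = A" and pos: "\<And>v. v \<noteq> 0 \<Longrightarrow> 0 < v \<bullet> (A *v v)"
  shows "k \<le> CARD('n) \<Longrightarrow> \<exists>E. finite E \<and> card E = k \<and> (\<forall>u\<in>E. \<forall>v\<in>E. u \<bullet> (A *v v) = (if u = v then 1 else 0))"
proof (induction k)
  case 0
  show ?case by (intro exI[of _ "{}"]) simp
next
  case (Suc k)
  then obtain E where E: "finite E" "card E = k" "\<And>u v. u \<in> E \<Longrightarrow> v \<in> E \<Longrightarrow> u \<bullet> (A *v v) = (if u = v then 1 else 0)"
    by auto
  have "dim (span E) < CARD('n)"
    using dim_le_card'[OF E(1)] E(2) Suc.prems by simp
  then have "span E \<noteq> UNIV" by (metis dim_UNIV DIM_cart DIM_real mult_1_right less_irrefl)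
  then obtain v where v: "v \<notin> span E" by auto
  define w where "w = v - (\<Sum>e\<in>E. (e \<bullet> (A *v v)) *\<^sub>R e)"
  have "w \<noteq> 0"
  proof
    assume "w = 0"
    then have "v = (\<Sum>e\<in>E. (e \<bullet> (A *v v)) *\<^sub>R e)" by (simp add: w_def)
    moreover have "\<dots> \<in> span E" by (intro span_sum span_scale span_base)
    ultimately show False using v by simp
  qed
  have swap: "a \<bullet> (A *v b) = b \<bullet> (A *v a)" for a b
    by (metis dot_lmul_matrix inner_commute sym transpose_matrix_vector)
  have we: "e \<bullet> (A *v w) = 0" if "e \<in> E" for e
  proof -
    have "e \<bullet> (A *v (\<Sum>d\<in>E. (d \<bullet> (A *v v)) *\<^sub>R d)) = (\<Sum>d\<in>E. (d \<bullet> (A *v v)) * (e \<bullet> (A *v d)))"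
      by (simp add: matrix_vector_mult_scaleR linear_sum[OF matrix_vector_mul_linear] inner_sum_right)
    also have "\<dots> = (\<Sum>d\<in>E. if d = e then e \<bullet> (A *v v) else 0)"
      by (intro sum.cong refl) (simp add: E(3)[OF that])
    also have "\<dots> = e \<bullet> (A *v v)"
      using E(1) that by simp
    finally show ?thesis by (simp add: w_def matrix_vector_mult_diff_distrib inner_diff_right)
  qed
  define q where "q = w \<bullet> (A *v w)"
  have q: "0 < q" using pos[OF \<open>w \<noteq> 0\<close>] by (simp add: q_def)
  define u where "u = (1 / sqrt q) *\<^sub>R w"
  have uu: "u \<bullet> (A *v u) = 1"
    using q by (simp add: u_def matrix_vector_mult_scaleR q_def[symmetric])
  have ue: "e \<bullet> (A *v u) = 0" "u \<bullet> (A *v e) = 0" if "e \<in> E" for e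
    using we[OF that] swap[of u e] by (simp_all add: u_def matrix_vector_mult_scaleR)
  then have "u \<notin> E" using uu by fastforce
  then have "finite (insert u E) \<and> card (insert u E) = Suc k \<and>
      (\<forall>a\<in>insert u E. \<forall>b\<in>insert u E. a \<bullet> (A *v b) = (if a = b then 1 else 0))"
    using E uu ue by auto
  then show ?case by blast
qed

lemma pos_def_congruent_identity:
  fixes A :: "real^'n::finite^'n"
  assumes sym: "transpose A = A" and pos: "\<And>v. v \<noteq> 0 \<Longrightarrow> 0 < v \<bullet> (A *v v)"
  shows "\<exists>P :: real^'n^'n. transpose P ** A ** P = mat 1"
proof -
  obtain E where E: "finite E" "card E = CARD('n)" "\<And>u v. u \<in> E \<Longrightarrow> v \<in> E \<Longrightarrow> u \<bullet> (A *v v) = (if u = v then 1 else 0)"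
    using pos_def_orthonormal_family[OF assms order_refl] by blast
  obtain f where f: "bij_betw f (UNIV :: 'n set) E"
    using finite_same_card_bij[of "UNIV :: 'n set" E] E by auto
  define P :: "real^'n^'n" where "P = (\<chi> i j. f j $ i)"
  have "(transpose P ** A ** P) $ i $ j = (mat 1 :: real^'n^'n) $ i $ j" for i j
  proof -
    have "(transpose P ** A ** P) $ i $ j = f i \<bullet> (A *v f j)"
      by (simp add: matrix_mul_assoc[symmetric])
        (simp add: matrix_matrix_mult_def transpose_def P_def inner_vec_def matrix_vector_mult_def)
    also have "\<dots> = (if f i = f j then 1 else 0)"
      using E(3) f by (meson bij_betwE UNIV_I)
    also have "\<dots> = (mat 1 :: real^'n^'n) $ i $ j"
      using f by (auto simp: mat_def bij_betw_def inj_on_def)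
    finally show ?thesis .
  qed
  then have "transpose P ** A ** P = mat 1" by (simp add: vec_eq_iff)
  then show ?thesis by blast
qed

text \<open>The pointwise norm \<open>|S|\<^sup>2\<close> of a symmetric two-tensor with respect to the metric \<open>A\<close> is \<open>trace (A\<^sup>-\<^sup>1 S A\<^sup>-\<^sup>1 S)\<close>. If the columns of \<open>P\<close> are an
  orthonormal basis then \<open>A\<^sup>-\<^sup>1 = P P\<^sup>T\<close>, so the norm is the sum of the squares of the entries of \<open>P\<^sup>T S P\<close>.\<close>

lemma trace_square_nonneg:
  fixes A S :: "real^'n::finite^'n"
  assumes sym: "transpose A = A" and pos: "\<And>v. v \<noteq> 0 \<Longrightarrow> 0 < v \<bullet> (A *v v)"
    and H: "H ** A = mat 1" and S: "transpose S = S"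
  shows "0 \<le> trace (H ** S ** H ** S)" "trace (H ** S ** H ** S) = 0 \<Longrightarrow> S = 0"
proof -
  obtain P :: "real^'n^'n" where P: "transpose P ** A ** P = mat 1" using pos_def_congruent_identity[OF sym pos] by blast
  have PA: "P ** transpose P ** A = mat 1"
    using P matrix_left_right_inverse[of "transpose P ** A" P] by (simp add: matrix_mul_assoc)
  then have AP: "A ** (P ** transpose P) = mat 1"
    by (simp add: matrix_left_right_inverse)
  have HP: "H = P ** transpose P"
  proof -
    have "H = H ** (A ** (P ** transpose P))" by (simp add: AP)
    also have "\<dots> = P ** transpose P" by (simp add: matrix_mul_assoc H)
    finally show ?thesis .
  qed
  define Y where "Y = transpose P ** S ** P"
  have Ys: "transpose Y = Y"
    by (simp add: Y_def matrix_transpose_mul transpose_transpose S matrix_mul_assoc)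
  have "trace (H ** S ** H ** S) = trace (P ** (transpose P ** S ** P ** transpose P ** S))"
    by (simp add: HP matrix_mul_assoc)
  also have "\<dots> = trace (Y ** Y)"
    by (subst trace_mul_sym) (simp add: Y_def matrix_mul_assoc)
  also have "\<dots> = (\<Sum>i\<in>UNIV. \<Sum>j\<in>UNIV. (Y $ i $ j)^2)"
  proof -
    have "Y $ j $ i = Y $ i $ j" for i j
      using arg_cong[OF Ys, of "\<lambda>M. M $ i $ j"] by (simp add: transpose_def)
    then show ?thesis by (simp add: trace_def matrix_matrix_mult_def power2_eq_square)
  qed
  finally have tr: "trace (H ** S ** H ** S) = (\<Sum>i\<in>UNIV. \<Sum>j\<in>UNIV. (Y $ i $ j)^2)" .
  show "0 \<le> trace (H ** S ** H ** S)" unfolding tr by (intro sum_nonneg) simp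
  assume "trace (H ** S ** H ** S) = 0"
  then have "\<forall>i j. (Y $ i $ j)^2 = 0"
    unfolding tr by (simp add: sum_nonneg_eq_0_iff sum_nonneg)
  then have Y0: "Y = 0" by (simp add: vec_eq_iff)
  have "S = (A ** (P ** transpose P)) ** S ** (P ** transpose P ** A)"
    by (simp add: AP PA)
  also have "\<dots> = A ** P ** Y ** (transpose P ** A)"
    by (simp add: Y_def matrix_mul_assoc)
  also have "\<dots> = 0" by (simp add: Y0 vec_eq_iff matrix_matrix_mult_def)
  finally show "S = 0" .
qed

section \<open>The divergence of the Lie derivative of the metric\<close>

context metric_chart
begin

lemma sum_ginv_G_contract: "x \<in> V \<Longrightarrow> (\<Sum>i\<in>UNIV. ginv G k i x * (\<Sum>a\<in>UNIV. G x $ i $ a * w a)) = w k"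
proof -
  assume x: "x \<in> V"
  have "(\<Sum>i\<in>UNIV. ginv G k i x * (\<Sum>a\<in>UNIV. G x $ i $ a * w a)) = (\<Sum>a\<in>UNIV. (\<Sum>i\<in>UNIV. ginv G k i x * G x $ i $ a) * w a)"
    by (simp add: sum_distrib_left sum_distrib_right mult.assoc) (rule sum.swap)
  then show ?thesis by (simp add: ginv_G[OF x] if_distrib if_distribR cong: if_cong)
qed

lemma metric_trace_lie_metric:
  assumes x: "x \<in> V"
  shows "metric_trace G (lie_metric G X) x = 2 * divergence_vec G X x"
proof -
  let ?D = "\<lambda>i k. nabla_vec G X x $ i $ k"
  have 1: "(\<Sum>i\<in>UNIV. \<Sum>j\<in>UNIV. ginv G i j x * (\<Sum>k\<in>UNIV. G x $ k $ j * ?D i k)) = divergence_vec G X x"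
    using sum_ginv_G_contract[OF x] by (simp add: divergence_vec_def G_sym[OF x, of _ j for j])
  moreover have "(\<Sum>i\<in>UNIV. \<Sum>j\<in>UNIV. ginv G i j x * (\<Sum>k\<in>UNIV. G x $ k $ i * ?D j k)) = divergence_vec G X x"
    using 1 by (subst sum.swap) (simp add: ginv_sym[OF x])
  ultimately show ?thesis
    by (simp add: metric_trace_def lie_metric_def distrib_left sum.distrib)
qed

lemma metric_trace_G: "x \<in> V \<Longrightarrow> (\<Sum>i\<in>UNIV. \<Sum>j\<in>UNIV. ginv G i j x * G x $ i $ j) = real CARD('n)"
  using ginv_G[of x] by (simp add: G_sym[of x])

lemma nabla_two_cong:
  assumes x: "x \<in> V" and "\<And>y. y \<in> V \<Longrightarrow> T y = U y" and "\<And>i j. (\<lambda>y. T y $ i $ j) differentiable (at x)"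
  shows "nabla_two G T x = nabla_two G U x"
proof -
  have "pd i (\<lambda>y. T y $ j $ k) x = pd i (\<lambda>y. U y $ j $ k) x" for i j k
    by (rule pd_cong[OF open_V x assms(3)]) (simp add: assms(2))
  then show ?thesis by (simp add: nabla_two_def assms(2)[OF x])
qed

lemma nabla_two_add:
  assumes "\<And>i j. (\<lambda>y. T y $ i $ j) differentiable (at x)" "\<And>i j. (\<lambda>y. U y $ i $ j) differentiable (at x)"
  shows "nabla_two G (\<lambda>y. T y + U y) x = nabla_two G T x + nabla_two G U x"
  using assms by (simp add: nabla_two_def vec_eq_iff pd_add distrib_left sum.distrib)

lemma nabla_two_scaleR:
  assumes "\<And>i j. (\<lambda>y. T y $ i $ j) differentiable (at x)"
  shows "nabla_two G (\<lambda>y. c *\<^sub>R T y) x = c *\<^sub>R nabla_two G T x"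
  using assms by (simp add: nabla_two_def vec_eq_iff pd_mult right_diff_distrib sum_distrib_left mult_ac)

lemma delta_add:
  assumes "\<And>i j. (\<lambda>y. T y $ i $ j) differentiable (at x)" "\<And>i j. (\<lambda>y. U y $ i $ j) differentiable (at x)"
  shows "delta G (\<lambda>y. T y + U y) x = delta G T x + delta G U x"
  by (simp add: delta_def nabla_two_add[OF assms] vec_eq_iff distrib_left sum.distrib)

lemma delta_scaleR:
  assumes "\<And>i j. (\<lambda>y. T y $ i $ j) differentiable (at x)"
  shows "delta G (\<lambda>y. c *\<^sub>R T y) x = c *\<^sub>R delta G T x"
  by (simp add: delta_def nabla_two_scaleR[OF assms] vec_eq_iff sum_distrib_left mult_ac sum_negf)

lemma delta_cong:
  assumes "x \<in> V" "\<And>y. y \<in> V \<Longrightarrow> T y = U y" "\<And>i j. (\<lambda>y. T y $ i $ j) differentiable (at x)"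
  shows "delta G T x = delta G U x"
  by (simp add: delta_def nabla_two_cong[OF assms])

text \<open>The metric is parallel, so only the function is differentiated.\<close>

lemma delta_function_times_metric:
  assumes x: "x \<in> V" and f: "f differentiable (at x)"
  shows "delta G (\<lambda>y. f y *\<^sub>R G y) x $ j = - pd j f x"
proof -
  have "nabla_two G (\<lambda>y. f y *\<^sub>R G y) x $ k $ i $ j = pd k f x * G x $ i $ j" for k i
    by (simp add: nabla_two_def pd_mult f G_diff[OF x] metric_compat[OF x] distrib_left sum_distrib_left mult_ac)
  then have "delta G (\<lambda>y. f y *\<^sub>R G y) x $ j = - (\<Sum>k\<in>UNIV. pd k f x * (\<Sum>i\<in>UNIV. ginv G k i x * G x $ i $ j))"
    by (simp add: delta_def sum_distrib_left mult_ac)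
  then show ?thesis by (simp add: ginv_G[OF x] if_distrib cong: if_cong)
qed

lemma smooth_nabla_vec:
  assumes "smooth_on V X" shows "smooth_on V (\<lambda>y. nabla_vec G X y $ i $ k)"
  unfolding nabla_vec_def
  by (simp add: smooth_on_add smooth_on_sum smooth_on_mult smooth_on_pd smooth_christoffel open_V X_smooth[OF assms])

lemma smooth_divergence: "smooth_on V X \<Longrightarrow> smooth_on V (divergence_vec G X)"
  unfolding divergence_vec_def[abs_def] by (intro smooth_on_sum smooth_nabla_vec open_V)

lemma smooth_lie_metric: "smooth_on V X \<Longrightarrow> smooth_on V (\<lambda>y. lie_metric G X y $ i $ j)"
  unfolding lie_metric_def
  by (simp add: smooth_on_add smooth_on_sum smooth_on_mult G_smooth open_V smooth_nabla_vec)

lemma lie_metric_sym: "lie_metric G X x $ i $ j = lie_metric G X x $ j $ i"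
  by (simp add: lie_metric_def)

text \<open>The Ricci identity. The sum of \<open>\<nabla>\<^sub>i \<nabla>\<^sub>j X\<close> and a curvature term has an expression by partial derivatives that is symmetric in \<open>i\<close> and \<open>j\<close> (\<open>nabla2_eq\<close>).\<close>

lemma nabla2_commute:
  assumes X: "smooth_on V X" and x: "x \<in> V"
  shows "nabla2 G X i j k x - nabla2 G X j i k x
    = (\<Sum>m\<in>UNIV. X x $ m * riemann G k i m j x) - (\<Sum>m\<in>UNIV. X x $ m * riemann G k j m i x)"
proof -
  have s: "pd m (christoffel G k i j) x = pd m (christoffel G k j i) x" for m
    by (rule pd_cong[OF open_V x]) (auto simp: differentiable_facts x chr_sym)
  have c: "pd i (pd j (\<lambda>y. X y $ k)) x = pd j (pd i (\<lambda>y. X y $ k)) x"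
    by (rule pd_commute[OF X_smooth[OF X] open_V x])
  note chr_sym[OF x, of k _ i] chr_sym[OF x, of k _ j] chr_sym[OF x, of _ i j]
  then show ?thesis
    using nabla2_eq[OF X x, of i j k] nabla2_eq[OF X x, of j i k] unfolding s c by simp
qed

text \<open>Contract the Ricci identity: one of the two curvature terms contains the trace of \<open>R(\<partial>\<^sub>m, \<partial>\<^sub>j)\<close>, which vanishes, and the
  other becomes the Ricci tensor.\<close>

lemma contracted_Ricci_identity:
  assumes X: "smooth_on V X" and x: "x \<in> V"
  shows "(\<Sum>i\<in>UNIV. nabla2 G X i j i x) = pd j (divergence_vec G X) x + (X x v* ricci G x) $ j"
proof -
  have "(\<Sum>i\<in>UNIV. \<Sum>a\<in>UNIV. christoffel G a j i x * nabla_vec G X x $ a $ i)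
      = (\<Sum>i\<in>UNIV. \<Sum>a\<in>UNIV. christoffel G i j a x * nabla_vec G X x $ i $ a)"
    by (rule sum.swap)
  then have 1: "(\<Sum>i\<in>UNIV. nabla2 G X j i i x) = pd j (divergence_vec G X) x"
    by (simp add: nabla2_def[OF X] sum.distrib sum_subtractf divergence_vec_def[abs_def] pd_sum nabla_vec_diff[OF X x])
  have anti: "riemann G i j m i x = - riemann G i j i m x" for i m by (simp add: riemann_def)
  have "(\<Sum>i\<in>UNIV. nabla2 G X i j i x - nabla2 G X j i i x)
     = (\<Sum>i\<in>UNIV. \<Sum>m\<in>UNIV. X x $ m * riemann G i i m j x) + (\<Sum>i\<in>UNIV. \<Sum>m\<in>UNIV. X x $ m * riemann G i j i m x)"
    by (simp add: nabla2_commute[OF X x] anti sum.distrib sum_subtractf sum_negf)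
  also have "(\<Sum>i\<in>UNIV. \<Sum>m\<in>UNIV. X x $ m * riemann G i i m j x) = 0"
    by (subst sum.swap) (simp add: sum_distrib_left[symmetric] trace_Riem[OF x])
  also have "(\<Sum>i\<in>UNIV. \<Sum>m\<in>UNIV. X x $ m * riemann G i j i m x) = (X x v* ricci G x) $ j"
    by (subst sum.swap) (simp add: vector_matrix_mult_def ricci_def sum_distrib_left mult.commute)
  finally show ?thesis using 1 by (simp add: sum_subtractf)
qed

text \<open>The Lie derivative is \<open>N + N\<^sup>T\<close> with \<open>N = \<nabla>\<theta>\<close>, \<open>\<theta>\<close> the one-form dual to \<open>X\<close>. The divergence of \<open>N\<close> is \<open>\<nabla>\<^sup>*\<nabla>\<theta>\<close> by definition, that of \<open>N\<^sup>T\<close>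
  is \<open>- \<nabla>\<^sub>i \<nabla>\<^sub>j X\<^sup>i\<close>, to which the contracted Ricci identity applies.\<close>

lemma delta_lie_metric:
  assumes X: "smooth_on V X" and x: "x \<in> V"
  shows "delta G (lie_metric G X) x $ j
    = rough_laplacian G (flat G X) x $ j - (X x v* ricci G x) $ j - pd j (divergence_vec G X) x"
proof -
  let ?N = "nabla_form G (flat G X)"
  have N: "?N y $ i $ j = (\<Sum>a\<in>UNIV. G y $ j $ a * nabla_vec G X y $ i $ a)" if "y \<in> V" for y i j
    by (rule nabla_form_flat[OF X that])
  have lie: "lie_metric G X y = ?N y + (\<chi> i j. ?N y $ j $ i)" if "y \<in> V" for y
    by (simp add: vec_eq_iff lie_metric_def N[OF that] G_sym[OF that])
  have dN: "(\<lambda>y. ?N y $ i $ j) differentiable (at x)" for i j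
  proof (rule differentiable_cong[OF open_V x])
    show "(\<lambda>y. \<Sum>a\<in>UNIV. G y $ j $ a * nabla_vec G X y $ i $ a) differentiable (at x)"
      by (auto intro!: differentiable_sum differentiable_mult G_diff nabla_vec_diff X x)
  qed (simp add: N)
  have "delta G (lie_metric G X) x = delta G (\<lambda>y. ?N y + (\<chi> i j. ?N y $ j $ i)) x"
    by (rule delta_cong[OF x lie]) (simp_all add: smooth_on_D[OF smooth_lie_metric[OF X] x])
  also have "\<dots> = delta G ?N x + delta G (\<lambda>y. \<chi> i j. ?N y $ j $ i) x"
    by (rule delta_add) (simp_all add: dN)
  finally have "delta G (lie_metric G X) x $ j = delta G ?N x $ j + delta G (\<lambda>y. \<chi> i j. ?N y $ j $ i) x $ j"
    by simp
  also have "delta G ?N x $ j = rough_laplacian G (flat G X) x $ j"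
    by (simp add: delta_def rough_laplacian_def)
  also have "delta G (\<lambda>y. \<chi> i j. ?N y $ j $ i) x $ j = - (\<Sum>k\<in>UNIV. \<Sum>i\<in>UNIV. ginv G k i x * nabla_two G ?N x $ k $ j $ i)"
    by (simp add: delta_def nabla_two_def algebra_simps)
  also have "\<dots> = - (\<Sum>k\<in>UNIV. nabla2 G X k j k x)"
    by (simp add: nabla_two_flat[OF X x] sum_ginv_G_contract[OF x])
  finally show ?thesis
    by (simp add: contracted_Ricci_identity[OF X x])
qed

lemma raised_nabla_form:
  assumes X: "smooth_on V X" and x: "x \<in> V"
  shows "(\<Sum>q\<in>UNIV. ginv G j q x * nabla_form G (flat G X) x $ i $ q) = nabla_vec G X x $ i $ j"
  by (simp add: nabla_form_flat[OF X x] sum_ginv_G_contract[OF x])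

lemma lie_metric_eq:
  assumes X: "smooth_on V X" and x: "x \<in> V"
  shows "lie_metric G X x = nabla_form G (flat G X) x + transpose (nabla_form G (flat G X) x)"
  by (simp add: vec_eq_iff lie_metric_def nabla_form_flat[OF X x] transpose_def G_sym[OF x])

text \<open>The product rule \<open>div(T X) = \<langle>T, \<nabla>X\<rangle> - (\<delta>T)(X)\<close>. As \<open>T\<close> is symmetric, only the symmetric part \<open>\<onehalf> L\<^sub>X g\<close> of \<open>\<nabla>X\<close>
  contributes to the first term.\<close>

lemma divergence_contraction:
  assumes X: "smooth_on V X" and x: "x \<in> V"
    and T: "\<And>i j. (\<lambda>y. T y $ i $ j) differentiable (at x)" and T_sym: "transpose (T x) = T x"
  shows "divergence_vec G (\<lambda>y. matrix_inv (G y) *v (T y *v X y)) x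
    = (1/2) * trace (matrix_inv (G x) ** T x ** matrix_inv (G x) ** lie_metric G X x) - delta G T x \<bullet> X x"
proof -
  let ?C = "\<lambda>l m a. christoffel G l m a x" and ?h = "\<lambda>i j. ginv G i j x"
  let ?H = "matrix_inv (G x)" and ?N = "nabla_form G (flat G X) x"
  let ?X = "\<lambda>j. X x $ j" and ?T = "\<lambda>i j. T x $ i $ j" and ?D = "\<lambda>i k. nabla_vec G X x $ i $ k"
  \<comment> \<open>The one-form \<open>T(\<cdot>, X)\<close>.\<close>
  define Q where "Q p y = (\<Sum>j\<in>UNIV. T y $ p $ j * X y $ j)" for p y
  have dQ: "Q p differentiable (at x)" for p
    unfolding Q_def[abs_def] by (auto intro!: differentiable_sum differentiable_mult T X_diff[OF X x])
  have pdQ: "pd i (Q p) x = (\<Sum>j\<in>UNIV. pd i (\<lambda>y. T y $ p $ j) x * ?X j) + (\<Sum>j\<in>UNIV. ?T p j * pd i (\<lambda>y. X y $ j) x)" for i p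
    unfolding Q_def[abs_def] by (simp add: pd_sum pd_mult T X_diff[OF X x] differentiable_mult sum.distrib)
  have DQ: "pd i (Q p) x - (\<Sum>a\<in>UNIV. ?C a i p * Q a x) = (\<Sum>j\<in>UNIV. nabla_two G T x $ i $ p $ j * ?X j) + (\<Sum>j\<in>UNIV. ?T p j * ?D i j)" for i p
  proof -
    have 1: "(\<Sum>j\<in>UNIV. (\<Sum>a\<in>UNIV. ?C a i p * ?T a j) * ?X j) = (\<Sum>a\<in>UNIV. ?C a i p * Q a x)"
      by (simp add: Q_def sum_distrib_left sum_distrib_right mult.assoc) (rule sum.swap)
    have 2: "(\<Sum>j\<in>UNIV. (\<Sum>a\<in>UNIV. ?C a i j * ?T p a) * ?X j) = (\<Sum>j\<in>UNIV. ?T p j * (\<Sum>a\<in>UNIV. ?C j i a * ?X a))"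
      by (simp add: sum_distrib_left sum_distrib_right mult_ac) (rule sum.swap)
    show ?thesis
      by (simp add: pdQ nabla_two_def nabla_vec_def left_diff_distrib distrib_left sum.distrib sum_subtractf 1 2)
  qed
  have comp: "(matrix_inv (G y) *v (T y *v X y)) $ i = (\<Sum>p\<in>UNIV. ginv G i p y * Q p y)" for i y
    by (simp add: matrix_vector_mult_def ginv_def Q_def)
  have "divergence_vec G (\<lambda>y. matrix_inv (G y) *v (T y *v X y)) x
    = (\<Sum>i\<in>UNIV. pd i (\<lambda>y. \<Sum>p\<in>UNIV. ginv G i p y * Q p y) x + (\<Sum>a\<in>UNIV. ?C i i a * (\<Sum>p\<in>UNIV. ?h a p * Q p x)))"
    by (simp add: divergence_vec_def nabla_vec_def comp)
  also have "\<dots> = (\<Sum>i\<in>UNIV. \<Sum>p\<in>UNIV. ?h i p * ((\<Sum>j\<in>UNIV. nabla_two G T x $ i $ p $ j * ?X j) + (\<Sum>j\<in>UNIV. ?T p j * ?D i j)))"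
    by (simp add: pd_raise[OF x dQ] DQ)
  also have "\<dots> = (\<Sum>i\<in>UNIV. \<Sum>p\<in>UNIV. \<Sum>j\<in>UNIV. ?h i p * nabla_two G T x $ i $ p $ j * ?X j) + (\<Sum>i\<in>UNIV. \<Sum>p\<in>UNIV. \<Sum>j\<in>UNIV. ?h i p * ?T p j * ?D i j)"
    by (simp add: distrib_left sum.distrib sum_distrib_left mult.assoc)
  also have "(\<Sum>i\<in>UNIV. \<Sum>p\<in>UNIV. \<Sum>j\<in>UNIV. ?h i p * nabla_two G T x $ i $ p $ j * ?X j) = - (delta G T x \<bullet> X x)"
  proof -
    have "(\<Sum>i\<in>UNIV. \<Sum>p\<in>UNIV. \<Sum>j\<in>UNIV. ?h i p * nabla_two G T x $ i $ p $ j * ?X j)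
        = (\<Sum>i\<in>UNIV. \<Sum>j\<in>UNIV. \<Sum>p\<in>UNIV. ?h i p * nabla_two G T x $ i $ p $ j * ?X j)"
      by (intro sum.cong refl sum.swap)
    also have "\<dots> = (\<Sum>j\<in>UNIV. \<Sum>i\<in>UNIV. \<Sum>p\<in>UNIV. ?h i p * nabla_two G T x $ i $ p $ j * ?X j)"
      by (rule sum.swap)
    finally show ?thesis by (simp add: delta_def inner_vec_def sum_distrib_right sum_negf)
  qed
  also have "(\<Sum>i\<in>UNIV. \<Sum>p\<in>UNIV. \<Sum>j\<in>UNIV. ?h i p * ?T p j * ?D i j) = trace (?H ** T x ** ?H ** transpose ?N)"
  proof -
    have "(?H ** T x ** (?H ** transpose ?N)) $ i $ i = (\<Sum>j\<in>UNIV. (\<Sum>p\<in>UNIV. ?h i p * ?T p j) * ?D i j)" for i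
      by (simp add: matrix_matrix_mult_def transpose_def raised_nabla_form[OF X x, symmetric] ginv_def)
    moreover have "\<dots> i = (\<Sum>p\<in>UNIV. \<Sum>j\<in>UNIV. ?h i p * ?T p j * ?D i j)" for i
      by (simp add: sum_distrib_right) (rule sum.swap)
    ultimately show ?thesis by (simp add: trace_def matrix_mul_assoc)
  qed
  also have "trace (?H ** T x ** ?H ** transpose ?N) = (1/2) * trace (?H ** T x ** ?H ** lie_metric G X x)"
  proof -
    have Hs: "transpose ?H = ?H" using ginv_sym[OF x] by (simp add: vec_eq_iff transpose_def ginv_def)
    have "trace (?H ** T x ** ?H ** transpose ?N) = trace (transpose (?H ** T x ** ?H ** transpose ?N))"
      by (simp add: trace_def transpose_def)
    also have "\<dots> = trace (?N ** (?H ** T x ** ?H))"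
      by (simp add: matrix_transpose_mul transpose_transpose Hs T_sym matrix_mul_assoc)
    also have "\<dots> = trace (?H ** T x ** ?H ** ?N)" by (rule trace_mul_sym)
    finally have "trace (?H ** T x ** ?H ** transpose ?N) = trace (?H ** T x ** ?H ** ?N)" .
    then show ?thesis by (simp add: lie_metric_eq[OF X x] matrix_add_ldistrib trace_add)
  qed
  finally show ?thesis by simp
qed

end

section \<open>The trace-free strain of a vector field\<close>

text \<open>Up to a constant factor, this is the Ahlfors operator applied to \<open>X\<close>; its kernel consists of the conformal Killing fields.\<close>

definition traceless_strain :: "(real^'n::finite \<Rightarrow> real^'n^'n) \<Rightarrow> (real^'n \<Rightarrow> real^'n) \<Rightarrow> real^'n \<Rightarrow> real^'n^'n" where
  "traceless_strain G X x = (1/2) *\<^sub>R lie_metric G X x - (1 / real CARD('n) * divergence_vec G X x) *\<^sub>R G x"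

text \<open>The vector field dual to the one-form \<open>S(\<cdot>, X)\<close>, \<open>S\<close> the trace-free strain of \<open>X\<close>.\<close>

definition strain_flux :: "(real^'n::finite \<Rightarrow> real^'n^'n) \<Rightarrow> (real^'n \<Rightarrow> real^'n) \<Rightarrow> real^'n \<Rightarrow> real^'n" where
  "strain_flux G X x = matrix_inv (G x) *v (traceless_strain G X x *v X x)"

definition strain_energy :: "(real^'n::finite \<Rightarrow> real^'n^'n) \<Rightarrow> (real^'n \<Rightarrow> real^'n) \<Rightarrow> real^'n \<Rightarrow> real" where
  "strain_energy G X x = trace (matrix_inv (G x) ** traceless_strain G X x ** matrix_inv (G x) ** traceless_strain G X x)"

context metric_chart
begin

lemma traceless_strain_sym: "x \<in> V \<Longrightarrow> transpose (traceless_strain G X x) = traceless_strain G X x"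
  unfolding vec_eq_iff transpose_def traceless_strain_def
  by (auto simp: G_sym[of x] lie_metric_sym[of X x])

lemma smooth_traceless_strain:
  "smooth_on V X \<Longrightarrow> smooth_on V (\<lambda>y. traceless_strain G X y $ i $ j)"
  unfolding traceless_strain_def
  unfolding vector_minus_component vector_scaleR_component real_scaleR_def
  by (intro smooth_on_diff smooth_on_mult smooth_on_const smooth_lie_metric smooth_divergence G_smooth open_V)

lemma strain_energy_nonneg: "x \<in> V \<Longrightarrow> 0 \<le> strain_energy G X x"
  unfolding strain_energy_def
  by (rule trace_square_nonneg(1)[OF transpose_G _ inv_G traceless_strain_sym]) (auto intro: G_pos)

lemma strain_energy_zero: "x \<in> V \<Longrightarrow> strain_energy G X x = 0 \<Longrightarrow> traceless_strain G X x = 0"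
  unfolding strain_energy_def
  by (rule trace_square_nonneg(2)[OF transpose_G _ inv_G traceless_strain_sym]) (auto intro: G_pos)

lemma trace_inv_traceless_strain: "x \<in> V \<Longrightarrow> trace (matrix_inv (G x) ** traceless_strain G X x) = 0"
proof -
  assume x: "x \<in> V"
  have "trace (matrix_inv (G x) ** T) = (\<Sum>i\<in>UNIV. \<Sum>j\<in>UNIV. ginv G i j x * T $ j $ i)" for T
    by (simp add: trace_def matrix_matrix_mult_def ginv_def)
  then have "trace (matrix_inv (G x) ** traceless_strain G X x)
     = (1/2) * metric_trace G (lie_metric G X) x
       - 1 / real CARD('n) * divergence_vec G X x * (\<Sum>i\<in>UNIV. \<Sum>j\<in>UNIV. ginv G i j x * G x $ i $ j)"
    by (simp add: traceless_strain_def metric_trace_def right_diff_distrib sum_subtractf sum_distrib_left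
        lie_metric_sym[of X x] G_sym[OF x] mult_ac)
  then show ?thesis by (simp add: metric_trace_lie_metric[OF x] metric_trace_G[OF x])
qed

text \<open>As \<open>S\<close> is trace-free, \<open>\<langle>S, \<onehalf> L\<^sub>X g\<rangle> = \<langle>S, S\<rangle>\<close>.\<close>

lemma divergence_strain_flux:
  assumes X: "smooth_on V X" and x: "x \<in> V"
  shows "divergence_vec G (strain_flux G X) x = strain_energy G X x - delta G (traceless_strain G X) x \<bullet> X x"
proof -
  let ?S = "traceless_strain G X x" and ?H = "matrix_inv (G x)"
  have L: "(1/2) *\<^sub>R lie_metric G X x = ?S + (1 / real CARD('n) * divergence_vec G X x) *\<^sub>R G x"
    by (simp add: traceless_strain_def)
  have "(1/2) * trace (?H ** ?S ** ?H ** lie_metric G X x)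
     = trace (?H ** ?S ** ?H ** (?S + (1 / real CARD('n) * divergence_vec G X x) *\<^sub>R G x))"
    unfolding L[symmetric] matrix_mul_scaleR_right trace_scaleR ..
  also have "\<dots> = strain_energy G X x"
    by (simp add: matrix_add_ldistrib trace_add strain_energy_def matrix_mul_scaleR_right trace_scaleR)
      (simp add: matrix_mul_assoc[symmetric] inv_G[OF x] trace_inv_traceless_strain[OF x])
  finally show ?thesis
    unfolding strain_flux_def[abs_def]
    using divergence_contraction[OF X x smooth_on_D[OF smooth_traceless_strain[OF X] x] traceless_strain_sym[OF x]]
    by simp
qed

end

section \<open>The orthogonal expansion of the Ricci tensor in a chart\<close>

locale ricci_expansion_chart = metric_chart G V for G :: "real^'n::finite \<Rightarrow> real^'n^'n" and V +
  fixes X :: "real^'n \<Rightarrow> real^'n" and f :: "real^'n \<Rightarrow> real" and \<phi> :: "real^'n \<Rightarrow> real^'n^'n"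
  assumes smooth_X: "smooth_on V X" and smooth_f: "smooth_on V f" and smooth_\<phi>: "smooth_on V \<phi>"
    and delta_\<phi>: "\<And>x. x \<in> V \<Longrightarrow> delta G \<phi> x = 0"
    and trace_\<phi>: "\<And>x. x \<in> V \<Longrightarrow> metric_trace G \<phi> x = 0"
    and expansion: "\<And>x. x \<in> V \<Longrightarrow> ricci G x = ((1/2) *\<^sub>R lie_metric G X x + f x *\<^sub>R G x) + \<phi> x"
begin

lemma scalar_eq: assumes x: "x \<in> V" shows "scalar G x = divergence_vec G X x + real CARD('n) * f x"
proof -
  have "scalar G x = (1/2) * metric_trace G (lie_metric G X) x + f x * (\<Sum>i\<in>UNIV. \<Sum>j\<in>UNIV. ginv G i j x * G x $ i $ j)
     + metric_trace G \<phi> x"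
    by (simp add: scalar_def metric_trace_def expansion[OF x] distrib_left sum.distrib sum_distrib_left mult_ac)
  then show ?thesis
    by (simp add: metric_trace_lie_metric[OF x] metric_trace_G[OF x] trace_\<phi>[OF x])
qed

lemma differentiable_expansion:
  assumes x: "x \<in> V"
  shows "(\<lambda>y. lie_metric G X y $ i $ j) differentiable (at x)" "(\<lambda>y. \<phi> y $ i $ j) differentiable (at x)"
    "f differentiable (at x)" "divergence_vec G X differentiable (at x)" "scalar G differentiable (at x)"
  by (rule smooth_on_D[OF smooth_lie_metric[OF smooth_X] x]
      smooth_on_D[OF smooth_on_comp_nth[OF open_V smooth_on_comp_nth[OF open_V smooth_\<phi>]] x]
      smooth_on_D[OF smooth_f x] smooth_on_D[OF smooth_divergence[OF smooth_X] x] smooth_on_D[OF smooth_scalar x])+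

lemma pd_scalar: assumes x: "x \<in> V" shows "pd j (scalar G) x = pd j (divergence_vec G X) x + real CARD('n) * pd j f x"
proof -
  note d = differentiable_expansion[OF x]
  have "pd j (scalar G) x = pd j (\<lambda>y. divergence_vec G X y + real CARD('n) * f y) x"
    by (rule pd_cong[OF open_V x d(5)]) (rule scalar_eq)
  also have "\<dots> = pd j (divergence_vec G X) x + real CARD('n) * pd j f x"
    by (simp add: pd_add pd_mult d)
  finally show ?thesis .
qed

text \<open>Divergence of the expansion: \<open>- \<onehalf> ds = \<onehalf> (\<nabla>\<^sup>*\<nabla>\<theta> - Ric(X, \<cdot>) - d(div X)) - df\<close>. Together with
  \<open>ds = d(div X) + n df\<close> this is the claim.\<close>

theorem rough_laplacian_minus_ricci:
  assumes x: "x \<in> V"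
  shows "rough_laplacian G (flat G X) x $ j - (X x v* ricci G x) $ j = (2 - real CARD('n)) * pd j f x"
proof -
  note d = differentiable_expansion[OF x]
  have "delta G (ricci G) x = delta G (\<lambda>y. ((1/2) *\<^sub>R lie_metric G X y + f y *\<^sub>R G y) + \<phi> y) x"
    by (rule delta_cong[OF x]) (simp_all add: expansion differentiable_facts x)
  also have "\<dots> = delta G (\<lambda>y. (1/2) *\<^sub>R lie_metric G X y) x + delta G (\<lambda>y. f y *\<^sub>R G y) x + delta G \<phi> x"
    by (subst delta_add delta_add; simp add: d G_diff x)+
  also have "delta G (\<lambda>y. (1/2) *\<^sub>R lie_metric G X y) x = (1/2) *\<^sub>R delta G (lie_metric G X) x"
    by (rule delta_scaleR) (rule d)
  finally have "delta G (ricci G) x $ j = (1/2) * delta G (lie_metric G X) x $ j + delta G (\<lambda>y. f y *\<^sub>R G y) x $ j"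
    by (simp add: delta_\<phi>[OF x])
  then show ?thesis
    unfolding contracted_Bianchi[OF x] delta_lie_metric[OF smooth_X x] delta_function_times_metric[OF x d(3)] pd_scalar[OF x]
    by (simp add: field_simps)
qed

text \<open>The differences are written as sums of multiples so that the linearity rules for \<open>\<delta>\<close> apply.\<close>

lemma strain_eq:
  assumes x: "x \<in> V"
  shows "traceless_strain G X x = (ricci G x + (- scalar G x / real CARD('n)) *\<^sub>R G x) + (- 1) *\<^sub>R \<phi> x"
proof -
  have "- scalar G x / real CARD('n) = - (1 / real CARD('n) * divergence_vec G X x) - f x"
    by (simp add: scalar_eq[OF x] field_simps)
  then show ?thesis
    by (simp only: traceless_strain_def expansion[OF x]) (simp add: scaleR_diff_left)
qed

text \<open>The divergence of \<open>Ric - (s/n) g - \<phi>\<close> is \<open>- \<onehalf> ds + (1/n) ds\<close>.\<close>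

theorem delta_traceless_strain:
  assumes x: "x \<in> V"
  shows "delta G (traceless_strain G X) x $ j = - ((real CARD('n) - 2) / (2 * real CARD('n))) * pd j (scalar G) x"
proof -
  let ?s = "\<lambda>y. - scalar G y / real CARD('n)"
  note d = differentiable_expansion[OF x]
  have ds: "?s differentiable (at x)" 
    unfolding divide_inverse by (rule differentiable_mult[OF differentiable_minus[OF d(5)] differentiable_const])
  have "delta G (traceless_strain G X) x = delta G (\<lambda>y. (ricci G y + ?s y *\<^sub>R G y) + (- 1) *\<^sub>R \<phi> y) x"
    by (rule delta_cong[OF x strain_eq]) (simp_all add: smooth_on_D[OF smooth_traceless_strain[OF smooth_X] x])
  also have "\<dots> = delta G (ricci G) x + delta G (\<lambda>y. ?s y *\<^sub>R G y) x + delta G (\<lambda>y. (- 1) *\<^sub>R \<phi> y) x"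
  proof -
    have 1: "(\<lambda>y. (?s y *\<^sub>R G y) $ i $ k) differentiable (at x)" for i k
      unfolding vector_scaleR_component real_scaleR_def by (rule differentiable_mult[OF ds G_diff[OF x]])
    have 2: "(\<lambda>y. ((- 1) *\<^sub>R \<phi> y) $ i $ k) differentiable (at x)" for i k
      unfolding vector_scaleR_component real_scaleR_def by (rule differentiable_mult[OF differentiable_const d(2)])
    have 3: "(\<lambda>y. (ricci G y + ?s y *\<^sub>R G y) $ i $ k) differentiable (at x)" for i k
      unfolding vector_add_component by (rule differentiable_add[OF differentiable_facts(4)[OF x] 1])
    show ?thesis
      unfolding delta_add[OF 3 2] delta_add[OF differentiable_facts(4)[OF x] 1] ..
  qed
  also have "delta G (\<lambda>y. (- 1) *\<^sub>R \<phi> y) x = (- 1) *\<^sub>R delta G \<phi> x"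
    by (rule delta_scaleR) (rule d)
  finally have "delta G (traceless_strain G X) x $ j = delta G (ricci G) x $ j + delta G (\<lambda>y. ?s y *\<^sub>R G y) x $ j"
    by (simp add: delta_\<phi>[OF x])
  then have fin: "delta G (traceless_strain G X) x $ j = - (1/2) * pd j (scalar G) x - pd j ?s x"
    unfolding contracted_Bianchi[OF x] delta_function_times_metric[OF x ds] by simp
  have ps: "pd j ?s x = - (1 / real CARD('n)) * pd j (scalar G) x"
    using pd_mult[OF differentiable_const d(5), of j "- (1 / real CARD('n))"] by simp
  show ?thesis unfolding fin ps by (simp add: field_simps)
qed

end

section \<open>Change of variables for the Lebesgue integral\<close>

text \<open>A copy of a finite type that carries a well-order. The change of variables theorem for absolutely integrable functions
  concerns coordinates indexed by a well-ordered type. Neither the Lebesgue measure nor the determinant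
  depends on the order of the coordinates, so relabelling them extends the theorem to every finite index type.\<close>

typedef 'a wo = "UNIV :: 'a set" morphisms of_wo to_wo ..

lemma of_wo_to_wo [simp]: "of_wo (to_wo x) = x" "to_wo (of_wo y) = y"
  by (simp_all add: to_wo_inverse of_wo_inverse)

lemma bij_of_wo: "bij of_wo"
  by (rule o_bij[of to_wo]) (auto simp: fun_eq_iff)

lemma bij_to_wo: "bij to_wo"
  by (rule o_bij[of of_wo]) (auto simp: fun_eq_iff)

instance wo :: (finite) finite
proof
  have "finite (range (to_wo :: 'a \<Rightarrow> 'a wo))" by simp
  then show "finite (UNIV :: 'a wo set)" by (simp add: bij_is_surj[OF bij_to_wo])
qed

instantiation wo :: (finite) wellorder
begin

definition less_eq_wo :: "'a wo \<Rightarrow> 'a wo \<Rightarrow> bool" where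
  "less_eq_wo x y \<longleftrightarrow> to_nat (of_wo x) \<le> to_nat (of_wo y)"

definition less_wo :: "'a wo \<Rightarrow> 'a wo \<Rightarrow> bool" where
  "less_wo x y \<longleftrightarrow> to_nat (of_wo x) < to_nat (of_wo y)"

instance
proof
  fix x y z :: "'a wo"
  show "x < y \<longleftrightarrow> x \<le> y \<and> \<not> y \<le> x" unfolding less_eq_wo_def less_wo_def by linarith
  show "x \<le> x" unfolding less_eq_wo_def by (rule order_refl)
  show "x \<le> y \<or> y \<le> x" unfolding less_eq_wo_def by linarith
  show "x \<le> z" if "x \<le> y" "y \<le> z" using that unfolding less_eq_wo_def by (rule order_trans)
  show "x = y" if "x \<le> y" "y \<le> x"
  proof -
    have "to_nat (of_wo x) = to_nat (of_wo y)" using that unfolding less_eq_wo_def by (rule order_antisym)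
    then have "of_wo x = of_wo y" by (rule injD[OF inj_to_nat])
    then show ?thesis by (rule of_wo_inject[THEN iffD1])
  qed
next
  fix P :: "'a wo \<Rightarrow> bool" and a
  assume step: "\<And>x. (\<And>y. y < x \<Longrightarrow> P y) \<Longrightarrow> P x"
  show "P a"
  proof (induction "to_nat (of_wo a)" arbitrary: a rule: less_induct)
    case less
    show ?case by (rule step, rule less) (simp only: less_wo_def)
  qed
qed

end

definition to_vec_wo :: "real^'n::finite \<Rightarrow> real^'n wo" where "to_vec_wo x = (\<chi> k. x $ of_wo k)"
definition of_vec_wo :: "real^'n::finite wo \<Rightarrow> real^'n" where "of_vec_wo y = (\<chi> i. y $ to_wo i)"

lemma vec_wo_inverse [simp]: "of_vec_wo (to_vec_wo x) = x" "to_vec_wo (of_vec_wo y) = y"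
  by (simp_all add: to_vec_wo_def of_vec_wo_def vec_eq_iff)

lemma bounded_linear_vec_wo: "bounded_linear to_vec_wo" "bounded_linear of_vec_wo"
proof -
  have "linear to_vec_wo" "linear of_vec_wo"
    by (rule linearI; simp add: to_vec_wo_def of_vec_wo_def vec_eq_iff)+
  then show "bounded_linear to_vec_wo" "bounded_linear of_vec_wo"
    by (simp_all add: linear_conv_bounded_linear)
qed

lemma continuous_vec_wo: "continuous_on A to_vec_wo" "continuous_on B of_vec_wo"
  by (rule linear_continuous_on, rule bounded_linear_vec_wo)+

lemma measurable_vec_wo [measurable]:
  "to_vec_wo \<in> borel \<rightarrow>\<^sub>M borel" "of_vec_wo \<in> borel \<rightarrow>\<^sub>M borel"
  by (rule borel_measurable_continuous_onI, rule continuous_vec_wo)+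

text \<open>Relabelling the coordinates maps boxes to boxes with the same edge lengths.\<close>

lemma lborel_of_vec_wo: "distr lborel borel of_vec_wo = (lborel :: (real^'n::finite) measure)"
proof (rule lborel_eqI[symmetric])
  fix l u :: "real^'n" assume lu: "\<And>b. b \<in> Basis \<Longrightarrow> l \<bullet> b \<le> u \<bullet> b"
  have le: "l $ i \<le> u $ i" for i
    using lu[of "axis i 1"] by (simp add: inner_axis)
  have prod: "(\<Prod>b\<in>Basis. f (v \<bullet> b)) = (\<Prod>i\<in>UNIV. f (v $ i))" for f :: "real \<Rightarrow> real" and v :: "real^'k::finite"
  proof -
    have "bij_betw (\<lambda>i. axis i (1::real)) (UNIV :: 'k set) Basis"
      by (auto simp: bij_betw_def inj_on_def axis_eq_axis Basis_vec_def)
    then show ?thesis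
      by (subst prod.reindex_bij_betw[symmetric, where g = "\<lambda>b. f (v \<bullet> b)"]) (auto simp: inner_axis)
  qed
  have vi: "of_vec_wo -` box l u = box (to_vec_wo l) (to_vec_wo u)"
  proof -
    have "(\<forall>i. l $ i < y $ to_wo i \<and> y $ to_wo i < u $ i) \<longleftrightarrow> (\<forall>k. l $ of_wo k < y $ k \<and> y $ k < u $ of_wo k)" for y
      by (metis of_wo_to_wo)
    then show ?thesis by (auto simp: mem_box_cart to_vec_wo_def of_vec_wo_def)
  qed
  have "emeasure (distr lborel borel of_vec_wo) (box l u) = emeasure lborel (box (to_vec_wo l) (to_vec_wo u))"
    by (subst emeasure_distr) (auto simp: vi)
  also have "\<dots> = ennreal (\<Prod>b\<in>Basis. (to_vec_wo u - to_vec_wo l) \<bullet> b)"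
    by (rule emeasure_lborel_box) (use le in \<open>auto simp: Basis_vec_def inner_axis to_vec_wo_def\<close>)
  also have "(\<Prod>b\<in>Basis. (to_vec_wo u - to_vec_wo l) \<bullet> b) = (\<Prod>k\<in>UNIV. u $ of_wo k - l $ of_wo k)"
    by (subst prod[of "\<lambda>x. x"]) (simp add: to_vec_wo_def)
  also have "\<dots> = (\<Prod>i\<in>UNIV. u $ i - l $ i)"
    by (rule prod.reindex_bij_betw[OF bij_of_wo, of "\<lambda>i. u $ i - l $ i"])
  also have "\<dots> = (\<Prod>b\<in>Basis. (u - l) \<bullet> b)"
    by (subst prod[of "\<lambda>x. x"]) simp
  finally show "emeasure (distr lborel borel of_vec_wo) (box l u) = ennreal (\<Prod>b\<in>Basis. (u - l) \<bullet> b)" .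
qed simp

lemma det_wo:
  fixes M :: "real^'n::finite^'n"
  shows "det (\<chi> a b. M $ of_wo a $ of_wo b) = det M"
proof -
  let ?m = "map_permutation UNIV of_wo :: ('n wo \<Rightarrow> 'n wo) \<Rightarrow> 'n \<Rightarrow> 'n"
  have inj: "inj (of_wo :: 'n wo \<Rightarrow> 'n)" using bij_of_wo by (rule bij_is_inj)
  have app: "?m p (of_wo a) = of_wo (p a)" for p a
    by (rule map_permutation_apply[OF inj]) simp
  have bij: "bij_betw ?m {p. p permutes UNIV} {p. p permutes UNIV}"
  proof (rule bij_betw_byWitness[where f' = "map_permutation UNIV to_wo"])
    show "\<forall>p\<in>{p. p permutes UNIV}. map_permutation UNIV to_wo (?m p) = p"
      by (simp add: map_permutation_compose_inv[OF bij_of_wo])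
    show "\<forall>p\<in>{p. p permutes UNIV}. ?m (map_permutation UNIV to_wo p) = p"
      by (simp add: map_permutation_compose_inv[OF bij_to_wo])
    show "?m ` {p. p permutes UNIV} \<subseteq> {p. p permutes UNIV}"
      using map_permutation_permutes[OF bij_of_wo] by auto
    show "map_permutation UNIV to_wo ` {p. p permutes UNIV} \<subseteq> {p. p permutes (UNIV :: 'n wo set)}"
      using map_permutation_permutes[OF bij_to_wo] by auto
  qed
  have pr: "(\<Prod>i\<in>UNIV. M $ i $ ?m p i) = (\<Prod>a\<in>UNIV. M $ of_wo a $ of_wo (p a))" for p
    using prod.reindex_bij_betw[OF bij_of_wo, of "\<lambda>i. M $ i $ ?m p i"] by (simp add: app)
  have sg: "sign (?m p) = sign p" if "p permutes UNIV" for p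
    by (rule sign_map_permutation[OF inj that]) simp
  have "det M = (\<Sum>p | p permutes UNIV. of_int (sign (?m p)) * (\<Prod>i\<in>UNIV. M $ i $ ?m p i))"
    unfolding det_def by (rule sum.reindex_bij_betw[OF bij, symmetric])
  also have "\<dots> = (\<Sum>p | p permutes UNIV. of_int (sign p) * (\<Prod>a\<in>UNIV. M $ of_wo a $ of_wo (p a)))"
    by (intro sum.cong) (simp_all add: pr sg)
  finally show ?thesis by (simp add: det_def)
qed

text \<open>If one of the two sides is finite, then the corresponding nonnegative function is absolutely integrable, and the
  theorem for such functions applies; otherwise both sides are infinite.\<close>

lemma nn_integral_change_of_variables_wellorder:
  fixes g :: "real^'m::{finite,wellorder} \<Rightarrow> real^'m::_" and f :: "real^'m::_ \<Rightarrow> real"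
  assumes S: "S \<in> sets borel"
    and g: "\<And>x. x \<in> S \<Longrightarrow> (g has_derivative g' x) (at x within S)" and inj: "inj_on g S"
    and f0: "\<And>y. y \<in> g ` S \<Longrightarrow> 0 \<le> f y"
    and mf: "set_borel_measurable borel (g ` S) f"
    and mh: "set_borel_measurable borel S (\<lambda>x. \<bar>det (matrix (g' x))\<bar> * f (g x))"
  shows "(\<integral>\<^sup>+y\<in>g ` S. f y \<partial>lborel) = (\<integral>\<^sup>+x\<in>S. \<bar>det (matrix (g' x))\<bar> * f (g x) \<partial>lborel)"
proof -
  let ?h = "\<lambda>x. \<bar>det (matrix (g' x))\<bar> * f (g x)"
  have h0: "0 \<le> ?h x" if "x \<in> S" for x using f0 that by simp
  have "(f has_integral b) (g ` S) \<longleftrightarrow> (?h has_integral b) S" for b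
  proof -
    have Sl: "S \<in> sets lebesgue" using S by auto
    have "?h absolutely_integrable_on S \<and> integral S ?h = b \<longleftrightarrow> f absolutely_integrable_on (g ` S) \<and> integral (g ` S) f = b"
      using has_absolute_integral_change_of_variables[OF Sl g inj, of "\<lambda>x. vec (f x) :: real^1" "vec b"]
      by (simp add: absolutely_integrable_on_1_iff integral_on_1_eq vec_eq_iff)
    then show ?thesis
      using f0 h0 by (auto simp: absolutely_integrable_on_iff_nonneg has_integral_iff)
  qed
  note iff = this
  have ex: "\<exists>b. (k has_integral b) A" if "set_borel_measurable borel A k" "\<And>x. x \<in> A \<Longrightarrow> 0 \<le> k x" "(\<integral>\<^sup>+x\<in>A. k x \<partial>lborel) < \<infinity>"
    for k :: "real^'m::{finite,wellorder} \<Rightarrow> real" and A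
  proof -
    have "(\<integral>\<^sup>+x. ennreal (indicator A x * k x) \<partial>lborel) = (\<integral>\<^sup>+x\<in>A. k x \<partial>lborel)"
      by (intro nn_integral_cong) (auto simp: indicator_def)
    then have "(\<lambda>x. indicator A x * k x) integrable_on UNIV"
      using that by (intro nn_integral_integrable_on) (auto simp: set_borel_measurable_def indicator_def)
    moreover have "(\<lambda>x. indicator A x * k x) = (\<lambda>x. if x \<in> A then k x else 0)"
      by (auto simp: indicator_def)
    ultimately have "k integrable_on A" by (simp add: integrable_restrict_UNIV)
    then show ?thesis by (intro exI) (rule integrable_integral)
  qed
  show ?thesis
  proof (cases "(\<integral>\<^sup>+y\<in>g ` S. f y \<partial>lborel) < \<infinity> \<or> (\<integral>\<^sup>+x\<in>S. ?h x \<partial>lborel) < \<infinity>")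
    case True
    then have "\<exists>b. (f has_integral b) (g ` S)"
    proof
      assume fin: "(\<integral>\<^sup>+y\<in>g ` S. f y \<partial>lborel) < \<infinity>"
      show ?thesis by (rule ex[OF mf _ fin]) (rule f0)
    next
      assume fin: "(\<integral>\<^sup>+x\<in>S. ?h x \<partial>lborel) < \<infinity>"
      have "\<exists>b. (?h has_integral b) S" by (rule ex[OF mh _ fin]) (rule h0)
      then show ?thesis unfolding iff .
    qed
    then obtain b where b: "(f has_integral b) (g ` S)" ..
    then have b': "(?h has_integral b) S" unfolding iff .
    have 1: "(\<integral>\<^sup>+y\<in>g ` S. f y \<partial>lborel) = ennreal b"
      by (rule nn_integral_has_integral_lebesgue'[OF _ b]) (rule f0)
    have 2: "(\<integral>\<^sup>+x\<in>S. ?h x \<partial>lborel) = ennreal b"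
      by (rule nn_integral_has_integral_lebesgue'[OF _ b']) (rule h0)
    show ?thesis by (rule trans[OF 1 2[symmetric]])
  next
    case False
    then show ?thesis unfolding infinity_ennreal_def less_top[symmetric] by (simp only: de_Morgan_disj not_not)
  qed
qed

lemma nn_integral_change_of_variables:
  fixes g :: "real^'n::finite \<Rightarrow> real^'n" and f :: "real^'n \<Rightarrow> real"
  assumes S: "S \<in> sets borel" and gS: "g ` S \<in> sets borel"
    and g: "\<And>x. x \<in> S \<Longrightarrow> (g has_derivative g' x) (at x within S)" and inj: "inj_on g S"
    and f0: "\<And>y. y \<in> g ` S \<Longrightarrow> 0 \<le> f y"
    and mf: "set_borel_measurable borel (g ` S) f"
    and mh: "set_borel_measurable borel S (\<lambda>x. \<bar>det (matrix (g' x))\<bar> * f (g x))"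
  shows "(\<integral>\<^sup>+y\<in>g ` S. f y \<partial>lborel) = (\<integral>\<^sup>+x\<in>S. \<bar>det (matrix (g' x))\<bar> * f (g x) \<partial>lborel)"
proof -
  let ?S = "of_vec_wo -` S" and ?g = "\<lambda>y. to_vec_wo (g (of_vec_wo y))"
  let ?g' = "\<lambda>y v. to_vec_wo (g' (of_vec_wo y) (of_vec_wo v))" and ?f = "\<lambda>y. f (of_vec_wo y)"
  have img: "?g ` ?S = of_vec_wo -` (g ` S)"
  proof (intro set_eqI iffI)
    fix y assume "y \<in> of_vec_wo -` (g ` S)"
    then have "of_vec_wo y \<in> g ` S" by simp
    then obtain x where x: "of_vec_wo y = g x" "x \<in> S" by (rule imageE)
    have "y = ?g (to_vec_wo x)" using arg_cong[OF x(1), of to_vec_wo] by simp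
    moreover have "to_vec_wo x \<in> ?S" using x(2) by simp
    ultimately show "y \<in> ?g ` ?S" by blast
  qed auto
  have mSm: "of_vec_wo -` A \<in> sets borel" if "A \<in> sets borel" for A :: "(real^'n) set"
    using measurable_sets[OF measurable_vec_wo(2) that] by simp
  have det: "det (matrix (?g' y)) = det (matrix (g' (of_vec_wo y)))" for y
  proof -
    have "matrix (?g' y) = (\<chi> a b. matrix (g' (of_vec_wo y)) $ of_wo a $ of_wo b)"
    proof -
      have "of_vec_wo (axis b 1) = axis (of_wo b) (1::real)" for b :: "'n wo"
        by (auto simp: of_vec_wo_def axis_def vec_eq_iff)
      then show ?thesis by (simp add: matrix_def to_vec_wo_def)
    qed
    then show ?thesis by (simp add: det_wo)
  qed
  have transfer: "(\<integral>\<^sup>+y\<in>A. k y \<partial>lborel) = (\<integral>\<^sup>+y\<in>of_vec_wo -` A. k (of_vec_wo y) \<partial>lborel)"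
    if "set_borel_measurable borel A k" for A and k :: "real^'n \<Rightarrow> real"
  proof -
    have [measurable]: "(\<lambda>x. indicator A x * k x) \<in> borel_measurable borel"
      using that by (simp add: set_borel_measurable_def)
    have "(\<integral>\<^sup>+y\<in>A. k y \<partial>lborel) = (\<integral>\<^sup>+y. ennreal (indicator A y * k y) \<partial>(distr lborel borel of_vec_wo))"
      unfolding lborel_of_vec_wo by (intro nn_integral_cong) (auto simp: indicator_def)
    also have "\<dots> = (\<integral>\<^sup>+y. ennreal (indicator A (of_vec_wo y) * k (of_vec_wo y)) \<partial>lborel)"
      by (rule nn_integral_distr) measurable
    also have "\<dots> = (\<integral>\<^sup>+y\<in>of_vec_wo -` A. k (of_vec_wo y) \<partial>lborel)"
      by (intro nn_integral_cong) (auto simp: indicator_def)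
    finally show ?thesis .
  qed
  have meas: "set_borel_measurable borel (of_vec_wo -` A) (\<lambda>y. k (of_vec_wo y))"
    if "set_borel_measurable borel A k" for A and k :: "real^'n \<Rightarrow> real"
  proof -
    have [measurable]: "(\<lambda>x. indicator A x * k x) \<in> borel_measurable borel"
      using that by (simp add: set_borel_measurable_def)
    have "(\<lambda>y. indicator A (of_vec_wo y) * k (of_vec_wo y)) \<in> borel_measurable borel" by measurable
    then show ?thesis by (simp add: set_borel_measurable_def indicator_def vimage_def cong: if_cong)
  qed
  have "(\<integral>\<^sup>+y\<in>g ` S. f y \<partial>lborel) = (\<integral>\<^sup>+y\<in>?g ` ?S. ?f y \<partial>lborel)"
    by (simp add: transfer[OF mf] img)
  also have "\<dots> = (\<integral>\<^sup>+y\<in>?S. \<bar>det (matrix (?g' y))\<bar> * ?f (?g y) \<partial>lborel)"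
  proof (rule nn_integral_change_of_variables_wellorder)
    show "?S \<in> sets borel" by (rule mSm[OF S])
    show "(?g has_derivative ?g' y) (at y within ?S)" if "y \<in> ?S" for y
    proof -
      have "(g has_derivative g' (of_vec_wo y)) (at (of_vec_wo y) within of_vec_wo ` ?S)"
      proof (rule has_derivative_subset[OF g])
        show "of_vec_wo y \<in> S" using that by simp
      qed auto
      then have "((\<lambda>y. g (of_vec_wo y)) has_derivative (\<lambda>v. g' (of_vec_wo y) (of_vec_wo v))) (at y within ?S)"
        by (rule has_derivative_in_compose[OF bounded_linear_imp_has_derivative[OF bounded_linear_vec_wo(2)]])
      then show ?thesis by (rule bounded_linear.has_derivative[OF bounded_linear_vec_wo(1)])
    qed
    show "inj_on ?g ?S"
    proof (rule inj_onI)
      fix x y assume xy: "x \<in> ?S" "y \<in> ?S" "?g x = ?g y"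
      then have "g (of_vec_wo x) = g (of_vec_wo y)" by (metis vec_wo_inverse(1))
      then have "of_vec_wo x = of_vec_wo y" using inj xy by (auto simp: inj_on_def)
      then show "x = y" by (metis vec_wo_inverse(2))
    qed
    show "0 \<le> ?f y" if "y \<in> ?g ` ?S" for y using that f0 unfolding img by auto
    show "set_borel_measurable borel (?g ` ?S) ?f" unfolding img by (rule meas[OF mf])
    show "set_borel_measurable borel ?S (\<lambda>y. \<bar>det (matrix (?g' y))\<bar> * ?f (?g y))"
      using meas[OF mh] by (simp add: det)
  qed
  also have "\<dots> = (\<integral>\<^sup>+x\<in>S. \<bar>det (matrix (g' x))\<bar> * f (g x) \<partial>lborel)"
    by (simp add: transfer[OF mh] det)
  finally show ?thesis .
qed

section \<open>The divergence theorem in a chart\<close>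

lemma pd_prod:
  assumes "\<And>a. a \<in> I \<Longrightarrow> f a differentiable (at x)"
  shows "pd i (\<lambda>y. \<Prod>a\<in>I. f a y) x = (\<Sum>a\<in>I. pd i (f a) x * (\<Prod>b\<in>I - {a}. f b x))"
proof -
  have "((\<lambda>y. \<Prod>a\<in>I. f a y) has_derivative
      (\<lambda>v. \<Sum>a\<in>I. frechet_derivative (f a) (at x) v * (\<Prod>b\<in>I - {a}. f b x))) (at x)"
    by (rule has_derivative_prod) (rule frechet_derivative_worksI[OF assms])
  then show ?thesis by (rule pd_eqI[THEN trans]) (simp add: pd_def)
qed

lemma differentiable_prod:
  fixes f :: "'i \<Rightarrow> real^'n::finite \<Rightarrow> real"
  assumes "\<And>a. a \<in> I \<Longrightarrow> f a differentiable (at x)"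
  shows "(\<lambda>y. \<Prod>a\<in>I. f a y) differentiable (at x)"
  unfolding differentiable_def
  by (rule exI, rule has_derivative_prod, rule frechet_derivative_worksI) (rule assms)

lemma differentiable_det:
  fixes F :: "real^'n::finite \<Rightarrow> real^'m::finite^'m"
  assumes "\<And>a b. (\<lambda>y. F y $ a $ b) differentiable (at x)"
  shows "(\<lambda>y. det (F y)) differentiable (at x)"
  unfolding det_def
  by (intro differentiable_sum differentiable_mult differentiable_const differentiable_prod assms ballI) simp

text \<open>A permutation other than the identity moves at least two indices, so in its summand of the
  Leibniz formula at least two factors vanish at \<open>x\<close>, and the product rule gives \<open>0\<close>.\<close>

lemma pd_det_at_identity:
  fixes M :: "real^'n::finite \<Rightarrow> real^'n^'n"
  assumes d: "\<And>a b. (\<lambda>y. M y $ a $ b) differentiable (at x)" and id: "M x = mat 1"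
  shows "pd i (\<lambda>y. det (M y)) x = trace (pd_mat i M x)"
proof -
  have dp: "(\<lambda>y. \<Prod>a\<in>UNIV. M y $ a $ p a) differentiable (at x)" for p
    by (rule differentiable_prod) (rule d)
  have p0: "pd i (\<lambda>y. \<Prod>a\<in>UNIV. M y $ a $ p a) x = (if p = id then trace (pd_mat i M x) else 0)"
    if p: "p permutes UNIV" for p
  proof -
    have *: "pd i (\<lambda>y. \<Prod>a\<in>UNIV. M y $ a $ p a) x
      = (\<Sum>a\<in>UNIV. pd i (\<lambda>y. M y $ a $ p a) x * (\<Prod>b\<in>UNIV - {a}. mat 1 $ b $ p b))"
      by (subst pd_prod) (simp_all add: d id)
    show ?thesis
    proof (cases "p = id")
      case True
      then show ?thesis unfolding * by (simp add: mat_def trace_def pd_mat_def)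
    next
      case False
      then obtain c where c: "p c \<noteq> c" by (auto simp: fun_eq_iff)
      have z: "(\<Prod>b\<in>UNIV - {a}. (mat 1 :: real^'n^'n) $ b $ p b) = 0" for a
      proof -
        \<comment> \<open>A moved index different from \<open>a\<close>; \<open>p c\<close> is moved whenever \<open>c\<close> is.\<close>
        define b where "b = (if a = c then p c else c)"
        have "p (p c) \<noteq> p c" using permutes_inj[OF p] c by (auto simp: inj_on_def)
        then have "b \<noteq> a" "p b \<noteq> b" using c by (auto simp: b_def)
        then show ?thesis by (intro prod_zero bexI[of _ b]) (auto simp: mat_def)
      qed
      show ?thesis unfolding * z using False by simp
    qed
  qed
  have "pd i (\<lambda>y. det (M y)) x = (\<Sum>p | p permutes UNIV. of_int (sign p) * pd i (\<lambda>y. \<Prod>a\<in>UNIV. M y $ a $ p a) x)"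
    unfolding det_def by (subst pd_sum) (simp_all add: dp pd_mult differentiable_mult)
  also have "\<dots> = (\<Sum>p | p permutes (UNIV :: 'n set). if p = id then trace (pd_mat i M x) else 0)"
    by (intro sum.cong refl) (simp add: p0)
  also have "\<dots> = trace (pd_mat i M x)"
    by (simp add: finite_permutations permutes_id)
  finally show ?thesis .
qed

text \<open>Factor out \<open>F x\<close> to reduce to a map whose value at \<open>x\<close> is the identity matrix.\<close>

lemma Jacobi_formula:
  fixes F :: "real^'n::finite \<Rightarrow> real^'n^'n"
  assumes d: "\<And>a b. (\<lambda>y. F y $ a $ b) differentiable (at x)" and H: "H ** F x = mat 1"
  shows "pd i (\<lambda>y. det (F y)) x = det (F x) * trace (H ** pd_mat i F x)"
proof -
  have HF: "F x ** H = mat 1" using H by (simp add: matrix_left_right_inverse)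
  have dM: "(\<lambda>y. (H ** F y) $ a $ b) differentiable (at x)" for a b
    unfolding matrix_matrix_mult_def by (simp add: d differentiable_mult)
  have "(\<lambda>y. det (F y)) = (\<lambda>y. det (F x) * det (H ** F y))"
  proof
    fix y
    have "det (F x) * det H = 1" using arg_cong[OF HF, of det] by (simp add: det_mul)
    then show "det (F y) = det (F x) * det (H ** F y)" by (simp add: det_mul flip: mult.assoc)
  qed
  then have "pd i (\<lambda>y. det (F y)) x = pd i (\<lambda>y. det (F x) * det (H ** F y)) x" by (rule arg_cong)
  also have "\<dots> = det (F x) * trace (pd_mat i (\<lambda>y. H ** F y) x)"
    by (simp add: pd_mult differentiable_det[OF dM] pd_det_at_identity[OF dM H])
  also have "pd_mat i (\<lambda>y. H ** F y) x = H ** pd_mat i F x"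
    by (subst pd_mat_mult) (simp_all add: d, simp add: pd_mat_def vec_eq_iff matrix_matrix_mult_def)
  finally show ?thesis .
qed

lemma det_pos_def:
  fixes A :: "real^'n::finite^'n"
  assumes "transpose A = A" and "\<And>v. v \<noteq> 0 \<Longrightarrow> 0 < v \<bullet> (A *v v)"
  shows "0 < det A"
proof -
  obtain P :: "real^'n^'n" where "transpose P ** A ** P = mat 1"
    using pos_def_congruent_identity[OF assms] by blast
  from arg_cong[OF this, of det] have "det A * (det P)\<^sup>2 = 1"
    by (simp add: det_mul det_transpose power2_eq_square mult_ac)
  then show ?thesis by (metis zero_less_mult_pos2 zero_less_one zero_less_power2 mult_zero_right zero_neq_one power_zero_numeral)
qed

text \<open>The difference quotients of \<open>f\<close> in the direction of the \<open>i\<close>-th coordinate have integral \<open>0\<close> by translation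
  invariance, and they converge to the partial derivative. By the mean value theorem and the compactness of the support they are dominated by
  a multiple of the indicator of a ball.\<close>

lemma integral_pd_compact_support:
  fixes f :: "real^'n::finite \<Rightarrow> real"
  assumes f: "C_diff (Suc 0) UNIV f" and K: "compact K" and f0: "\<And>x. x \<notin> K \<Longrightarrow> f x = 0"
  shows "integrable lborel (pd i f)" "(\<integral>x. pd i f x \<partial>lborel) = 0"
proof -
  let ?e = "axis i 1 :: real^'n"
  have df: "f differentiable (at x)" for x using f by simp
  have cf: "continuous_on UNIV f"
    using C_diff_Suc_imp[OF f] by simp
  have cD: "continuous_on UNIV (pd i f)"
    using C_diff_pd[OF f] by simp
  have D0: "pd i f x = 0" if "x \<notin> K" for x
  proof -
    have "pd i (\<lambda>y. 0) x = pd i f x"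
      by (rule pd_cong[of "- K"]) (use K that f0 in \<open>auto intro: compact_imp_closed\<close>)
    then show ?thesis by simp
  qed
  have int: "integrable lborel k" if "continuous_on UNIV k" "\<And>x. x \<notin> K \<Longrightarrow> k x = 0" for k :: "real^'n \<Rightarrow> real"
  proof -
    have "integrable lborel (\<lambda>x. indicator K x *\<^sub>R k x)"
      by (rule borel_integrable_compact[OF K]) (rule continuous_on_subset[OF that(1) subset_UNIV])
    moreover have "(\<lambda>x. indicator K x *\<^sub>R k x) = k" using that(2) by (auto simp: indicator_def fun_eq_iff)
    ultimately show ?thesis by simp
  qed
  show intD: "integrable lborel (pd i f)" by (rule int[OF cD D0])
  have intf: "integrable lborel f" by (rule int[OF cf f0])
  have "bounded (pd i f ` K)"
    by (intro compact_imp_bounded compact_continuous_image K continuous_on_subset[OF cD subset_UNIV])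
  then obtain M where M: "\<And>x. x \<in> K \<Longrightarrow> \<bar>pd i f x\<bar> \<le> M" by (auto simp: bounded_iff)
  have M': "\<bar>pd i f x\<bar> \<le> max M 0" for x using M[of x] D0[of x] by (cases "x \<in> K") auto
  obtain R where R: "\<And>x. x \<in> K \<Longrightarrow> norm x \<le> R" using compact_imp_bounded[OF K] by (auto simp: bounded_iff)
  define t where "t n = 1 / real (Suc n)" for n
  have t: "0 < t n" "t n \<le> 1" for n by (simp_all add: t_def)
  define q where "q n x = (f (t n *\<^sub>R ?e + x) - f x) / t n" for n x
  have line: "((\<lambda>s. f (s *\<^sub>R ?e + x)) has_real_derivative pd i f (s *\<^sub>R ?e + x)) (at s)" for s x
  proof -
    let ?y = "s *\<^sub>R ?e + x"
    have 1: "((\<lambda>s. s *\<^sub>R ?e + x) has_derivative (\<lambda>h. h *\<^sub>R ?e)) (at s)"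
      by (auto intro!: derivative_eq_intros)
    have 2: "(f has_derivative frechet_derivative f (at ?y)) (at ?y)" by (rule frechet_derivative_worksI[OF df])
    have "((\<lambda>s. f (s *\<^sub>R ?e + x)) has_derivative (\<lambda>h. frechet_derivative f (at ?y) (h *\<^sub>R ?e))) (at s)"
      by (rule has_derivative_compose[OF 1 2])
    moreover have "(\<lambda>h. frechet_derivative f (at ?y) (h *\<^sub>R ?e)) = (*) (pd i f ?y)"
      by (simp add: fun_eq_iff linear_scale[OF linear_frechet_derivative[OF df]] pd_def)
    ultimately show ?thesis by (simp only: has_field_derivative_def)
  qed
  have q_mvt: "\<exists>s. 0 < s \<and> s < t n \<and> q n x = pd i f (s *\<^sub>R ?e + x)" for n x
  proof -
    have "\<exists>s>0. s < t n \<and> f (t n *\<^sub>R ?e + x) - f (0 *\<^sub>R ?e + x) = (t n - 0) * pd i f (s *\<^sub>R ?e + x)"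
      by (rule MVT2[where f = "\<lambda>s. f (s *\<^sub>R ?e + x)"]) (use t(1) line in auto)
    then obtain s where "0 < s" "s < t n" "f (t n *\<^sub>R ?e + x) - f (0 *\<^sub>R ?e + x) = (t n - 0) * pd i f (s *\<^sub>R ?e + x)"
      by auto
    then show ?thesis using t(1)[of n] by (intro exI[of _ s]) (simp add: q_def)
  qed
  have q_bound: "norm (q n x) \<le> max M 0 * indicator (cball 0 (R + 1)) x" for n x
  proof (cases "x \<in> cball 0 (R + 1)")
    case True
    then show ?thesis using q_mvt[of n x] M' by auto
  next
    case False
    have "t n *\<^sub>R ?e + x \<notin> K" "x \<notin> K"
    proof -
      have "norm (t n *\<^sub>R ?e + x) \<ge> norm x - norm (t n *\<^sub>R ?e)" by (metis add.commute norm_diff_ineq)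
      moreover have "norm (t n *\<^sub>R ?e) \<le> 1" using t[of n] by (simp add: norm_axis_1)
      ultimately show "t n *\<^sub>R ?e + x \<notin> K" "x \<notin> K" using False R[of x] R[of "t n *\<^sub>R ?e + x"] by force+
    qed
    then show ?thesis using f0 by (simp add: q_def)
  qed
  have q_int: "(\<integral>x. q n x \<partial>lborel) = 0" for n
  proof -
    have m: "f \<in> borel_measurable borel" by (rule borel_measurable_continuous_onI[OF cf])
    have eq: "(\<integral>x. f (t n *\<^sub>R ?e + x) \<partial>lborel) = (\<integral>x. f x \<partial>lborel)"
      using integral_distr[of "(+) (t n *\<^sub>R ?e)" lborel borel f] m by (simp add: lborel_distr_plus)
    have "integrable lborel (\<lambda>x. f (t n *\<^sub>R ?e + x))"
      using integrable_distr_eq[of "(+) (t n *\<^sub>R ?e)" lborel borel f] m intf by (simp add: lborel_distr_plus)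
    then show ?thesis using intf eq by (simp add: q_def)
  qed
  have q_lim: "(\<lambda>n. q n x) \<longlonglongrightarrow> pd i f x" for x
  proof -
    have "((\<lambda>s. (f (s *\<^sub>R ?e + x) - f x) / s) \<longlongrightarrow> pd i f x) (at 0)"
      using line[of x 0] by (simp add: DERIV_def)
    moreover have "filterlim t (at 0) sequentially"
      unfolding filterlim_at using LIMSEQ_inverse_real_of_nat t(1)
      by (auto simp: t_def[abs_def] inverse_eq_divide intro!: always_eventually)
    ultimately show ?thesis unfolding q_def by (rule filterlim_compose)
  qed
  have "(\<lambda>n. \<integral>x. q n x \<partial>lborel) \<longlonglongrightarrow> (\<integral>x. pd i f x \<partial>lborel)"
  proof (rule integral_dominated_convergence[where w = "\<lambda>x. max M 0 * indicator (cball 0 (R + 1)) x"])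
    show "pd i f \<in> borel_measurable lborel" using borel_measurable_continuous_onI[OF cD] by simp
    show "q n \<in> borel_measurable lborel" for n
    proof -
      have "continuous_on UNIV (q n)"
        unfolding q_def[abs_def] using t(1)[of n]
        by (intro continuous_intros continuous_on_compose2[OF cf]) auto
      then show ?thesis by (simp add: borel_measurable_continuous_onI)
    qed
    \<comment> \<open>The radius \<open>R + 1\<close> leaves room for the steps \<open>t n \<le> 1\<close> of the difference quotients.\<close>
    show "integrable lborel (\<lambda>x. max M 0 * indicator (cball 0 (R + 1)) x :: real)"
      by (intro integrable_mult_right integrable_real_indicator) (auto simp: emeasure_bounded_finite[unfolded infinity_ennreal_def])
    show "AE x in lborel. (\<lambda>n. q n x) \<longlonglongrightarrow> pd i f x" by (simp add: q_lim)
    show "AE x in lborel. norm (q n x) \<le> max M 0 * indicator (cball 0 (R + 1)) x" for n by (intro AE_I2 q_bound)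
  qed
  then show "(\<integral>x. pd i f x \<partial>lborel) = 0" by (simp add: q_int LIMSEQ_const_iff)
qed

lemma C_diff_open_Un:
  assumes "open S" "open T" "C_diff k S f" "C_diff k T f"
  shows "C_diff k (S \<union> T) f"
  using assms(3,4)
proof (induction k arbitrary: f)
  case 0
  then show ?case using assms(1,2) by (simp add: continuous_on_open_Un)
next
  case (Suc k)
  then show ?case by (auto simp: Suc.IH)
qed

text \<open>The extended function is \<open>f\<close> on \<open>V\<close> and \<open>0\<close> on the open set \<open>W - K\<close>, and these two sets cover \<open>W\<close>.\<close>

lemma C_diff_zero_extension:
  assumes "open V" "open (W - K)" "V \<subseteq> W" "K \<subseteq> V" "C_diff k V f" and "\<And>x. x \<in> V - K \<Longrightarrow> f x = 0"
  shows "C_diff k W (\<lambda>x. if x \<in> V then f x else 0)"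
proof -
  let ?F = "\<lambda>x. if x \<in> V then f x else 0"
  have "C_diff k V ?F" by (rule C_diff_cong[OF assms(1) _ assms(5)]) simp
  moreover have "C_diff k (W - K) ?F"
    by (rule C_diff_cong[OF assms(2) _ C_diff_const[of k _ 0]]) (use assms(6) in auto)
  moreover have "V \<union> (W - K) = W" using assms(3,4) by auto
  ultimately show ?thesis using C_diff_open_Un[OF assms(1,2)] by metis
qed

context metric_chart
begin

lemma det_G_pos: "x \<in> V \<Longrightarrow> 0 < det (G x)"
  by (rule det_pos_def[OF transpose_G]) (auto intro: G_pos)

lemma smooth_det_G: "smooth_on V (\<lambda>x. det (G x))"
  by (rule smooth_on_det[OF open_V G_smooth])

lemma C_diff_volume_density: "C_diff k V (\<lambda>x. sqrt (det (G x)))"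
  by (rule C_diff_sqrt[OF open_V smooth_on_C_diff[OF smooth_det_G] det_G_pos])

text \<open>By Jacobi's formula and \<open>\<partial>\<^sub>i G = \<Gamma>\<^sub>i\<^sup>T G + G \<Gamma>\<^sub>i\<close>.\<close>

lemma pd_det_G:
  assumes x: "x \<in> V"
  shows "pd i (\<lambda>y. det (G y)) x = det (G x) * (2 * (\<Sum>a\<in>UNIV. christoffel G a i a x))"
proof -
  let ?H = "matrix_inv (G x)"
  have "trace (?H ** pd_mat i G x) = trace (?H ** (transpose (Gam i x) ** G x)) + trace (?H ** G x ** Gam i x)"
    by (simp add: pd_mat_G[OF x] matrix_add_ldistrib trace_add matrix_mul_assoc)
  also have "trace (?H ** (transpose (Gam i x) ** G x)) = trace (transpose (Gam i x) ** (G x ** ?H))"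
    by (subst trace_mul_sym) (simp add: matrix_mul_assoc)
  finally have "trace (?H ** pd_mat i G x) = 2 * trace (Gam i x)"
    by (simp add: mul_inv_G[OF x] inv_G[OF x]) (simp add: trace_def transpose_def)
  then show ?thesis
    using Jacobi_formula[OF G_diff[OF x] inv_G[OF x], of i] by (simp add: trace_def Gam_def)
qed

lemma pd_volume_density:
  assumes x: "x \<in> V"
  shows "pd i (\<lambda>y. sqrt (det (G y))) x = sqrt (det (G x)) * (\<Sum>a\<in>UNIV. christoffel G a i a x)"
proof -
  let ?\<Gamma> = "\<Sum>a\<in>UNIV. christoffel G a i a x"
  have p: "0 < det (G x)" by (rule det_G_pos[OF x])
  have dd: "(\<lambda>y. det (G y)) differentiable (at x)" by (rule smooth_on_D[OF smooth_det_G x])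
  have "pd i (\<lambda>y. sqrt (det (G y))) x = inverse (sqrt (det (G x))) * (1/2) * pd i (\<lambda>y. det (G y)) x"
    by (rule pd_eqI[OF has_derivative_compose[OF frechet_derivative_worksI[OF dd]
        DERIV_real_sqrt[OF p, unfolded has_field_derivative_def]], THEN trans]) (simp add: pd_def)
  also have "\<dots> = (det (G x) / sqrt (det (G x))) * ?\<Gamma>"
    unfolding pd_det_G[OF x] by (simp add: field_simps)
  also have "det (G x) / sqrt (det (G x)) = sqrt (det (G x))" by (rule real_div_sqrt) (use p in simp)
  finally show ?thesis .
qed

text \<open>The classical formula \<open>sqrt (det g) div W = \<partial>\<^sub>i (sqrt (det g) W\<^sup>i)\<close>: the derivatives of the density account for the
  Christoffel symbols in \<open>div W\<close>.\<close>

lemma weighted_divergence: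
  assumes x: "x \<in> V" and W: "\<And>i. (\<lambda>y. W y $ i) differentiable (at x)"
  shows "(\<Sum>i\<in>UNIV. pd i (\<lambda>y. sqrt (det (G y)) * W y $ i) x) = sqrt (det (G x)) * divergence_vec G W x"
proof -
  let ?w = "sqrt (det (G x))"
  have dw: "(\<lambda>y. sqrt (det (G y))) differentiable (at x)"
    using C_diff_volume_density[of "Suc 0"] x by simp
  have "(\<Sum>i\<in>UNIV. pd i (\<lambda>y. sqrt (det (G y)) * W y $ i) x)
    = ?w * ((\<Sum>i\<in>UNIV. pd i (\<lambda>y. W y $ i) x) + (\<Sum>i\<in>UNIV. \<Sum>a\<in>UNIV. christoffel G a i a x * W x $ i))"
    by (simp add: pd_mult dw W pd_volume_density[OF x] sum.distrib distrib_left sum_distrib_left sum_distrib_right mult_ac)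
  also have "(\<Sum>i\<in>UNIV. \<Sum>a\<in>UNIV. christoffel G a i a x * W x $ i) = (\<Sum>a\<in>UNIV. \<Sum>i\<in>UNIV. christoffel G a a i x * W x $ i)"
    by (subst sum.swap) (simp add: chr_sym[OF x, of a _ a for a])
  finally show ?thesis by (simp add: divergence_vec_def nabla_vec_def sum.distrib)
qed

theorem chart_divergence_theorem:
  assumes W: "\<And>i. C_diff (Suc 0) V (\<lambda>y. W y $ i)" and K: "compact K" "K \<subseteq> V"
    and W0: "\<And>y. y \<in> V - K \<Longrightarrow> W y = 0"
  shows "(\<integral>x. indicator V x * (sqrt (det (G x)) * divergence_vec G W x) \<partial>lborel) = 0"
proof -
  \<comment> \<open>Extended by zero, \<open>sqrt (det g) W\<^sup>i\<close> is a compactly supported function on the whole space.\<close>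
  define h where "h i y = (if y \<in> V then sqrt (det (G y)) * W y $ i else 0)" for i y
  have "C_diff (Suc 0) V (\<lambda>y. sqrt (det (G y)) * W y $ i)" for i
    by (rule C_diff_mult[OF open_V C_diff_volume_density W])
  then have h: "C_diff (Suc 0) UNIV (h i)" for i
    unfolding h_def[abs_def] using K W0
    by (intro C_diff_zero_extension[where K = K] open_V) (auto simp: Compl_eq_Diff_UNIV[symmetric] compact_imp_closed)
  have h0: "h i x = 0" if "x \<notin> K" for i x
    using that by (simp add: h_def W0)
  have dW: "(\<lambda>y. W y $ i) differentiable (at x)" if "x \<in> V" for i x using W that by simp
  have dw: "(\<lambda>y. sqrt (det (G y))) differentiable (at x)" if "x \<in> V" for x
    using C_diff_volume_density[of "Suc 0"] that by simp
  have "indicator V x * (sqrt (det (G x)) * divergence_vec G W x) = (\<Sum>i\<in>UNIV. pd i (h i) x)" for x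
  proof (cases "x \<in> V")
    case True
    have "pd i (h i) x = pd i (\<lambda>y. sqrt (det (G y)) * W y $ i) x" for i
      by (rule pd_cong[OF open_V True, symmetric]) (use True in \<open>auto simp: h_def intro!: differentiable_mult dw dW\<close>)
    then show ?thesis using True by (simp add: weighted_divergence dW)
  next
    case False
    have "pd i (h i) x = pd i (\<lambda>y. 0) x" for i
      by (rule pd_cong[of "- K", symmetric]) (use K False h0 in \<open>auto intro: compact_imp_closed\<close>)
    then show ?thesis using False by simp
  qed
  then show ?thesis
    using integral_pd_compact_support[OF h K(1) h0] by (simp add: Bochner_Integration.integral_sum)
qed

end

section \<open>Change of coordinates\<close>

definition jac_mat :: "(real^'n::finite \<Rightarrow> real^'n) \<Rightarrow> real^'n \<Rightarrow> real^'n^'n" where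
  "jac_mat \<tau> x = (\<chi> k i. pd i (\<lambda>y. \<tau> y $ k) x)"

lemma matrix_frechet_derivative:
  assumes "\<tau> differentiable (at x)"
  shows "matrix (frechet_derivative \<tau> (at x)) = jac_mat \<tau> x"
proof -
  have "pd i (\<lambda>y. \<tau> y $ k) x = frechet_derivative \<tau> (at x) (axis i 1) $ k" for i k
    by (rule pd_eqI) (rule bounded_linear.has_derivative[OF bounded_linear_vec_nth frechet_derivative_worksI[OF assms]])
  then show ?thesis by (simp add: matrix_def jac_mat_def vec_eq_iff)
qed

lemma bilinear_pullback_matrix:
  fixes S T :: "real^'n::finite^'n"
  assumes "linear J" "\<And>v w. v \<bullet> (S *v w) = J v \<bullet> (T *v J w)"
  shows "S = transpose (matrix J) ** T ** matrix J"
proof -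
  define M where "M = matrix J"
  have J: "J v = M *v v" for v unfolding M_def by (rule fun_cong[OF matrix_vector_mul(2)[OF assms(1), symmetric]])
  have tr: "v \<bullet> (transpose M *v u) = (M *v v) \<bullet> u" for u v
    by (metis dot_lmul_matrix vector_transpose_matrix)
  have bl: "v \<bullet> (S *v w) = v \<bullet> ((transpose M ** T ** M) *v w)" for v w
  proof -
    have "v \<bullet> (S *v w) = (M *v v) \<bullet> (T *v (M *v w))" using assms(2)[of v w] by (simp only: J)
    also have "\<dots> = v \<bullet> ((transpose M ** T ** M) *v w)"
      by (simp only: matrix_vector_mul_assoc[symmetric] tr)
    finally show ?thesis .
  qed
  have "S *v w = (transpose M ** T ** M) *v w" for w
    by (rule vector_eq_ldot[THEN iffD1], rule allI, rule bl)
  then show ?thesis unfolding matrix_eq M_def by (rule allI)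
qed

lemma pd_compose:
  fixes \<tau> :: "real^'n::finite \<Rightarrow> real^'m::finite"
  assumes "\<tau> differentiable (at x)" "f differentiable (at (\<tau> x))"
  shows "pd i (\<lambda>y. f (\<tau> y)) x = (\<Sum>m\<in>UNIV. pd m f (\<tau> x) * pd i (\<lambda>y. \<tau> y $ m) x)"
proof -
  have \<tau>: "(\<tau> has_derivative frechet_derivative \<tau> (at x)) (at x)" by (rule frechet_derivative_worksI[OF assms(1)])
  have "pd i (\<lambda>y. \<tau> y $ m) x = frechet_derivative \<tau> (at x) (axis i 1) $ m" for m
    by (rule pd_eqI) (rule bounded_linear.has_derivative[OF bounded_linear_vec_nth \<tau>])
  then show ?thesis
    using pd_eqI[OF has_derivative_compose[OF \<tau> pd_has_derivative[OF assms(2)]], of i] by (simp add: mult.commute)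
qed

text \<open>The formula \<open>div X = \<partial>\<^sub>i X\<^sup>i + \<onehalf> X(log (det g))\<close> depends on the metric through its determinant only, which transforms in a simple way.\<close>

lemma (in metric_chart) divergence_eq_log_derivative:
  assumes x: "x \<in> V"
  shows "divergence_vec G X x = (\<Sum>i\<in>UNIV. pd i (\<lambda>y. X y $ i) x)
    + (1/2) * (\<Sum>i\<in>UNIV. X x $ i * pd i (\<lambda>y. det (G y)) x) / det (G x)"
proof -
  have p: "det (G x) \<noteq> 0" using det_G_pos[OF x] by simp
  have "(\<Sum>i\<in>UNIV. X x $ i * pd i (\<lambda>y. det (G y)) x)
      = 2 * det (G x) * (\<Sum>i\<in>UNIV. X x $ i * (\<Sum>a\<in>UNIV. christoffel G a i a x))"
    by (simp only: pd_det_G[OF x] sum_distrib_left mult_ac)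
  then have "(1/2) * (\<Sum>i\<in>UNIV. X x $ i * pd i (\<lambda>y. det (G y)) x) / det (G x) = (\<Sum>i\<in>UNIV. X x $ i * (\<Sum>a\<in>UNIV. christoffel G a i a x))"
    using p by simp
  also have "\<dots> = (\<Sum>a\<in>UNIV. \<Sum>i\<in>UNIV. christoffel G a i a x * X x $ i)"
    by (simp add: sum_distrib_left mult.commute) (rule sum.swap)
  also have "\<dots> = (\<Sum>a\<in>UNIV. \<Sum>i\<in>UNIV. christoffel G a a i x * X x $ i)"
    by (intro sum.cong refl arg_cong2[where f = "(*)"] chr_sym[OF x])
  finally show ?thesis by (simp add: divergence_vec_def nabla_vec_def sum.distrib)
qed

text \<open>The Lie derivative by partial derivatives only: the Christoffel symbols in \<open>\<nabla>X\<close> are absorbed by \<open>X(g)\<close>, as the metric is parallel.\<close>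

lemma (in metric_chart) lie_metric_eq_matrix:
  assumes x: "x \<in> V"
  shows "lie_metric G X x = (\<Sum>a\<in>UNIV. X x $ a *\<^sub>R pd_mat a G x) + transpose (jac_mat X x) ** G x + G x ** jac_mat X x"
proof -
  have "lie_metric G X x $ i $ j = ((\<Sum>a\<in>UNIV. X x $ a *\<^sub>R pd_mat a G x) + transpose (jac_mat X x) ** G x + G x ** jac_mat X x) $ i $ j" for i j
  proof -
    have half: "(\<Sum>k\<in>UNIV. G x $ k $ q * nabla_vec G X x $ p $ k)
        = (\<Sum>k\<in>UNIV. G x $ k $ q * pd p (\<lambda>y. X y $ k) x) + (\<Sum>a\<in>UNIV. X x $ a * (\<Sum>k\<in>UNIV. christoffel G k a p x * G x $ k $ q))" for p q
    proof -
      have "(\<Sum>k\<in>UNIV. G x $ k $ q * (\<Sum>a\<in>UNIV. christoffel G k p a x * X x $ a))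
          = (\<Sum>k\<in>UNIV. G x $ k $ q * (\<Sum>a\<in>UNIV. christoffel G k a p x * X x $ a))"
        by (intro sum.cong refl arg_cong2[where f = "(*)"] chr_sym[OF x])
      also have "\<dots> = (\<Sum>a\<in>UNIV. X x $ a * (\<Sum>k\<in>UNIV. christoffel G k a p x * G x $ k $ q))"
        by (simp add: sum_distrib_left mult_ac) (rule sum.swap)
      finally show ?thesis by (simp add: nabla_vec_def distrib_left sum.distrib)
    qed
    have sym2: "(\<Sum>a\<in>UNIV. christoffel G a m j x * G x $ i $ a) = (\<Sum>a\<in>UNIV. christoffel G a m j x * G x $ a $ i)" for m
      by (simp add: G_sym[OF x, of i])
    have "(\<Sum>a\<in>UNIV. X x $ a * pd a (\<lambda>y. G y $ i $ j) x)
       = (\<Sum>a\<in>UNIV. X x $ a * (\<Sum>k\<in>UNIV. christoffel G k a i x * G x $ k $ j)) + (\<Sum>a\<in>UNIV. X x $ a * (\<Sum>k\<in>UNIV. christoffel G k a j x * G x $ k $ i))"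
      unfolding metric_compat[OF x] sym2 distrib_left sum.distrib ..
    then show ?thesis
      by (simp add: lie_metric_def half pd_mat_def matrix_matrix_mult_def transpose_def jac_mat_def mult.commute G_sym[OF x, of i])
  qed
  then show ?thesis by (simp add: vec_eq_iff)
qed

text \<open>The map \<open>\<tau>\<close> is the transition map on the overlap \<open>U\<close>, in coordinates of the first chart; it is an isometry from \<open>G\<close> to \<open>G'\<close>.\<close>

locale chart_change = M: metric_chart G V + M': metric_chart G' V'
  for G :: "real^'n::finite \<Rightarrow> real^'n^'n" and V and G' :: "real^'n::finite \<Rightarrow> real^'n^'n" and V' +
  fixes \<tau> :: "real^'n \<Rightarrow> real^'n" and U
  assumes open_U: "open U" and U_V: "U \<subseteq> V" and \<tau>_smooth: "smooth_on U \<tau>" and \<tau>_maps: "\<And>x. x \<in> U \<Longrightarrow> \<tau> x \<in> V'"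
    and pullback: "\<And>x. x \<in> U \<Longrightarrow> G x = transpose (jac_mat \<tau> x) ** G' (\<tau> x) ** jac_mat \<tau> x"
begin

lemma smooth_\<tau>_nth: "smooth_on U (\<lambda>y. \<tau> y $ k)"
  by (rule smooth_on_comp_nth[OF open_U \<tau>_smooth])

lemma diff_\<tau>: "x \<in> U \<Longrightarrow> \<tau> differentiable (at x)"
  by (rule smooth_on_D[OF \<tau>_smooth])

lemma diff_jac: "x \<in> U \<Longrightarrow> (\<lambda>y. jac_mat \<tau> y $ k $ i) differentiable (at x)"
  unfolding jac_mat_def using smooth_on_D[OF smooth_on_pd[OF smooth_\<tau>_nth]] by simp

lemma det_pullback: "x \<in> U \<Longrightarrow> det (G x) = (det (jac_mat \<tau> x))\<^sup>2 * det (G' (\<tau> x))"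
  by (simp add: pullback det_mul det_transpose power2_eq_square)

lemma det_jac_nonzero: "x \<in> U \<Longrightarrow> det (jac_mat \<tau> x) \<noteq> 0"
  using det_pullback[of x] M.det_G_pos[of x] U_V by fastforce

lemma volume_density_pullback:
  "x \<in> U \<Longrightarrow> sqrt (det (G x)) = \<bar>det (jac_mat \<tau> x)\<bar> * sqrt (det (G' (\<tau> x)))"
  by (simp add: det_pullback real_sqrt_mult)

text \<open>Differentiate \<open>X'(\<tau> y) = J y (X y)\<close>. The second derivatives of \<open>\<tau>\<close> are symmetric, which makes the derivative of \<open>J\<close> in the direction of \<open>X\<close> appear.\<close>

lemma jac_related:
  assumes x: "x \<in> U" and X: "\<And>i. (\<lambda>y. X y $ i) differentiable (at x)"
    and X': "\<And>i. (\<lambda>y. X' y $ i) differentiable (at (\<tau> x))"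
    and related: "\<And>y. y \<in> U \<Longrightarrow> X' (\<tau> y) = jac_mat \<tau> y *v X y"
  shows "jac_mat X' (\<tau> x) ** jac_mat \<tau> x
    = (\<Sum>i\<in>UNIV. X x $ i *\<^sub>R pd_mat i (jac_mat \<tau>) x) + jac_mat \<tau> x ** jac_mat X x"
proof -
  let ?J = "jac_mat \<tau> x"
  define D where "D = jac_mat X x"
  define D' where "D' = jac_mat X' (\<tau> x)"
  define B where "B = (\<Sum>i\<in>UNIV. X x $ i *\<^sub>R pd_mat i (jac_mat \<tau>) x)"
  have "D' ** ?J = B + ?J ** D"
  proof -
    have "(D' ** ?J) $ k $ j = (B + ?J ** D) $ k $ j" for k j
    proof -
      have sw: "pd j (\<lambda>y. jac_mat \<tau> y $ k $ i) x = pd i (\<lambda>y. jac_mat \<tau> y $ k $ j) x" for i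
        using pd_commute[OF smooth_\<tau>_nth open_U x, of j i k] by (simp add: jac_mat_def)
      have "(D' ** ?J) $ k $ j = pd j (\<lambda>y. X' (\<tau> y) $ k) x"
        using pd_compose[OF diff_\<tau>[OF x] X'[of k], of j]
        by (simp add: D'_def jac_mat_def[of X'] matrix_matrix_mult_def jac_mat_def)
      also have "\<dots> = pd j (\<lambda>y. \<Sum>i\<in>UNIV. jac_mat \<tau> y $ k $ i * X y $ i) x"
        by (rule pd_cong[OF open_U x differentiable_compose[OF X' diff_\<tau>[OF x]]])
          (simp add: related matrix_vector_mult_def)
      also have "\<dots> = (\<Sum>i\<in>UNIV. pd i (\<lambda>y. jac_mat \<tau> y $ k $ j) x * X x $ i) + (\<Sum>i\<in>UNIV. ?J $ k $ i * pd j (\<lambda>y. X y $ i) x)"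
        unfolding sw[symmetric] by (simp add: pd_sum pd_mult diff_jac x X differentiable_mult sum.distrib)
      finally show ?thesis
        by (simp add: B_def D_def jac_mat_def[of X] pd_mat_def matrix_matrix_mult_def mult.commute)
    qed
    then show ?thesis by (simp add: vec_eq_iff)
  qed
  then show ?thesis unfolding B_def D_def D'_def .
qed

text \<open>With \<open>J\<close> the Jacobian matrix and \<open>B\<close> its derivative along \<open>X\<close>, the previous identity gives
  \<open>\<partial>\<^sub>k X'\<^sup>k = \<partial>\<^sub>k X\<^sup>k + trace (J\<^sup>-\<^sup>1 B)\<close>. Since \<open>det G = (det J)\<^sup>2 det G'\<close>, the term \<open>\<onehalf> X(log (det G))\<close> exceeds
  \<open>\<onehalf> X'(log (det G'))\<close> by \<open>X(log |det J|)\<close>, which is the same trace by Jacobi's formula.\<close>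

theorem divergence_invariant:
  assumes x: "x \<in> U" and X: "\<And>i. (\<lambda>y. X y $ i) differentiable (at x)"
    and X': "\<And>i. (\<lambda>y. X' y $ i) differentiable (at (\<tau> x))"
    and related: "\<And>y. y \<in> U \<Longrightarrow> X' (\<tau> y) = jac_mat \<tau> y *v X y"
  shows "divergence_vec G' X' (\<tau> x) = divergence_vec G X x"
proof -
  let ?J = "jac_mat \<tau> x" and ?dJ = "\<lambda>i. pd i (\<lambda>y. det (jac_mat \<tau> y)) x"
  have xV: "x \<in> V" "\<tau> x \<in> V'" using x U_V \<tau>_maps by auto
  have J0: "det ?J \<noteq> 0" by (rule det_jac_nonzero[OF x])
  obtain K where K: "?J ** K = mat 1" "K ** ?J = mat 1"
    using J0 by (auto simp: invertible_det_nz[symmetric] invertible_def)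
  define D where "D = jac_mat X x"
  define D' where "D' = jac_mat X' (\<tau> x)"
  define B where "B = (\<Sum>i\<in>UNIV. X x $ i *\<^sub>R pd_mat i (jac_mat \<tau>) x)"
  have "D' ** ?J = B + ?J ** D"
    unfolding D_def D'_def B_def by (rule jac_related[OF x X X' related])
  then have "D' ** ?J ** K = (B + ?J ** D) ** K" by simp
  then have D': "D' = B ** K + ?J ** D ** K"
    by (simp add: matrix_mul_assoc[symmetric] K) (simp add: matrix_mul_add_left matrix_mul_assoc)
  have "trace D' = trace (K ** B) + trace (K ** (?J ** D))"
    unfolding D' trace_add trace_mul_sym[of B K] trace_mul_sym[of "?J ** D" K] ..
  then have tr: "trace D' = trace (K ** B) + trace D"
    by (simp add: matrix_mul_assoc K)
  have dJ: "?dJ i = det ?J * trace (K ** pd_mat i (jac_mat \<tau>) x)" for i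
    by (rule Jacobi_formula[OF diff_jac[OF x] K(2)])
  have "trace (K ** B) = (\<Sum>i\<in>UNIV. X x $ i * trace (K ** pd_mat i (jac_mat \<tau>) x))"
  proof -
    have "trace (K ** B) = (\<Sum>a\<in>UNIV. \<Sum>b\<in>UNIV. \<Sum>i\<in>UNIV. X x $ i * (K $ a $ b * pd_mat i (jac_mat \<tau>) x $ b $ a))"
      by (simp add: trace_def matrix_matrix_mult_def B_def sum_distrib_left mult_ac)
    also have "\<dots> = (\<Sum>a\<in>UNIV. \<Sum>i\<in>UNIV. \<Sum>b\<in>UNIV. X x $ i * (K $ a $ b * pd_mat i (jac_mat \<tau>) x $ b $ a))"
      by (intro sum.cong refl sum.swap)
    also have "\<dots> = (\<Sum>i\<in>UNIV. \<Sum>a\<in>UNIV. \<Sum>b\<in>UNIV. X x $ i * (K $ a $ b * pd_mat i (jac_mat \<tau>) x $ b $ a))"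
      by (rule sum.swap)
    finally show ?thesis by (simp add: trace_def matrix_matrix_mult_def sum_distrib_left)
  qed
  then have KB: "trace (K ** B) * det ?J = (\<Sum>i\<in>UNIV. X x $ i * ?dJ i)"
    by (simp add: dJ sum_distrib_left sum_distrib_right mult_ac)
  let ?\<delta> = "\<lambda>y. det (G y)" and ?\<delta>' = "\<lambda>y. det (G' y)"
  have d\<delta>': "?\<delta>' differentiable (at (\<tau> x))" by (rule smooth_on_D[OF M'.smooth_det_G xV(2)])
  have ddJ: "(\<lambda>y. det (jac_mat \<tau> y)) differentiable (at x)" by (rule differentiable_det[OF diff_jac[OF x]])
  have d\<delta>: "pd i ?\<delta> x = 2 * det ?J * ?dJ i * ?\<delta>' (\<tau> x) + (det ?J)\<^sup>2 * (\<Sum>m\<in>UNIV. pd m ?\<delta>' (\<tau> x) * ?J $ m $ i)" for i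
  proof -
    have "pd i ?\<delta> x = pd i (\<lambda>y. (det (jac_mat \<tau> y) * det (jac_mat \<tau> y)) * ?\<delta>' (\<tau> y)) x"
      by (rule pd_cong[OF open_U x smooth_on_D[OF M.smooth_det_G xV(1)]]) (simp add: det_pullback power2_eq_square)
    also have "\<dots> = (?dJ i * det ?J + det ?J * ?dJ i) * ?\<delta>' (\<tau> x) + det ?J * det ?J * pd i (\<lambda>y. ?\<delta>' (\<tau> y)) x"
      by (simp add: pd_mult ddJ differentiable_mult differentiable_compose[OF d\<delta>' diff_\<tau>[OF x]])
    also have "pd i (\<lambda>y. ?\<delta>' (\<tau> y)) x = (\<Sum>m\<in>UNIV. pd m ?\<delta>' (\<tau> x) * ?J $ m $ i)"
      by (simp add: pd_compose[OF diff_\<tau>[OF x] d\<delta>'] jac_mat_def)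
    finally show ?thesis by (simp add: power2_eq_square algebra_simps)
  qed
  have \<delta>0: "?\<delta>' (\<tau> x) \<noteq> 0" using M'.det_G_pos[OF xV(2)] by simp
  define T where "T = (\<Sum>m\<in>UNIV. X' (\<tau> x) $ m * pd m ?\<delta>' (\<tau> x))"
  have "(\<Sum>i\<in>UNIV. X x $ i * (\<Sum>m\<in>UNIV. pd m ?\<delta>' (\<tau> x) * ?J $ m $ i)) = (\<Sum>m\<in>UNIV. pd m ?\<delta>' (\<tau> x) * (\<Sum>i\<in>UNIV. ?J $ m $ i * X x $ i))"
    by (simp add: sum_distrib_left mult_ac) (rule sum.swap)
  also have "\<dots> = T"
    by (simp add: T_def related[OF x] matrix_vector_mult_def mult.commute)
  finally have T: "(\<Sum>i\<in>UNIV. X x $ i * (\<Sum>m\<in>UNIV. pd m ?\<delta>' (\<tau> x) * ?J $ m $ i)) = T" .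
  have "(\<Sum>i\<in>UNIV. X x $ i * pd i ?\<delta> x) = 2 * det ?J * ?\<delta>' (\<tau> x) * (\<Sum>i\<in>UNIV. X x $ i * ?dJ i)
      + (det ?J)\<^sup>2 * (\<Sum>i\<in>UNIV. X x $ i * (\<Sum>m\<in>UNIV. pd m ?\<delta>' (\<tau> x) * ?J $ m $ i))"
    unfolding d\<delta> distrib_left sum.distrib sum_distrib_left by (simp add: mult_ac)
  also have "\<dots> = (det ?J)\<^sup>2 * (2 * ?\<delta>' (\<tau> x) * trace (K ** B) + T)"
    unfolding T KB[symmetric] by (simp add: power2_eq_square algebra_simps)
  finally have "(\<Sum>i\<in>UNIV. X x $ i * pd i ?\<delta> x) / ?\<delta> x = 2 * trace (K ** B) + T / ?\<delta>' (\<tau> x)"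
    using J0 \<delta>0 by (simp add: det_pullback[OF x] field_simps)
  then show ?thesis
    using tr by (simp add: M.divergence_eq_log_derivative[OF xV(1)] M'.divergence_eq_log_derivative[OF xV(2)]
        T_def[symmetric] trace_def D_def D'_def jac_mat_def[of X] jac_mat_def[of X'] field_simps)
qed

lemma pd_mat_compose:
  assumes x: "x \<in> U"
  shows "pd_mat i (\<lambda>y. G' (\<tau> y)) x = (\<Sum>m\<in>UNIV. jac_mat \<tau> x $ m $ i *\<^sub>R pd_mat m G' (\<tau> x))"
  by (simp add: vec_eq_iff pd_mat_def jac_mat_def mult.commute
      pd_compose[OF diff_\<tau>[OF x] M'.G_diff[OF \<tau>_maps[OF x]]])

text \<open>Differentiating \<open>G = J\<^sup>T G' J\<close> along \<open>X\<close> produces derivatives of \<open>J\<close> on both sides of \<open>G'\<close>; by \<open>jac_related\<close> they combine with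
  the terms that contain the Jacobian matrix of \<open>X\<close> into those for \<open>X'\<close>.\<close>

theorem lie_metric_pullback:
  assumes x: "x \<in> U" and X: "\<And>i. (\<lambda>y. X y $ i) differentiable (at x)"
    and X': "\<And>i. (\<lambda>y. X' y $ i) differentiable (at (\<tau> x))"
    and related: "\<And>y. y \<in> U \<Longrightarrow> X' (\<tau> y) = jac_mat \<tau> y *v X y"
  shows "lie_metric G X x = transpose (jac_mat \<tau> x) ** lie_metric G' X' (\<tau> x) ** jac_mat \<tau> x"
proof -
  have xV: "x \<in> V" "\<tau> x \<in> V'" using x U_V \<tau>_maps by auto
  define J where "J = jac_mat \<tau> x"
  define D where "D = jac_mat X x"
  define D' where "D' = jac_mat X' (\<tau> x)"
  define B where "B = (\<Sum>i\<in>UNIV. X x $ i *\<^sub>R pd_mat i (jac_mat \<tau>) x)"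
  \<comment> \<open>The derivative of \<open>G'\<close> along \<open>X'\<close>.\<close>
  define E where "E = (\<Sum>m\<in>UNIV. X' (\<tau> x) $ m *\<^sub>R pd_mat m G' (\<tau> x))"
  have DJ: "D' ** J = B + J ** D"
    unfolding D_def D'_def B_def J_def by (rule jac_related[OF x X X' related])
  have Gx: "G x = transpose J ** G' (\<tau> x) ** J" unfolding J_def by (rule pullback[OF x])
  have dJ: "(\<lambda>y. jac_mat \<tau> y $ a $ b) differentiable (at x)" for a b by (rule diff_jac[OF x])
  have dJt: "(\<lambda>y. transpose (jac_mat \<tau> y) $ a $ b) differentiable (at x)" for a b
    using dJ by (simp add: transpose_def)
  have dG': "(\<lambda>y. G' (\<tau> y) $ a $ b) differentiable (at x)" for a b
    by (rule differentiable_compose[OF M'.G_diff[OF xV(2)] diff_\<tau>[OF x]])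
  have dp: "(\<lambda>y. (transpose (jac_mat \<tau> y) ** G' (\<tau> y)) $ a $ b) differentiable (at x)" for a b
    unfolding matrix_matrix_mult_def using dJt dG' by (simp add: differentiable_mult)
  have pd_G: "pd_mat i G x = transpose (pd_mat i (jac_mat \<tau>) x) ** G' (\<tau> x) ** J
      + transpose J ** pd_mat i (\<lambda>y. G' (\<tau> y)) x ** J + transpose J ** G' (\<tau> x) ** pd_mat i (jac_mat \<tau>) x" for i
  proof -
    have "pd_mat i G x = pd_mat i (\<lambda>y. transpose (jac_mat \<tau> y) ** G' (\<tau> y) ** jac_mat \<tau> y) x"
    proof -
      have "pd i (\<lambda>y. G y $ a $ b) x = pd i (\<lambda>y. (transpose (jac_mat \<tau> y) ** G' (\<tau> y) ** jac_mat \<tau> y) $ a $ b) x" for a b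
        by (rule pd_cong[OF open_U x M.G_diff[OF xV(1)]]) (simp add: pullback)
      then show ?thesis by (simp add: pd_mat_def)
    qed
    also have "\<dots> = pd_mat i (\<lambda>y. transpose (jac_mat \<tau> y) ** G' (\<tau> y)) x ** J
        + transpose J ** G' (\<tau> x) ** pd_mat i (jac_mat \<tau>) x"
      unfolding J_def by (rule pd_mat_mult[OF dp dJ])
    also have "pd_mat i (\<lambda>y. transpose (jac_mat \<tau> y) ** G' (\<tau> y)) x
        = pd_mat i (\<lambda>y. transpose (jac_mat \<tau> y)) x ** G' (\<tau> x) + transpose J ** pd_mat i (\<lambda>y. G' (\<tau> y)) x"
      unfolding J_def by (rule pd_mat_mult[OF dJt dG'])
    also have "pd_mat i (\<lambda>y. transpose (jac_mat \<tau> y)) x = transpose (pd_mat i (jac_mat \<tau>) x)"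
      by (simp add: pd_mat_def transpose_def)
    finally show ?thesis by (simp only: matrix_mul_add_left)
  qed
  have EJ: "(\<Sum>i\<in>UNIV. X x $ i *\<^sub>R pd_mat i (\<lambda>y. G' (\<tau> y)) x) = E"
  proof -
    have "(\<Sum>i\<in>UNIV. X x $ i *\<^sub>R pd_mat i (\<lambda>y. G' (\<tau> y)) x)
       = (\<Sum>m\<in>UNIV. (\<Sum>i\<in>UNIV. J $ m $ i * X x $ i) *\<^sub>R pd_mat m G' (\<tau> x))"
      by (simp add: pd_mat_compose[OF x] J_def scaleR_sum_right scaleR_sum_left mult.commute) (rule sum.swap)
    then show ?thesis by (simp add: E_def related[OF x] J_def matrix_vector_mult_def)
  qed
  have lin: "(\<Sum>i\<in>UNIV. X x $ i *\<^sub>R (P ** F i ** Q)) = P ** (\<Sum>i\<in>UNIV. X x $ i *\<^sub>R F i) ** Q" for P Q :: "real^'n^'n" and F :: "'n \<Rightarrow> real^'n^'n"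
  proof -
    have e: "P ** (\<Sum>i\<in>UNIV. X x $ i *\<^sub>R F i) = (\<Sum>i\<in>UNIV. X x $ i *\<^sub>R (P ** F i))"
      unfolding matrix_mul_sum_right matrix_mul_scaleR_right ..
    show ?thesis by (simp add: e matrix_mul_sum_left matrix_mul_scaleR_left)
  qed
  have lin1: "(\<Sum>i\<in>UNIV. X x $ i *\<^sub>R (F i ** R ** Q)) = (\<Sum>i\<in>UNIV. X x $ i *\<^sub>R F i) ** R ** Q" for R Q :: "real^'n^'n" and F :: "'n \<Rightarrow> real^'n^'n"
    using lin[of "mat 1" F "R ** Q"] by (simp add: matrix_mul_assoc)
  have lin2: "(\<Sum>i\<in>UNIV. X x $ i *\<^sub>R (P ** R ** F i)) = P ** R ** (\<Sum>i\<in>UNIV. X x $ i *\<^sub>R F i)" for P R :: "real^'n^'n" and F :: "'n \<Rightarrow> real^'n^'n"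
    using lin[of "P ** R" F "mat 1"] by simp
  have Bt: "(\<Sum>i\<in>UNIV. X x $ i *\<^sub>R transpose (pd_mat i (jac_mat \<tau>) x)) = transpose B"
    by (simp add: B_def vec_eq_iff transpose_def)
  have "(\<Sum>i\<in>UNIV. X x $ i *\<^sub>R pd_mat i G x)
     = transpose B ** G' (\<tau> x) ** J + transpose J ** E ** J + transpose J ** G' (\<tau> x) ** B"
    unfolding pd_G scaleR_add_right sum.distrib lin1 lin2 lin EJ Bt B_def[symmetric] ..
  then have "lie_metric G X x = transpose B ** G' (\<tau> x) ** J + transpose J ** E ** J + transpose J ** G' (\<tau> x) ** B
      + transpose D ** (transpose J ** G' (\<tau> x) ** J) + (transpose J ** G' (\<tau> x) ** J) ** D"
    unfolding M.lie_metric_eq_matrix[OF xV(1)] Gx[symmetric] D_def by simp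
  also have "\<dots> = transpose (B + J ** D) ** G' (\<tau> x) ** J + transpose J ** E ** J + transpose J ** G' (\<tau> x) ** (B + J ** D)"
  proof -
    have "transpose (B + J ** D) = transpose B + transpose D ** transpose J"
      by (simp add: vec_eq_iff transpose_def matrix_matrix_mult_def mult.commute)
    then show ?thesis by (simp add: matrix_mul_add_left matrix_add_ldistrib matrix_mul_assoc)
  qed
  also have "\<dots> = transpose J ** (E + transpose D' ** G' (\<tau> x) + G' (\<tau> x) ** D') ** J"
    unfolding DJ[symmetric] by (simp add: matrix_transpose_mul matrix_mul_add_left matrix_add_ldistrib matrix_mul_assoc)
  also have "E + transpose D' ** G' (\<tau> x) + G' (\<tau> x) ** D' = lie_metric G' X' (\<tau> x)"
    unfolding M'.lie_metric_eq_matrix[OF xV(2)] E_def D'_def ..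
  finally show ?thesis unfolding J_def .
qed

end

section \<open>The Riemannian measure\<close>

locale riemannian_manifold =
  fixes A :: "('a::t2_space, 'n::finite) chart set" and g :: "('a, 'n) chart \<Rightarrow> real^'n \<Rightarrow> real^'n^'n"
  assumes atlas: "smooth_atlas A" and metric: "riemannian_metric A g"
begin

lemma chart_cover: "\<exists>c\<in>A. p \<in> fst c"
  using atlas unfolding smooth_atlas_def by (metis UNIV_I UN_E)

lemma open_chart_dom: "c \<in> A \<Longrightarrow> open (fst c)"
  using atlas unfolding smooth_atlas_def by (elim conjE) (drule (1) bspec, elim conjE)

lemma open_chart_img: "c \<in> A \<Longrightarrow> open (chart_img c)"
  using atlas unfolding smooth_atlas_def by (elim conjE) (drule (1) bspec, elim conjE)

lemma chart_homeomorphism: "c \<in> A \<Longrightarrow> homeomorphism (fst c) (chart_img c) (snd c) (chart_inv c)"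
  using atlas unfolding smooth_atlas_def by (elim conjE) (drule (1) bspec, elim conjE)

lemma chart_inv_chart: "c \<in> A \<Longrightarrow> p \<in> fst c \<Longrightarrow> chart_inv c (snd c p) = p"
  using homeomorphism_apply1[OF chart_homeomorphism] by blast

lemma chart_chart_inv: "c \<in> A \<Longrightarrow> x \<in> chart_img c \<Longrightarrow> snd c (chart_inv c x) = x"
  by (rule f_inv_into_f)

lemma chart_inv_dom: "c \<in> A \<Longrightarrow> x \<in> chart_img c \<Longrightarrow> chart_inv c x \<in> fst c"
  by (rule inv_into_into)

lemma continuous_chart: "c \<in> A \<Longrightarrow> continuous_on (fst c) (snd c)"
  using chart_homeomorphism by (rule homeomorphism_cont1)

lemma continuous_chart_inv: "c \<in> A \<Longrightarrow> continuous_on (chart_img c) (chart_inv c)"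
  using chart_homeomorphism by (rule homeomorphism_cont2)

lemma chart_image_eq:
  assumes "c \<in> A" "B \<subseteq> fst c"
  shows "snd c ` B = {x \<in> chart_img c. chart_inv c x \<in> B}"
proof (intro equalityI subsetI)
  fix x assume "x \<in> snd c ` B"
  then obtain p where p: "p \<in> B" "x = snd c p" by auto
  then have "p \<in> fst c" using assms(2) by auto
  then show "x \<in> {x \<in> chart_img c. chart_inv c x \<in> B}" using p chart_inv_chart[OF assms(1)] by auto
next
  fix x assume x: "x \<in> {x \<in> chart_img c. chart_inv c x \<in> B}"
  then have "snd c (chart_inv c x) = x" using chart_chart_inv[OF assms(1)] by simp
  then show "x \<in> snd c ` B" using x by (metis (mono_tags, lifting) image_eqI mem_Collect_eq)
qed

lemma open_chart_preimage:
  assumes "c \<in> A" "open S" shows "open {x \<in> chart_img c. chart_inv c x \<in> S}"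
proof -
  have "{x \<in> chart_img c. chart_inv c x \<in> S} = chart_img c \<inter> chart_inv c -` S" by auto
  moreover have "open (chart_img c \<inter> chart_inv c -` S)"
    by (rule continuous_open_preimage[OF continuous_chart_inv open_chart_img]) fact+
  ultimately show ?thesis by simp
qed

lemma open_dom_preimage:
  assumes "c \<in> A" "open S" shows "open {p \<in> fst c. snd c p \<in> S}"
proof -
  have "{p \<in> fst c. snd c p \<in> S} = fst c \<inter> snd c -` S" by auto
  moreover have "open (fst c \<inter> snd c -` S)"
    by (rule continuous_open_preimage[OF continuous_chart open_chart_dom]) fact+
  ultimately show ?thesis by simp
qed

lemma chart_contains_cball:
  assumes c: "c \<in> A" and p: "p \<in> fst c"
  obtains r where "0 < r" "cball (snd c p) r \<subseteq> chart_img c"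
  using open_chart_img[OF c] p by (meson imageI open_contains_cball)

lemma metric_chart_at: "c \<in> A \<Longrightarrow> metric_chart (g c) (chart_img c)"
proof (rule metric_chart.intro)
  assume c: "c \<in> A"
  note m = metric[unfolded riemannian_metric_def smooth_sym_tensor_def]
  show "open (chart_img c)" by (rule open_chart_img[OF c])
  show "smooth_on (chart_img c) (g c)" using m c by blast
  show "g c x $ i $ j = g c x $ j $ i" if "x \<in> chart_img c" for x i j using m c that by blast
  show "0 < v \<bullet> (g c x *v v)" if "x \<in> chart_img c" "v \<noteq> 0" for x v using m c that by blast
qed

definition overlap :: "('a, 'n) chart \<Rightarrow> ('a, 'n) chart \<Rightarrow> (real^'n) set" where
  "overlap c d = snd c ` (fst c \<inter> fst d)"

definition transition :: "('a, 'n) chart \<Rightarrow> ('a, 'n) chart \<Rightarrow> real^'n \<Rightarrow> real^'n" where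
  "transition c d = snd d \<circ> chart_inv c"

lemma overlap_eq: "c \<in> A \<Longrightarrow> overlap c d = {x \<in> chart_img c. chart_inv c x \<in> fst c \<inter> fst d}"
  unfolding overlap_def by (rule chart_image_eq) auto

lemma overlap_iff: "c \<in> A \<Longrightarrow> x \<in> overlap c d \<longleftrightarrow> x \<in> chart_img c \<and> chart_inv c x \<in> fst d"
  using chart_inv_dom by (auto simp: overlap_eq)

lemma open_overlap: "c \<in> A \<Longrightarrow> d \<in> A \<Longrightarrow> open (overlap c d)"
  unfolding overlap_eq by (rule open_chart_preimage) (auto intro: open_chart_dom)

lemma overlap_subset: "overlap c d \<subseteq> chart_img c"
  by (auto simp: overlap_def)

lemma smooth_transition: "c \<in> A \<Longrightarrow> d \<in> A \<Longrightarrow> smooth_on (overlap c d) (transition c d)"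
  using atlas unfolding smooth_atlas_def overlap_def transition_def by blast

lemma transition_chart: "c \<in> A \<Longrightarrow> p \<in> fst c \<Longrightarrow> transition c d (snd c p) = snd d p"
  by (simp add: transition_def chart_inv_chart)

lemma transition_maps: "c \<in> A \<Longrightarrow> x \<in> overlap c d \<Longrightarrow> transition c d x \<in> chart_img d"
  by (simp add: overlap_iff transition_def)

lemma jacobian_eq_jac_mat:
  assumes c: "c \<in> A" "d \<in> A" and p: "p \<in> fst c \<inter> fst d"
  shows "jacobian c d p v = jac_mat (transition c d) (snd c p) *v v" "linear (jacobian c d p)"
proof -
  have x: "snd c p \<in> overlap c d" using p by (auto simp: overlap_def)
  have diff: "transition c d differentiable (at (snd c p))" by (rule smooth_on_D[OF smooth_transition[OF c] x])
  have J: "jacobian c d p = frechet_derivative (transition c d) (at (snd c p))"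
    by (simp add: jacobian_def transition_def)
  show lin: "linear (jacobian c d p)" unfolding J by (rule linear_frechet_derivative[OF diff])
  show "jacobian c d p v = jac_mat (transition c d) (snd c p) *v v"
    unfolding matrix_frechet_derivative[OF diff, symmetric] J[symmetric]
    by (rule fun_cong[OF matrix_vector_mul(2)[OF lin, symmetric]])
qed

lemma sym_tensor_pullback:
  assumes T: "\<And>v w. v \<bullet> (T c (snd c p) *v w) = jacobian c d p v \<bullet> (T d (snd d p) *v jacobian c d p w)"
    and c: "c \<in> A" "d \<in> A" and p: "p \<in> fst c \<inter> fst d"
  shows "T c (snd c p) = transpose (jac_mat (transition c d) (snd c p)) ** T d (snd d p) ** jac_mat (transition c d) (snd c p)"
proof -
  have diff: "transition c d differentiable (at (snd c p))"
    by (rule smooth_on_D[OF smooth_transition[OF c]]) (use p in \<open>auto simp: overlap_def\<close>)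
  have "matrix (jacobian c d p) = jac_mat (transition c d) (snd c p)"
    using matrix_frechet_derivative[OF diff] by (simp add: jacobian_def transition_def)
  then show ?thesis using bilinear_pullback_matrix[OF jacobian_eq_jac_mat(2)[OF c p] T] by simp
qed

lemma chart_change_at:
  assumes c: "c \<in> A" and d: "d \<in> A"
  shows "chart_change (g c) (chart_img c) (g d) (chart_img d) (transition c d) (overlap c d)"
proof (intro chart_change.intro chart_change_axioms.intro metric_chart_at c d open_overlap overlap_subset smooth_transition)
  fix x assume x: "x \<in> overlap c d"
  show "transition c d x \<in> chart_img d" by (rule transition_maps[OF c x])
  obtain p where p: "p \<in> fst c \<inter> fst d" "x = snd c p" using x by (auto simp: overlap_def)
  have "g c (snd c p) = transpose (jac_mat (transition c d) (snd c p)) ** g d (snd d p) ** jac_mat (transition c d) (snd c p)"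
  proof (rule sym_tensor_pullback[where T = g, OF _ c d p(1)])
    show "v \<bullet> (g c (snd c p) *v w) = jacobian c d p v \<bullet> (g d (snd d p) *v jacobian c d p w)" for v w
      using metric c d p(1) unfolding riemannian_metric_def smooth_sym_tensor_def by blast
  qed
  then show "g c x = transpose (jac_mat (transition c d) x) ** g d (transition c d x) ** jac_mat (transition c d) x"
    using p transition_chart[OF c] by simp
qed

lemma glue_eq:
  assumes inv: "\<And>d e. d \<in> A \<Longrightarrow> e \<in> A \<Longrightarrow> p \<in> fst d \<inter> fst e \<Longrightarrow> h d (snd d p) = h e (snd e p)"
    and c: "c \<in> A" "p \<in> fst c"
  shows "glue A h p = h c (snd c p)"
proof -
  define e where "e = (SOME c. c \<in> A \<and> p \<in> fst c)"
  have "e \<in> A \<and> p \<in> fst e" unfolding e_def by (rule someI[of _ c]) (use c in simp)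
  then show ?thesis using inv[of e c] c by (simp add: glue_def e_def[symmetric] Let_def)
qed

lemma continuous_from_charts:
  fixes f :: "'a \<Rightarrow> real"
  assumes "\<And>c. c \<in> A \<Longrightarrow> continuous_on (chart_img c) (f \<circ> chart_inv c)"
  shows "continuous_on UNIV f"
proof -
  have "continuous_on (fst c) f" if c: "c \<in> A" for c
  proof -
    have "continuous_on (fst c) ((f \<circ> chart_inv c) \<circ> snd c)"
      by (rule continuous_on_compose[OF continuous_chart[OF c] assms[OF c]])
    then show ?thesis by (rule continuous_on_eq) (simp add: chart_inv_chart c)
  qed
  then have "continuous_on (\<Union>c\<in>A. fst c) f"
    by (intro continuous_on_open_UN open_chart_dom)
  moreover have "(\<Union>c\<in>A. fst c) = UNIV" using chart_cover by blast
  ultimately show ?thesis by simp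
qed

text \<open>The Riemannian measure in coordinates, extended by zero outside the image of the chart.\<close>

definition chart_measure :: "('a, 'n) chart \<Rightarrow> (real^'n) measure" where
  "chart_measure c = density lborel (\<lambda>x. ennreal (sqrt (det (g c x))) * indicator (chart_img c) x)"

lemma sets_chart_measure [simp]: "sets (chart_measure c) = sets borel" "space (chart_measure c) = UNIV"
  by (simp_all add: chart_measure_def)

lemma measurable_density: 
  assumes c: "c \<in> A"
  shows "(\<lambda>x. indicator (chart_img c) x *\<^sub>R sqrt (det (g c x))) \<in> borel_measurable borel"
proof (rule borel_measurable_continuous_on_indicator)
  interpret metric_chart "g c" "chart_img c" by (rule metric_chart_at[OF c])
  show "continuous_on (chart_img c) (\<lambda>x. sqrt (det (g c x)))" using C_diff_volume_density[of 0] by simp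
qed (simp add: open_chart_img[OF c])

lemma measurable_density_ennreal [measurable]:
  assumes c: "c \<in> A"
  shows "(\<lambda>x. ennreal (sqrt (det (g c x))) * indicator (chart_img c) x) \<in> borel_measurable borel"
proof -
  have "(\<lambda>x. ennreal (indicator (chart_img c) x *\<^sub>R sqrt (det (g c x)))) \<in> borel_measurable borel"
    using measurable_density[OF c] by simp
  moreover have "(\<lambda>x. ennreal (indicator (chart_img c) x *\<^sub>R sqrt (det (g c x)))) = (\<lambda>x. ennreal (sqrt (det (g c x))) * indicator (chart_img c) x)"
    by (auto simp: indicator_def)
  ultimately show ?thesis by simp
qed

lemma emeasure_chart_measure:
  assumes c: "c \<in> A" and E: "E \<in> sets borel" "E \<subseteq> chart_img c"
  shows "emeasure (chart_measure c) E = (\<integral>\<^sup>+x\<in>E. ennreal (sqrt (det (g c x))) \<partial>lborel)"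
proof -
  have "emeasure (chart_measure c) E = (\<integral>\<^sup>+x. ennreal (sqrt (det (g c x))) * indicator (chart_img c) x * indicator E x \<partial>lborel)"
    unfolding chart_measure_def by (rule emeasure_density) (use c E in auto)
  also have "\<dots> = (\<integral>\<^sup>+x\<in>E. ennreal (sqrt (det (g c x))) \<partial>lborel)"
    using E(2) by (intro nn_integral_cong) (auto simp: indicator_def)
  finally show ?thesis .
qed

lemma borel_chart_image:
  assumes c: "c \<in> A" and B: "B \<in> sets borel" "B \<subseteq> fst c"
  shows "snd c ` B \<in> sets borel"
proof -
  have "chart_inv c \<in> borel_measurable (restrict_space borel (chart_img c))"
    by (rule borel_measurable_continuous_on_restrict[OF continuous_chart_inv[OF c]])
  then have "chart_inv c -` B \<inter> space (restrict_space borel (chart_img c)) \<in> sets (restrict_space borel (chart_img c))"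
    using B(1) by (rule measurable_sets)
  then have "chart_img c \<inter> chart_inv c -` B \<in> sets borel"
    using open_chart_img[OF c] by (simp add: space_restrict_space sets_restrict_space_iff Int_commute)
  moreover have "snd c ` B = chart_img c \<inter> chart_inv c -` B"
    using chart_image_eq[OF c B(2)] by auto
  ultimately show ?thesis by simp
qed

text \<open>The change of variables formula: the density picks up exactly the factor \<open>|det J|\<close> under a transition map.\<close>

lemma chart_measure_consistent:
  assumes c: "c \<in> A" and d: "d \<in> A" and B: "B \<in> sets borel" "B \<subseteq> fst c \<inter> fst d"
  shows "emeasure (chart_measure c) (snd c ` B) = emeasure (chart_measure d) (snd d ` B)"
proof -
  interpret C: chart_change "g c" "chart_img c" "g d" "chart_img d" "transition c d" "overlap c d"
    by (rule chart_change_at[OF c d])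
  let ?\<tau> = "transition c d" and ?S = "snd c ` B"
  have Bc: "B \<subseteq> fst c" and Bd: "B \<subseteq> fst d" using B(2) by auto
  have S: "?S \<in> sets borel" by (rule borel_chart_image[OF c B(1) Bc])
  have S_sub: "?S \<subseteq> overlap c d" using B(2) by (auto simp: overlap_def)
  have img: "?\<tau> ` ?S = snd d ` B"
    unfolding image_image by (rule image_cong[OF refl]) (rule transition_chart[OF c], use Bc in auto)
  have dB: "snd d ` B \<in> sets borel" by (rule borel_chart_image[OF d B(1) Bd])
  have inj: "inj_on ?\<tau> ?S"
  proof (rule inj_onI)
    fix x y assume "x \<in> ?S" "y \<in> ?S" and eq: "?\<tau> x = ?\<tau> y"
    then obtain p q where p: "p \<in> B" "x = snd c p" and q: "q \<in> B" "y = snd c q" by auto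
    have pq: "p \<in> fst c" "q \<in> fst c" "p \<in> fst d" "q \<in> fst d" using p q Bc Bd by auto
    have "snd d p = snd d q" using eq unfolding p(2) q(2) transition_chart[OF c pq(1)] transition_chart[OF c pq(2)] .
    then have "p = q" by (metis chart_inv_chart[OF d pq(3)] chart_inv_chart[OF d pq(4)])
    then show "x = y" using p q by simp
  qed
  have der: "(?\<tau> has_derivative frechet_derivative ?\<tau> (at x)) (at x within ?S)" if "x \<in> ?S" for x
    by (rule has_derivative_at_withinI[OF frechet_derivative_worksI[OF C.diff_\<tau>]]) (use S_sub that in auto)
  have dens: "sqrt (det (g c x)) = \<bar>det (matrix (frechet_derivative ?\<tau> (at x)))\<bar> * sqrt (det (g d (?\<tau> x)))" if "x \<in> ?S" for x
  proof -
    have x: "x \<in> overlap c d" using that S_sub by auto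
    show ?thesis unfolding matrix_frechet_derivative[OF C.diff_\<tau>[OF x]] by (rule C.volume_density_pullback[OF x])
  qed
  have "emeasure (chart_measure d) (snd d ` B) = (\<integral>\<^sup>+x\<in>?\<tau> ` ?S. ennreal (sqrt (det (g d x))) \<partial>lborel)"
    unfolding img by (rule emeasure_chart_measure[OF d dB]) (use B in auto)
  also have "\<dots> = (\<integral>\<^sup>+x\<in>?S. ennreal (\<bar>det (matrix (frechet_derivative ?\<tau> (at x)))\<bar> * sqrt (det (g d (?\<tau> x)))) \<partial>lborel)"
  proof (rule nn_integral_change_of_variables[OF S _ der inj])
    show "?\<tau> ` ?S \<in> sets borel" unfolding img by (rule dB)
    show "0 \<le> sqrt (det (g d y))" if "y \<in> ?\<tau> ` ?S" for y
      using that B(2) C.M'.det_G_pos[of y] unfolding img by (auto intro!: less_imp_le)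
    have ind: "set_borel_measurable borel E (\<lambda>x. sqrt (det (g e x)))" if "e \<in> A" "E \<in> sets borel" "E \<subseteq> chart_img e" for e E
    proof -
      have 1: "(\<lambda>x. indicator E x *\<^sub>R (indicator (chart_img e) x *\<^sub>R sqrt (det (g e x)))) \<in> borel_measurable borel"
        by (rule borel_measurable_scaleR[OF borel_measurable_indicator[OF that(2)] measurable_density[OF that(1)]])
      have 2: "(\<lambda>x. indicator E x *\<^sub>R (indicator (chart_img e) x *\<^sub>R sqrt (det (g e x)))) = (\<lambda>x. indicator E x *\<^sub>R sqrt (det (g e x)))"
        using that(3) by (auto simp: indicator_def fun_eq_iff)
      show ?thesis unfolding set_borel_measurable_def 2[symmetric] by (rule 1)
    qed
    show "set_borel_measurable borel (?\<tau> ` ?S) (\<lambda>x. sqrt (det (g d x)))"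
      unfolding img by (rule ind[OF d dB]) (use B in auto)
    have "set_borel_measurable borel ?S (\<lambda>x. sqrt (det (g c x)))"
      by (rule ind[OF c S]) (use B in auto)
    then show "set_borel_measurable borel ?S (\<lambda>x. \<bar>det (matrix (frechet_derivative ?\<tau> (at x)))\<bar> * sqrt (det (g d (?\<tau> x))))"
      unfolding set_borel_measurable_def
      by (rule measurable_cong[THEN iffD1, rotated]) (simp add: indicator_def dens)
  qed
  also have "\<dots> = (\<integral>\<^sup>+x\<in>?S. ennreal (sqrt (det (g c x))) \<partial>lborel)"
    by (intro nn_integral_cong) (simp add: indicator_def dens)
  also have "\<dots> = emeasure (chart_measure c) ?S"
    by (rule emeasure_chart_measure[OF c S, symmetric]) (use B in auto)
  finally show ?thesis by simp
qed

lemma is_riemannian_measure_iff: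
  "is_riemannian_measure A g \<mu> \<longleftrightarrow> sets \<mu> = sets borel \<and>
     (\<forall>c\<in>A. \<forall>B\<in>sets borel. B \<subseteq> fst c \<longrightarrow> emeasure \<mu> B = emeasure (chart_measure c) (snd c ` B))"
proof -
  have eq: "(\<integral>\<^sup>+x\<in>snd c ` B. ennreal (sqrt (det (g c x))) \<partial>lborel) = emeasure (chart_measure c) (snd c ` B)"
    if "c \<in> A" "B \<in> sets borel" "B \<subseteq> fst c" for c B
    by (rule emeasure_chart_measure[OF that(1) borel_chart_image[OF that], symmetric]) (use that(3) in auto)
  show ?thesis
    unfolding is_riemannian_measure_def by (intro conj_cong refl ball_cong imp_cong) (simp add: eq)
qed

end

locale compact_riemannian_manifold = riemannian_manifold A g
  for A :: "('a::t2_space, 'n::finite) chart set" and g +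
  assumes compact: "compact (UNIV :: 'a set)"
begin

text \<open>Finitely many chart domains cover the compact manifold; subtracting from each one its predecessors makes them disjoint.\<close>

lemma finite_chart_decomposition:
  "\<exists>(m :: nat) c D. (\<forall>i<m. c i \<in> A \<and> D i \<in> sets borel \<and> D i \<subseteq> fst (c i))
     \<and> disjoint_family_on D {..<m} \<and> (\<Union>i<m. D i) = UNIV"
proof -
  have "UNIV \<subseteq> (\<Union>c\<in>A. fst c)" using chart_cover by blast
  then obtain C where C: "C \<subseteq> A" "finite C" "UNIV \<subseteq> (\<Union>c\<in>C. fst c)"
    by (rule compactE_image[OF compact open_chart_dom, rotated])
  obtain cs where cs: "set cs = C" using finite_list[OF C(2)] by blast
  define F where "F i = (if i < length cs then fst (cs ! i) else {})" for i
  have c: "cs ! i \<in> A" if "i < length cs" for i using that cs C(1) by auto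
  have F: "open (F i)" for i using open_chart_dom[OF c] by (simp add: F_def)
  show ?thesis
  proof (intro exI[of _ "length cs"] exI[of _ "\<lambda>i. cs ! i"] exI[of _ "disjointed F"] conjI allI impI)
    show "cs ! i \<in> A" if "i < length cs" for i by (rule c[OF that])
    show "disjointed F i \<in> sets borel" for i
      unfolding disjointed_def using F by (auto intro!: sets.Diff sets.finite_UN)
    show "disjointed F i \<subseteq> fst (cs ! i)" if "i < length cs" for i
      using disjointed_subset[of F i] that by (simp add: F_def)
    show "disjoint_family_on (disjointed F) {..<length cs}"
      using disjoint_family_disjointed by (rule disjoint_family_on_mono[OF subset_UNIV])
    show "(\<Union>i<length cs. disjointed F i) = UNIV"
    proof -
      have "p \<in> (\<Union>i<length cs. disjointed F i)" for p
      proof -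
        have "p \<in> (\<Union>i. F i)"
        proof -
          obtain d where "d \<in> C" "p \<in> fst d" using C(3) by blast
          then obtain i where "i < length cs" "cs ! i = d" using cs by (auto simp: in_set_conv_nth)
          then show ?thesis using \<open>p \<in> fst d\<close> by (auto simp: F_def intro!: exI[of _ i])
        qed
        then have "p \<in> (\<Union>i. disjointed F i)" by (simp only: UN_disjointed_eq)
        then obtain i where i: "p \<in> disjointed F i" by blast
        have "p \<in> F i" by (rule subsetD[OF disjointed_subset i])
        then have "i < length cs" by (simp add: F_def split: if_splits)
        then show ?thesis using i by blast
      qed
      then show ?thesis by blast
    qed
  qed
qed

text \<open>Along a disjoint decomposition into Borel subsets \<open>D i\<close> of chart domains, the measure can only be the sum of the chart measures of the pieces; this proves
  uniqueness. The sum is countably additive, and on the domain of any further chart it has the required density because the chart measures are consistent.\<close>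

theorem vol_is_riemannian_measure: "is_riemannian_measure A g (vol A g)"
proof -
  obtain m :: nat and c D where c: "\<And>i. i < m \<Longrightarrow> c i \<in> A" and D: "\<And>i. i < m \<Longrightarrow> D i \<in> sets borel" "\<And>i. i < m \<Longrightarrow> D i \<subseteq> fst (c i)"
    and disj: "disjoint_family_on D {..<m}" and UN: "(\<Union>i<m. D i) = UNIV"
    using finite_chart_decomposition by metis
  define F where "F B = (\<Sum>i<m. emeasure (chart_measure (c i)) (snd (c i) ` (B \<inter> D i)))" for B
  define \<mu> where "\<mu> = measure_of (space borel) (sets borel) F"
  have sets_\<mu>: "sets \<mu> = sets borel" unfolding \<mu>_def by (rule sets.sets_measure_of_eq)
  have img: "snd (c i) ` (B \<inter> D i) \<in> sets borel" if "i < m" "B \<in> sets borel" for i B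
    by (rule borel_chart_image[OF c[OF that(1)]]) (use D[OF that(1)] that(2) in auto)
  have inj: "inj_on (snd d) (fst d)" if "d \<in> A" for d
    by (rule inj_on_inverseI[where g = "chart_inv d"]) (rule chart_inv_chart[OF that])
  have "countably_additive (sets \<mu>) F"
  proof (rule countably_additiveI)
    fix B :: "nat \<Rightarrow> 'a set" assume B: "range B \<subseteq> sets \<mu>" "disjoint_family B"
    have Bn: "B n \<in> sets borel" for n using B(1) sets_\<mu> by blast
    have "(\<Sum>n. emeasure (chart_measure (c i)) (snd (c i) ` (B n \<inter> D i))) = emeasure (chart_measure (c i)) (snd (c i) ` ((\<Union>n. B n) \<inter> D i))"
      if i: "i < m" for i
    proof -
      have "disjoint_family (\<lambda>n. snd (c i) ` (B n \<inter> D i))"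
      proof (unfold disjoint_family_on_def, intro ballI impI)
        fix n k :: nat assume "n \<noteq> k"
        then have "(B n \<inter> D i) \<inter> (B k \<inter> D i) = {}" using B(2) by (auto simp: disjoint_family_on_def)
        then show "snd (c i) ` (B n \<inter> D i) \<inter> snd (c i) ` (B k \<inter> D i) = {}"
          using inj_on_image_Int[OF inj[OF c[OF i]], of "B n \<inter> D i" "B k \<inter> D i"] D(2)[OF i] by (simp add: le_infI2)
      qed
      moreover have "range (\<lambda>n. snd (c i) ` (B n \<inter> D i)) \<subseteq> sets (chart_measure (c i))"
        using img[OF i Bn] by auto
      ultimately have "(\<Sum>n. emeasure (chart_measure (c i)) (snd (c i) ` (B n \<inter> D i))) = emeasure (chart_measure (c i)) (\<Union>n. snd (c i) ` (B n \<inter> D i))"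
        by (intro suminf_emeasure)
      then show ?thesis by (simp add: image_UN[symmetric] Int_UN_distrib2)
    qed
    then show "(\<Sum>n. F (B n)) = F (\<Union>n. B n)"
      unfolding F_def by (subst suminf_sum) auto
  qed
  moreover have "positive (sets \<mu>) F" by (simp add: positive_def F_def)
  ultimately have em: "emeasure \<mu> B = F B" if "B \<in> sets borel" for B
    using that sets_\<mu> by (intro emeasure_measure_of[OF \<mu>_def]) (auto intro: sets.space_closed)
  have \<mu>: "is_riemannian_measure A g \<mu>"
    unfolding is_riemannian_measure_iff
  proof (intro conjI ballI impI sets_\<mu>)
    fix d B assume d: "d \<in> A" and B: "B \<in> sets borel" "B \<subseteq> fst d"
    have imgd: "snd d ` (B \<inter> D i) \<in> sets borel" if "i < m" for i
      by (rule borel_chart_image[OF d]) (use B D[OF that] in auto)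
    have "emeasure (chart_measure (c i)) (snd (c i) ` (B \<inter> D i)) = emeasure (chart_measure d) (snd d ` (B \<inter> D i))" if i: "i < m" for i
      by (rule chart_measure_consistent[OF c[OF i] d]) (use B D[OF i] in auto)
    then have "emeasure \<mu> B = (\<Sum>i<m. emeasure (chart_measure d) (snd d ` (B \<inter> D i)))"
      by (simp add: em[OF B(1)] F_def)
    also have "\<dots> = emeasure (chart_measure d) (\<Union>i<m. snd d ` (B \<inter> D i))"
    proof (rule sum_emeasure)
      show "disjoint_family_on (\<lambda>i. snd d ` (B \<inter> D i)) {..<m}"
      proof (unfold disjoint_family_on_def, intro ballI impI)
        fix n k :: nat assume "n \<in> {..<m}" "k \<in> {..<m}" "n \<noteq> k"
        then have "(B \<inter> D n) \<inter> (B \<inter> D k) = {}" using disj by (auto simp: disjoint_family_on_def)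
        then show "snd d ` (B \<inter> D n) \<inter> snd d ` (B \<inter> D k) = {}"
          using inj_on_image_Int[OF inj[OF d], of "B \<inter> D n" "B \<inter> D k"] B(2) by (simp add: le_infI1)
      qed
    qed (use imgd in auto)
    also have "(\<Union>i<m. snd d ` (B \<inter> D i)) = snd d ` (B \<inter> (\<Union>i<m. D i))" by blast
    finally show "emeasure \<mu> B = emeasure (chart_measure d) (snd d ` B)" by (simp add: UN)
  qed
  have "M = \<mu>" if M: "is_riemannian_measure A g M" for M
  proof (rule measure_eqI)
    have sets_M: "sets M = sets borel" using M by (simp add: is_riemannian_measure_def)
    show "sets M = sets \<mu>" by (simp add: sets_M sets_\<mu>)
    fix B assume "B \<in> sets M"
    then have B: "B \<in> sets borel" by (simp add: sets_M)
    have "emeasure N B = F B" if N: "is_riemannian_measure A g N" for N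
    proof -
      have sN: "sets N = sets borel" using N by (simp add: is_riemannian_measure_def)
      have "emeasure N B = (\<Sum>i<m. emeasure N (B \<inter> D i))"
        by (rule sum_emeasure_cover) (use B D disj UN in \<open>auto simp: sN\<close>)
      also have "\<dots> = F B"
        unfolding F_def
      proof (rule sum.cong[OF refl])
        fix i assume "i \<in> {..<m}"
        then have i: "i < m" by simp
        show "emeasure N (B \<inter> D i) = emeasure (chart_measure (c i)) (snd (c i) ` (B \<inter> D i))"
          using N[unfolded is_riemannian_measure_iff] c[OF i] D[OF i] B by (simp add: le_infI2)
      qed
      finally show ?thesis .
    qed
    from this[OF M] this[OF \<mu>] show "emeasure M B = emeasure \<mu> B" by simp
  qed
  with \<mu> show ?thesis unfolding vol_def by (rule theI)
qed

lemma sets_vol [simp]: "sets (vol A g) = sets borel"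
  using vol_is_riemannian_measure by (simp add: is_riemannian_measure_def)

lemma space_vol [simp]: "space (vol A g) = UNIV"
  using sets_eq_imp_space_eq[OF sets_vol] by simp

lemma emeasure_vol:
  "c \<in> A \<Longrightarrow> B \<in> sets borel \<Longrightarrow> B \<subseteq> fst c \<Longrightarrow> emeasure (vol A g) B = emeasure (chart_measure c) (snd c ` B)"
  using vol_is_riemannian_measure unfolding is_riemannian_measure_iff by blast

lemma emeasure_chart_measure_outside:
  assumes c: "c \<in> A" and E: "E \<in> sets borel"
  shows "emeasure (chart_measure c) E = emeasure (chart_measure c) (E \<inter> chart_img c)"
proof -
  have mS: "chart_img c \<in> sets borel" using open_chart_img[OF c] by simp
  have 1: "emeasure (chart_measure c) K = (\<integral>\<^sup>+x. ennreal (sqrt (det (g c x))) * indicator (chart_img c) x * indicator K x \<partial>lborel)"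
    if "K \<in> sets borel" for K
    unfolding chart_measure_def by (rule emeasure_density) (use c that in auto)
  show ?thesis
    unfolding 1[OF E] 1[OF sets.Int[OF E mS]]
    by (intro nn_integral_cong) (auto simp: indicator_def)
qed

lemma restrict_vol_measurable:
  assumes "c \<in> A" shows "snd c \<in> borel_measurable (restrict_space (vol A g) (fst c))"
  unfolding measurable_cong_sets[OF sets_restrict_space_cong[OF sets_vol] refl]
  by (rule borel_measurable_continuous_on_restrict[OF continuous_chart[OF assms]])

lemma distr_vol_chart:
  assumes c: "c \<in> A"
  shows "distr (restrict_space (vol A g) (fst c)) borel (snd c) = chart_measure c"
proof (rule measure_eqI)
  show "sets (distr (restrict_space (vol A g) (fst c)) borel (snd c)) = sets (chart_measure c)" by simp
  fix E assume "E \<in> sets (distr (restrict_space (vol A g) (fst c)) borel (snd c))"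
  then have E: "E \<in> sets borel" by simp
  have dom: "fst c \<in> sets borel" using open_chart_dom[OF c] by simp
  have m: "snd c \<in> borel_measurable (restrict_space borel (fst c))"
    by (rule borel_measurable_continuous_on_restrict[OF continuous_chart[OF c]])
  have m': "snd c \<in> borel_measurable (restrict_space (vol A g) (fst c))" by (rule restrict_vol_measurable[OF c])
  have B: "snd c -` E \<inter> fst c \<in> sets borel"
    using measurable_sets[OF m E] dom by (simp add: space_restrict_space sets_restrict_space_iff)
  have "emeasure (distr (restrict_space (vol A g) (fst c)) borel (snd c)) E = emeasure (restrict_space (vol A g) (fst c)) (snd c -` E \<inter> fst c)"
    using emeasure_distr[OF m' E] by (simp add: space_restrict_space)
  also have "\<dots> = emeasure (vol A g) (snd c -` E \<inter> fst c)"
    by (rule emeasure_restrict_space) (use dom in auto)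
  also have "\<dots> = emeasure (chart_measure c) (snd c ` (snd c -` E \<inter> fst c))"
    by (rule emeasure_vol[OF c B]) simp
  also have "snd c ` (snd c -` E \<inter> fst c) = E \<inter> chart_img c" by auto
  also have "emeasure (chart_measure c) (E \<inter> chart_img c) = emeasure (chart_measure c) E"
    by (rule emeasure_chart_measure_outside[OF c E, symmetric])
  finally show "emeasure (distr (restrict_space (vol A g) (fst c)) borel (snd c)) E = emeasure (chart_measure c) E" .
qed

lemma integral_vol_chart:
  fixes F :: "'a \<Rightarrow> real"
  assumes c: "c \<in> A" and F: "F \<in> borel_measurable borel" and F0: "\<And>p. p \<notin> fst c \<Longrightarrow> F p = 0"
  shows "(\<integral>p. F p \<partial>vol A g) = (\<integral>x. indicator (chart_img c) x * (sqrt (det (g c x)) * F (chart_inv c x)) \<partial>lborel)"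
proof -
  have dom: "fst c \<in> sets borel" and img: "chart_img c \<in> sets borel"
    using open_chart_dom[OF c] open_chart_img[OF c] by auto
  define k where "k x = indicator (chart_img c) x *\<^sub>R F (chart_inv c x)" for x
  have k: "k \<in> borel_measurable borel"
  proof -
    have "chart_inv c \<in> borel_measurable (restrict_space borel (chart_img c))"
      by (rule borel_measurable_continuous_on_restrict[OF continuous_chart_inv[OF c]])
    then have "(\<lambda>x. F (chart_inv c x)) \<in> borel_measurable (restrict_space borel (chart_img c))"
      by (rule measurable_compose[OF _ F])
    then show ?thesis
      unfolding k_def[abs_def] using img by (subst (asm) borel_measurable_restrict_space_iff) auto
  qed
  have m: "snd c \<in> borel_measurable (restrict_space (vol A g) (fst c))" by (rule restrict_vol_measurable[OF c])
  have "(\<integral>p. F p \<partial>vol A g) = (\<integral>p. indicator (fst c) p *\<^sub>R F p \<partial>vol A g)"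
    using F0 by (intro Bochner_Integration.integral_cong) (auto simp: indicator_def)
  also have "\<dots> = (\<integral>p. F p \<partial>restrict_space (vol A g) (fst c))"
    by (rule integral_restrict_space[symmetric]) (use dom in simp)
  also have "\<dots> = (\<integral>p. k (snd c p) \<partial>restrict_space (vol A g) (fst c))"
    by (intro Bochner_Integration.integral_cong refl) (auto simp: k_def space_restrict_space chart_inv_chart[OF c])
  also have "\<dots> = (\<integral>x. k x \<partial>chart_measure c)"
    unfolding distr_vol_chart[OF c, symmetric] by (rule integral_distr[OF m k, symmetric])
  also have "\<dots> = (\<integral>x. k x \<partial>density lborel (\<lambda>x. ennreal (indicator (chart_img c) x *\<^sub>R sqrt (det (g c x)))))"
  proof -
    have "(\<lambda>x. ennreal (sqrt (det (g c x))) * indicator (chart_img c) x) = (\<lambda>x. ennreal (indicator (chart_img c) x *\<^sub>R sqrt (det (g c x))))"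
      by (auto simp: indicator_def fun_eq_iff)
    then show ?thesis by (simp only: chart_measure_def)
  qed
  also have "\<dots> = (\<integral>x. (indicator (chart_img c) x *\<^sub>R sqrt (det (g c x))) *\<^sub>R k x \<partial>lborel)"
  proof (rule integral_density)
    show "k \<in> borel_measurable lborel" using k by simp
    show "(\<lambda>x. indicator (chart_img c) x *\<^sub>R sqrt (det (g c x))) \<in> borel_measurable lborel"
      using measurable_density[OF c] by simp
    interpret metric_chart "g c" "chart_img c" by (rule metric_chart_at[OF c])
    show "AE x in lborel. 0 \<le> indicator (chart_img c) x *\<^sub>R sqrt (det (g c x))"
      using det_G_pos by (intro AE_I2) (auto simp: indicator_def intro!: less_imp_le)
  qed
  also have "\<dots> = (\<integral>x. indicator (chart_img c) x * (sqrt (det (g c x)) * F (chart_inv c x)) \<partial>lborel)"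
    by (intro Bochner_Integration.integral_cong refl) (auto simp: k_def indicator_def)
  finally show ?thesis .
qed

text \<open>In a closed ball in the image of a chart the density is bounded, so every point has a neighbourhood of finite measure.\<close>

lemma finite_vol: "finite_measure (vol A g)"
proof
  have "\<exists>U. open U \<and> p \<in> U \<and> emeasure (vol A g) U < \<infinity>" for p
  proof -
    obtain c where c: "c \<in> A" "p \<in> fst c" using chart_cover by blast
    interpret metric_chart "g c" "chart_img c" by (rule metric_chart_at[OF c(1)])
    obtain r where r: "0 < r" "cball (snd c p) r \<subseteq> chart_img c" by (rule chart_contains_cball[OF c])
    let ?K = "cball (snd c p) r" and ?U = "{q \<in> fst c. snd c q \<in> ball (snd c p) r}"
    have U: "open ?U" by (rule open_dom_preimage[OF c(1) open_ball])
    have "continuous_on ?K (\<lambda>x. sqrt (det (g c x)))"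
      using continuous_on_subset[OF _ r(2)] C_diff_volume_density[of 0] by simp
    then have "bounded ((\<lambda>x. sqrt (det (g c x))) ` ?K)"
      by (intro compact_imp_bounded compact_continuous_image compact_cball)
    then obtain M where "\<forall>y\<in>(\<lambda>x. sqrt (det (g c x))) ` ?K. norm y \<le> M" unfolding bounded_iff ..
    then have M: "sqrt (det (g c x)) \<le> M" if "x \<in> ?K" for x
      using that by (metis abs_le_D1 imageI real_norm_def)
    have "emeasure (vol A g) ?U = emeasure (chart_measure c) (snd c ` ?U)"
      by (rule emeasure_vol[OF c(1)]) (use U in auto)
    also have "\<dots> \<le> emeasure (chart_measure c) ?K"
      by (rule emeasure_mono) (auto intro: less_imp_le)
    also have "\<dots> = (\<integral>\<^sup>+x\<in>?K. ennreal (sqrt (det (g c x))) \<partial>lborel)"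
      by (rule emeasure_chart_measure[OF c(1) _ r(2)]) simp
    also have "\<dots> \<le> (\<integral>\<^sup>+x. ennreal M * indicator ?K x \<partial>lborel)"
      using M by (intro nn_integral_mono) (auto simp: indicator_def intro: ennreal_leI)
    also have "\<dots> = ennreal M * emeasure lborel ?K" by (rule nn_integral_cmult_indicator) simp
    also have "\<dots> < \<infinity>" using emeasure_bounded_finite[OF bounded_cball, of "snd c p" r] by (simp add: ennreal_mult_less_top)
    finally show ?thesis using U c(2) r(1) by (intro exI[of _ ?U]) auto
  qed
  then obtain U where U: "\<And>p. open (U p)" "\<And>p. p \<in> U p" "\<And>p. emeasure (vol A g) (U p) < \<infinity>" by metis
  have "UNIV \<subseteq> (\<Union>p\<in>UNIV. U p)" using U(2) by blast
  then obtain P where P: "P \<subseteq> UNIV" "finite P" "UNIV \<subseteq> (\<Union>p\<in>P. U p)"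
    by (rule compactE_image[OF compact U(1)])
  have "(\<Union>p\<in>P. U p) = UNIV" using P(3) by blast
  then have "emeasure (vol A g) UNIV = emeasure (vol A g) (\<Union>p\<in>P. U p)" by simp
  also have "\<dots> \<le> (\<Sum>p\<in>P. emeasure (vol A g) (U p))"
    using U(1) P(2) by (intro emeasure_subadditive_finite) auto
  also have "\<dots> < \<infinity>" using U(3) P(2) by simp
  finally show "emeasure (vol A g) (space (vol A g)) \<noteq> \<infinity>" by simp
qed

lemma integrable_continuous:
  fixes f :: "'a \<Rightarrow> real"
  assumes "continuous_on UNIV f"
  shows "integrable (vol A g) f"
proof -
  interpret finite_measure "vol A g" by (rule finite_vol)
  have "bounded (range f)" by (intro compact_imp_bounded compact_continuous_image compact assms)
  then obtain B where "\<And>p. norm (f p) \<le> B" by (auto simp: bounded_iff)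
  moreover have "f \<in> borel_measurable (vol A g)"
    using borel_measurable_continuous_onI[OF assms] by (simp add: measurable_cong_sets[OF sets_vol refl])
  ultimately show ?thesis by (intro integrable_const_bound[of _ B]) auto
qed

text \<open>A nonempty open set has positive measure, since it contains a nonempty open subset of a chart domain, where the density is positive.\<close>

lemma nonneg_integral_zero:
  fixes f :: "'a \<Rightarrow> real"
  assumes cont: "continuous_on UNIV f" and nonneg: "\<And>p. 0 \<le> f p" and zero: "(\<integral>p. f p \<partial>vol A g) = 0"
  shows "f p = 0"
proof (rule ccontr)
  assume "f p \<noteq> 0"
  obtain c where c: "c \<in> A" "p \<in> fst c" using chart_cover by blast
  interpret metric_chart "g c" "chart_img c" by (rule metric_chart_at[OF c(1)])
  define Z where "Z = {q. f q \<noteq> 0}"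
  have Z: "open Z"
  proof -
    have "Z = f -` (- {0})" by (auto simp: Z_def)
    moreover have "open (- {0 :: real})" by (rule open_Compl) simp
    ultimately show ?thesis using open_vimage[OF _ cont] by simp
  qed
  have "AE q in vol A g. f q = 0"
    using integral_nonneg_eq_0_iff_AE[OF integrable_continuous[OF cont]] nonneg zero by simp
  then have "emeasure (vol A g) Z = 0"
    using Z by (subst (asm) AE_iff_measurable[where N = Z]) (auto simp: Z_def)
  define O' where "O' = fst c \<inter> Z"
  have O': "open O'" "O' \<subseteq> fst c" using Z open_chart_dom[OF c(1)] by (auto simp: O'_def)
  have "emeasure (vol A g) O' \<le> emeasure (vol A g) Z"
    by (rule emeasure_mono) (use Z in \<open>auto simp: O'_def\<close>)
  then have "emeasure (vol A g) O' = 0" using \<open>emeasure (vol A g) Z = 0\<close> by simp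
  then have "emeasure (chart_measure c) (snd c ` O') = 0"
    using emeasure_vol[OF c(1) _ O'(2)] O'(1) by simp
  define E where "E = snd c ` O'"
  have E: "open E"
    unfolding E_def chart_image_eq[OF c(1) O'(2)] by (rule open_chart_preimage[OF c(1) O'(1)])
  have Esub: "E \<subseteq> chart_img c" using O'(2) by (auto simp: E_def)
  have "(\<integral>\<^sup>+x\<in>E. ennreal (sqrt (det (g c x))) \<partial>lborel) = 0"
    using emeasure_chart_measure[OF c(1) _ Esub] E \<open>emeasure (chart_measure c) (snd c ` O') = 0\<close> by (simp add: E_def)
  moreover have m: "(\<lambda>x. ennreal (sqrt (det (g c x))) * indicator E x) \<in> borel_measurable lborel"
  proof -
    have "(\<lambda>x. ennreal (sqrt (det (g c x))) * indicator (chart_img c) x * indicator E x) \<in> borel_measurable borel"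
      using measurable_density_ennreal[OF c(1)] E by simp
    moreover have "(\<lambda>x. ennreal (sqrt (det (g c x))) * indicator (chart_img c) x * indicator E x) = (\<lambda>x. ennreal (sqrt (det (g c x))) * indicator E x)"
      using Esub by (auto simp: indicator_def fun_eq_iff)
    ultimately show ?thesis by simp
  qed
  ultimately have "emeasure lborel {x \<in> space lborel. ennreal (sqrt (det (g c x))) * indicator E x \<noteq> 0} = 0"
    using nn_integral_0_iff[OF m] by simp
  moreover have "{x \<in> space lborel. ennreal (sqrt (det (g c x))) * indicator E x \<noteq> 0} = E"
    using Esub det_G_pos by (force simp: indicator_def)
  ultimately have "E \<in> null_sets lborel" using E by (simp add: null_setsI)
  then have "negligible E" unfolding negligible_iff_null_sets by (rule null_sets_completionI)
  moreover have "E \<noteq> {}" using c(2) \<open>f p \<noteq> 0\<close> by (auto simp: E_def O'_def Z_def)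
  ultimately show False using open_not_negligible[OF E] by simp
qed

end

section \<open>The divergence theorem on a compact manifold\<close>

lemma C_diff_differentiable: "C_diff (Suc k) S f \<Longrightarrow> x \<in> S \<Longrightarrow> f differentiable (at x)"
  by simp

text \<open>The function \<open>(max 0 t)\<^sup>2\<close> is continuously differentiable, and this regularity suffices for a partition of
  unity in the divergence theorem.\<close>

lemma has_real_derivative_square_positive_part:
  "((\<lambda>t. (max 0 t)\<^sup>2) has_real_derivative 2 * max 0 t) (at t)"
proof -
  consider "0 < t" | "t < 0" | "t = 0" by linarith
  then show ?thesis
  proof cases
    case 1
    have "((\<lambda>t::real. t\<^sup>2) has_real_derivative 2 * max 0 t) (at t)"
      using 1 by (auto intro!: derivative_eq_intros)
    then show ?thesis
      by (rule has_field_derivative_transform_within_open[of _ _ _ "{0<..}"]) (use 1 in auto)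
  next
    case 2
    have "((\<lambda>t::real. 0) has_real_derivative 2 * max 0 t) (at t)"
      using 2 by (auto intro!: derivative_eq_intros)
    then show ?thesis
      by (rule has_field_derivative_transform_within_open[of _ _ _ "{..<0}"]) (use 2 in auto)
  next
    case 3
    have "((\<lambda>h. ((max 0 (0 + h))\<^sup>2 - (max 0 0)\<^sup>2) / h) \<longlongrightarrow> 0) (at (0::real))"
    proof (rule Lim_null_comparison)
      show "\<forall>\<^sub>F h in at (0::real). norm (((max 0 (0 + h))\<^sup>2 - (max 0 0)\<^sup>2) / h) \<le> \<bar>h\<bar>"
      proof (rule always_eventually, rule allI)
        fix h :: real
        show "norm (((max 0 (0 + h))\<^sup>2 - (max 0 0)\<^sup>2) / h) \<le> \<bar>h\<bar>"
          by (cases "0 < h") (simp_all add: power2_eq_square max_def)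
      qed
      show "((\<lambda>h::real. \<bar>h\<bar>) \<longlongrightarrow> 0) (at 0)" by (rule tendsto_rabs_zero[OF tendsto_ident_at])
    qed
    then show ?thesis using 3 by (simp add: DERIV_def)
  qed
qed

lemma C_diff_square_positive_part:
  fixes f :: "'v::real_normed_vector \<Rightarrow> real"
  assumes "open S" "C_diff (Suc 0) S f"
  shows "C_diff (Suc 0) S (\<lambda>x. (max 0 (f x))\<^sup>2)"
proof (rule C_diff_SucI[OF assms(1)])
  show "((\<lambda>y. (max 0 (f y))\<^sup>2) has_derivative (\<lambda>v. 2 * max 0 (f x) * frechet_derivative f (at x) v)) (at x)" if "x \<in> S" for x
    using has_derivative_compose[OF C_diff_has_derivative[OF assms(2) that]
        has_real_derivative_square_positive_part[unfolded has_field_derivative_def]] by simp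
  show "C_diff 0 S (\<lambda>x. 2 * max 0 (f x) * frechet_derivative f (at x) v)" for v
    using C_diff_Suc_imp[OF assms(2)] C_diff_frechet[OF assms(2)] by (auto intro!: continuous_intros)
qed

context riemannian_manifold
begin

definition C1_function :: "('a \<Rightarrow> real) \<Rightarrow> bool" where
  "C1_function f \<longleftrightarrow> (\<forall>c\<in>A. C_diff (Suc 0) (chart_img c) (\<lambda>x. f (chart_inv c x)))"

definition C1_field :: "(('a, 'n) chart \<Rightarrow> real^'n \<Rightarrow> real^'n) \<Rightarrow> bool" where
  "C1_field Y \<longleftrightarrow> (\<forall>c\<in>A. \<forall>i. C_diff (Suc 0) (chart_img c) (\<lambda>x. Y c x $ i)) \<and>
     (\<forall>c\<in>A. \<forall>d\<in>A. \<forall>p\<in>fst c \<inter> fst d. Y d (snd d p) = jac_mat (transition c d) (snd c p) *v Y c (snd c p))"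

lemma C1_fieldD:
  "C1_field Y \<Longrightarrow> c \<in> A \<Longrightarrow> C_diff (Suc 0) (chart_img c) (\<lambda>x. Y c x $ i)"
  "C1_field Y \<Longrightarrow> c \<in> A \<Longrightarrow> d \<in> A \<Longrightarrow> x \<in> overlap c d \<Longrightarrow> Y d (transition c d x) = jac_mat (transition c d) x *v Y c x"
proof -
  assume Y: "C1_field Y" and c: "c \<in> A"
  show "C_diff (Suc 0) (chart_img c) (\<lambda>x. Y c x $ i)" using Y c by (simp only: C1_field_def)
  assume d: "d \<in> A" and x: "x \<in> overlap c d"
  obtain p where p: "p \<in> fst c \<inter> fst d" "x = snd c p" using x unfolding overlap_def by (rule imageE)
  have "Y d (snd d p) = jac_mat (transition c d) (snd c p) *v Y c (snd c p)"
    using Y c d p(1) by (simp only: C1_field_def)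
  then show "Y d (transition c d x) = jac_mat (transition c d) x *v Y c x"
    using transition_chart[OF c, of p] p by simp
qed

lemma C1_field_differentiable:
  assumes "C1_field Y" "c \<in> A" "x \<in> chart_img c" shows "(\<lambda>y. Y c y $ i) differentiable (at x)"
  by (rule C_diff_differentiable[OF C1_fieldD(1)[OF assms(1,2)] assms(3)])

definition divergence :: "(('a, 'n) chart \<Rightarrow> real^'n \<Rightarrow> real^'n) \<Rightarrow> 'a \<Rightarrow> real" where
  "divergence Y = glue A (\<lambda>c. divergence_vec (g c) (Y c))"

lemma divergence_chart_independent:
  assumes Y: "C1_field Y" and c: "c \<in> A" and d: "d \<in> A" and p: "p \<in> fst c \<inter> fst d"
  shows "divergence_vec (g c) (Y c) (snd c p) = divergence_vec (g d) (Y d) (snd d p)"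
proof -
  interpret C: chart_change "g c" "chart_img c" "g d" "chart_img d" "transition c d" "overlap c d"
    by (rule chart_change_at[OF c d])
  have x: "snd c p \<in> overlap c d" unfolding overlap_def by (rule imageI[OF p])
  have tr: "transition c d (snd c p) = snd d p" using transition_chart[OF c] p by blast
  have "divergence_vec (g d) (Y d) (transition c d (snd c p)) = divergence_vec (g c) (Y c) (snd c p)"
  proof (rule C.divergence_invariant[OF x])
    show "(\<lambda>y. Y c y $ i) differentiable (at (snd c p))" for i
      by (rule C1_field_differentiable[OF Y c]) (use p in auto)
    show "(\<lambda>y. Y d y $ i) differentiable (at (transition c d (snd c p)))" for i
      unfolding tr by (rule C1_field_differentiable[OF Y d]) (use p in auto)
  qed (rule C1_fieldD(2)[OF Y c d])
  then show ?thesis unfolding tr by (rule sym)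
qed

lemma divergence_eq:
  assumes Y: "C1_field Y" and c: "c \<in> A" "p \<in> fst c"
  shows "divergence Y p = divergence_vec (g c) (Y c) (snd c p)"
  unfolding divergence_def
  by (rule glue_eq[where h = "\<lambda>c. divergence_vec (g c) (Y c)", OF _ c]) (rule divergence_chart_independent[OF Y])

lemma continuous_divergence:
  assumes Y: "C1_field Y" shows "continuous_on UNIV (divergence Y)"
proof (rule continuous_from_charts)
  fix c assume c: "c \<in> A"
  interpret metric_chart "g c" "chart_img c" by (rule metric_chart_at[OF c])
  have "continuous_on (chart_img c) (\<lambda>x. (\<Sum>i\<in>UNIV. pd i (\<lambda>y. Y c y $ i) x + (\<Sum>a\<in>UNIV. christoffel (g c) i i a x * Y c x $ a)))"
    using C_diff_pd[OF C1_fieldD(1)[OF Y c]] C_diff_Suc_imp[OF C1_fieldD(1)[OF Y c]] smooth_on_cont[OF smooth_christoffel]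
    by (intro continuous_on_sum continuous_on_add continuous_on_mult) simp_all
  then have "continuous_on (chart_img c) (divergence_vec (g c) (Y c))"
    by (simp add: divergence_vec_def[abs_def] nabla_vec_def)
  then show "continuous_on (chart_img c) (divergence Y \<circ> chart_inv c)"
    by (rule continuous_on_eq) (simp add: divergence_eq[OF Y c] chart_inv_dom[OF c] chart_chart_inv[OF c])
qed

lemma C1_field_scale:
  assumes f: "C1_function f" and Y: "C1_field Y"
  shows "C1_field (\<lambda>c x. f (chart_inv c x) *\<^sub>R Y c x)"
  unfolding C1_field_def
proof (intro conjI ballI allI)
  fix c i assume c: "c \<in> A"
  show "C_diff (Suc 0) (chart_img c) (\<lambda>x. (f (chart_inv c x) *\<^sub>R Y c x) $ i)"
    unfolding vector_scaleR_component real_scaleR_def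
    by (rule C_diff_mult[OF open_chart_img[OF c] _ C1_fieldD(1)[OF Y c]]) (use f c in \<open>simp only: C1_function_def\<close>)
next
  fix c d p assume c: "c \<in> A" and d: "d \<in> A" and p: "p \<in> fst c \<inter> fst d"
  have e: "chart_inv c (snd c p) = p" "chart_inv d (snd d p) = p" using chart_inv_chart c d p by blast+
  have "Y d (snd d p) = jac_mat (transition c d) (snd c p) *v Y c (snd c p)"
    using Y c d p unfolding C1_field_def by blast
  then show "f (chart_inv d (snd d p)) *\<^sub>R Y d (snd d p) = jac_mat (transition c d) (snd c p) *v (f (chart_inv c (snd c p)) *\<^sub>R Y c (snd c p))"
    unfolding e by (simp add: matrix_vector_mult_scaleR)
qed

lemma C1_function_sum: "(\<And>i. i \<in> I \<Longrightarrow> C1_function (f i)) \<Longrightarrow> C1_function (\<lambda>p. \<Sum>i\<in>I. f i p)"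
  unfolding C1_function_def by (intro ballI C_diff_sum open_chart_img) auto

lemma C1_function_divide:
  "C1_function f \<Longrightarrow> C1_function h \<Longrightarrow> (\<And>p. h p \<noteq> 0) \<Longrightarrow> C1_function (\<lambda>p. f p / h p)"
  unfolding C1_function_def by (intro ballI C_diff_divide open_chart_img) auto

text \<open>The function \<open>(max 0 (r\<^sup>2 - |x - a|\<^sup>2))\<^sup>2\<close> in a chart, where \<open>a\<close> is the image of \<open>p\<close> and the closed ball of radius \<open>r\<close> lies in the image of the chart.\<close>

lemma bump_function:
  assumes c: "c \<in> A" and p: "p \<in> fst c"
  shows "\<exists>\<psi> K. C1_function \<psi> \<and> (\<forall>q. 0 \<le> \<psi> q) \<and> 0 < \<psi> p \<and> compact K \<and> K \<subseteq> fst c \<and> (\<forall>q. q \<notin> K \<longrightarrow> \<psi> q = 0)"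
proof -
  obtain r where r: "0 < r" "cball (snd c p) r \<subseteq> chart_img c" by (rule chart_contains_cball[OF c p])
  define h where "h x = r\<^sup>2 - (x - snd c p) \<bullet> (x - snd c p)" for x
  define \<psi> where "\<psi> q = (if q \<in> fst c then (max 0 (h (snd c q)))\<^sup>2 else 0)" for q
  define K where "K = chart_inv c ` cball (snd c p) r"
  have K: "compact K"
    unfolding K_def by (rule compact_continuous_image[OF continuous_on_subset[OF continuous_chart_inv[OF c] r(2)] compact_cball])
  have K_sub: "K \<subseteq> fst c" using chart_inv_dom[OF c] r(2) by (auto simp: K_def)
  have \<psi>0: "\<psi> q = 0" if "q \<notin> K" for q
  proof (cases "q \<in> fst c")
    case True
    have "snd c q \<notin> cball (snd c p) r"
    proof
      assume "snd c q \<in> cball (snd c p) r"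
      then have "chart_inv c (snd c q) \<in> K" unfolding K_def by (rule imageI)
      then show False using that chart_inv_chart[OF c True] by simp
    qed
    then have "r < norm (snd c q - snd c p)" by (simp add: dist_norm norm_minus_commute)
    then have "r\<^sup>2 < (norm (snd c q - snd c p))\<^sup>2" using r(1) by (intro power_strict_mono) auto
    then have "h (snd c q) < 0" by (simp add: h_def power2_norm_eq_inner)
    then show ?thesis by (simp add: \<psi>_def max_def)
  qed (simp add: \<psi>_def)
  have "C1_function \<psi>"
    unfolding C1_function_def
  proof
    fix d assume d: "d \<in> A"
    let ?O = "overlap d c" and ?\<tau> = "transition d c" and ?K = "{x \<in> chart_img d. chart_inv d x \<in> K}"
    have O: "open ?O" by (rule open_overlap[OF d c])
    have "C_diff (Suc 0) ?O (\<lambda>x. ?\<tau> x $ i)" for i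
      by (rule smooth_on_C_diff[OF smooth_on_comp_nth[OF O smooth_transition[OF d c]]])
    then have "C_diff (Suc 0) ?O (\<lambda>x. h (?\<tau> x))"
      unfolding h_def inner_vec_def inner_real_def vector_minus_component
      by (intro C_diff_diff C_diff_sum C_diff_mult C_diff_const O)
    then have C1: "C_diff (Suc 0) ?O (\<lambda>x. (max 0 (h (?\<tau> x)))\<^sup>2)"
      by (rule C_diff_square_positive_part[OF O])
    have "open {x \<in> chart_img d. chart_inv d x \<in> - K}"
      by (rule open_chart_preimage[OF d open_Compl[OF compact_imp_closed[OF K]]])
    moreover have "{x \<in> chart_img d. chart_inv d x \<in> - K} = chart_img d - ?K" by auto
    ultimately have oK: "open (chart_img d - ?K)" by simp
    have val: "\<psi> (chart_inv d x) = (if x \<in> ?O then (max 0 (h (?\<tau> x)))\<^sup>2 else 0)" if "x \<in> chart_img d" for x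
      using that by (simp add: \<psi>_def overlap_iff[OF d] transition_def)
    have "C_diff (Suc 0) (chart_img d) (\<lambda>x. if x \<in> ?O then (max 0 (h (?\<tau> x)))\<^sup>2 else 0)"
    proof (rule C_diff_zero_extension[OF O oK overlap_subset _ C1])
      show "?K \<subseteq> ?O" using K_sub by (auto simp: overlap_iff[OF d])
      show "(max 0 (h (?\<tau> x)))\<^sup>2 = 0" if "x \<in> ?O - ?K" for x
      proof -
        have "x \<in> chart_img d" "x \<in> ?O" "chart_inv d x \<notin> K" using that overlap_subset by blast+
        then show ?thesis using val[of x] \<psi>0[of "chart_inv d x"] by simp
      qed
    qed
    then show "C_diff (Suc 0) (chart_img d) (\<lambda>x. \<psi> (chart_inv d x))"
      by (rule C_diff_cong[OF open_chart_img[OF d], rotated]) (rule val[symmetric])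
  qed
  moreover have "0 < \<psi> p" using r(1) p by (simp add: \<psi>_def h_def)
  moreover have "\<forall>q. 0 \<le> \<psi> q" by (simp add: \<psi>_def)
  ultimately show ?thesis using K K_sub \<psi>0 by blast
qed

end

context compact_riemannian_manifold
begin

text \<open>Near every point outside the chart domain the field vanishes, so the integral is one over a single chart.\<close>

lemma integral_divergence_compact_support:
  assumes Y: "C1_field Y" and c: "c \<in> A" and K: "compact K" "K \<subseteq> fst c"
    and Y0: "\<And>d x. d \<in> A \<Longrightarrow> x \<in> chart_img d \<Longrightarrow> chart_inv d x \<notin> K \<Longrightarrow> Y d x = 0"
  shows "(\<integral>p. divergence Y p \<partial>vol A g) = 0"
proof -
  interpret metric_chart "g c" "chart_img c" by (rule metric_chart_at[OF c])
  have div0: "divergence Y p = 0" if p: "p \<notin> fst c" for p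
  proof -
    obtain d where d: "d \<in> A" "p \<in> fst d" using chart_cover by blast
    let ?U = "{x \<in> chart_img d. chart_inv d x \<in> - K}"
    have U: "open ?U" by (rule open_chart_preimage[OF d(1) open_Compl[OF compact_imp_closed[OF K(1)]]])
    have x: "snd d p \<in> ?U" using chart_inv_chart[OF d] d p K(2) by auto
    have "pd i (\<lambda>y. Y d y $ j) (snd d p) = 0" for i j
    proof -
      have "pd i (\<lambda>y. 0) (snd d p) = pd i (\<lambda>y. Y d y $ j) (snd d p)"
        by (rule pd_cong[OF U x]) (use Y0[OF d(1)] in auto)
      then show ?thesis by simp
    qed
    moreover have "Y d (snd d p) = 0" using Y0[OF d(1)] x by auto
    ultimately show ?thesis by (simp add: divergence_eq[OF Y d] divergence_vec_def nabla_vec_def)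
  qed
  have "(\<integral>p. divergence Y p \<partial>vol A g) = (\<integral>x. indicator (chart_img c) x * (sqrt (det (g c x)) * divergence Y (chart_inv c x)) \<partial>lborel)"
    by (rule integral_vol_chart[OF c borel_measurable_continuous_onI[OF continuous_divergence[OF Y]] div0])
  also have "\<dots> = (\<integral>x. indicator (chart_img c) x * (sqrt (det (g c x)) * divergence_vec (g c) (Y c) x) \<partial>lborel)"
    by (intro Bochner_Integration.integral_cong refl)
      (simp add: indicator_def divergence_eq[OF Y c] chart_inv_dom[OF c] chart_chart_inv[OF c])
  also have "\<dots> = 0"
  proof (rule chart_divergence_theorem[where K = "snd c ` K"])
    show "C_diff (Suc 0) (chart_img c) (\<lambda>y. Y c y $ i)" for i by (rule C1_fieldD(1)[OF Y c])
    show "compact (snd c ` K)"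
      by (rule compact_continuous_image[OF continuous_on_subset[OF continuous_chart[OF c] K(2)] K(1)])
    show "snd c ` K \<subseteq> chart_img c" by (rule image_mono[OF K(2)])
    show "Y c y = 0" if y: "y \<in> chart_img c - snd c ` K" for y
    proof (rule Y0[OF c])
      show "y \<in> chart_img c" using y by blast
      show "chart_inv c y \<notin> K" using y chart_image_eq[OF c K(2)] by blast
    qed
  qed
  finally show ?thesis .
qed

text \<open>Dividing finitely many bump functions by their positive sum gives a partition of unity \<open>\<rho>\<close>. The field is
  the sum of the fields \<open>\<rho>\<^sub>p Y\<close>, each with compact support in a chart domain.\<close>

theorem divergence_theorem:
  assumes Y: "C1_field Y"
  shows "(\<integral>p. divergence Y p \<partial>vol A g) = 0"
proof -
  have "\<forall>p. \<exists>c \<psi> K. c \<in> A \<and> C1_function \<psi> \<and> (\<forall>q. 0 \<le> \<psi> q) \<and> 0 < \<psi> p \<and> compact K \<and> K \<subseteq> fst c \<and> (\<forall>q. q \<notin> K \<longrightarrow> \<psi> q = 0)"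
  proof
    fix p
    obtain c where c: "c \<in> A" "p \<in> fst c" using chart_cover by blast
    from bump_function[OF c] c(1)
    show "\<exists>c \<psi> K. c \<in> A \<and> C1_function \<psi> \<and> (\<forall>q. 0 \<le> \<psi> q) \<and> 0 < \<psi> p \<and> compact K \<and> K \<subseteq> fst c \<and> (\<forall>q. q \<notin> K \<longrightarrow> \<psi> q = 0)"
      by blast
  qed
  then obtain c \<psi> K where all: "\<forall>p. c p \<in> A \<and> C1_function (\<psi> p) \<and> (\<forall>q. 0 \<le> \<psi> p q) \<and> 0 < \<psi> p p \<and> compact (K p) \<and> K p \<subseteq> fst (c p) \<and> (\<forall>q. q \<notin> K p \<longrightarrow> \<psi> p q = 0)"
    unfolding choice_iff by (elim exE)
  have cA: "\<And>p. c p \<in> A" and \<psi>: "\<And>p. C1_function (\<psi> p)" "\<And>p q. 0 \<le> \<psi> p q" "\<And>p. 0 < \<psi> p p"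
    and K: "\<And>p. compact (K p)" "\<And>p. K p \<subseteq> fst (c p)" "\<And>p q. q \<notin> K p \<Longrightarrow> \<psi> p q = 0"
    using all by blast+
  have cont: "continuous_on UNIV (\<psi> p)" for p
  proof (rule continuous_from_charts)
    fix d assume "d \<in> A"
    then have "C_diff (Suc 0) (chart_img d) (\<lambda>x. \<psi> p (chart_inv d x))" using \<psi>(1) by (simp only: C1_function_def)
    from C_diff_Suc_imp[OF this] show "continuous_on (chart_img d) (\<psi> p \<circ> chart_inv d)" by (simp add: o_def)
  qed
  define U where "U p = \<psi> p -` {0<..}" for p
  have U: "open (U p)" for p unfolding U_def by (rule open_vimage[OF open_greaterThan cont])
  have "UNIV \<subseteq> (\<Union>p\<in>UNIV. U p)" using \<psi>(3) by (auto simp: U_def)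
  then obtain P where P: "P \<subseteq> UNIV" "finite P" "UNIV \<subseteq> (\<Union>p\<in>P. U p)" by (rule compactE_image[OF compact U])
  define \<Psi> where "\<Psi> q = (\<Sum>p\<in>P. \<psi> p q)" for q
  have \<Psi>_pos: "0 < \<Psi> q" for q
  proof -
    obtain p where "p \<in> P" "q \<in> U p" using P(3) by blast
    then show ?thesis unfolding \<Psi>_def using \<psi>(2) P(2) by (intro sum_pos2[of P p]) (auto simp: U_def)
  qed
  define \<rho> where "\<rho> p q = \<psi> p q / \<Psi> q" for p q
  have \<rho>: "C1_function (\<rho> p)" for p
    unfolding \<rho>_def[abs_def] \<Psi>_def[abs_def]
    by (intro C1_function_divide C1_function_sum \<psi>(1)) (use \<Psi>_pos in \<open>simp add: \<Psi>_def less_imp_neq[symmetric]\<close>)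
  have \<rho>_sum: "(\<Sum>p\<in>P. \<rho> p q) = 1" for q
    unfolding \<rho>_def sum_divide_distrib[symmetric] \<Psi>_def[symmetric] using \<Psi>_pos[of q] by simp
  define Z where "Z p d x = \<rho> p (chart_inv d x) *\<^sub>R Y d x" for p d x
  have Z: "C1_field (Z p)" for p
    unfolding Z_def[abs_def] by (rule C1_field_scale[OF \<rho> Y])
  have "divergence Y q = (\<Sum>p\<in>P. divergence (Z p) q)" for q
  proof -
    obtain d where d: "d \<in> A" "q \<in> fst d" using chart_cover by blast
    let ?x = "snd d q"
    have x: "?x \<in> chart_img d" using d(2) by (rule imageI)
    have Ysum: "Y d y $ i = (\<Sum>p\<in>P. Z p d y $ i)" for y i
      unfolding Z_def vector_scaleR_component real_scaleR_def sum_distrib_right[symmetric] \<rho>_sum by simp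
    have "pd i (\<lambda>y. Y d y $ i) ?x = (\<Sum>p\<in>P. pd i (\<lambda>y. Z p d y $ i) ?x)" for i
      unfolding Ysum by (rule pd_sum) (rule C1_field_differentiable[OF Z d(1) x])
    then have "divergence_vec (g d) (Y d) ?x = (\<Sum>i\<in>UNIV. \<Sum>p\<in>P. nabla_vec (g d) (Z p d) ?x $ i $ i)"
      unfolding divergence_vec_def nabla_vec_def vec_lambda_beta Ysum
      by (simp add: sum.distrib sum_distrib_left) (intro sum.cong refl sum.swap)
    also have "\<dots> = (\<Sum>p\<in>P. divergence_vec (g d) (Z p d) ?x)"
      unfolding divergence_vec_def by (rule sum.swap)
    finally show ?thesis by (simp add: divergence_eq[OF Y d] divergence_eq[OF Z d])
  qed
  then have "(\<integral>q. divergence Y q \<partial>vol A g) = (\<Sum>p\<in>P. \<integral>q. divergence (Z p) q \<partial>vol A g)"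
    by (simp add: Bochner_Integration.integral_sum integrable_continuous continuous_divergence[OF Z])
  also have "\<dots> = 0"
  proof (intro sum.neutral ballI)
    fix p assume "p \<in> P"
    show "(\<integral>q. divergence (Z p) q \<partial>vol A g) = 0"
      by (rule integral_divergence_compact_support[OF Z cA[of p] K(1) K(2)]) (simp add: Z_def \<rho>_def K(3))
  qed
  finally show ?thesis .
qed

end

section \<open>The orthogonal expansion of the Ricci tensor on a compact manifold\<close>

context chart_change
begin

lemma traceless_strain_pullback:
  assumes x: "x \<in> U" and X: "\<And>i. (\<lambda>y. X y $ i) differentiable (at x)"
    and X': "\<And>i. (\<lambda>y. X' y $ i) differentiable (at (\<tau> x))"
    and related: "\<And>y. y \<in> U \<Longrightarrow> X' (\<tau> y) = jac_mat \<tau> y *v X y"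
  shows "traceless_strain G X x = transpose (jac_mat \<tau> x) ** traceless_strain G' X' (\<tau> x) ** jac_mat \<tau> x"
proof -
  let ?J = "jac_mat \<tau> x"
  have "divergence_vec G' X' (\<tau> x) = divergence_vec G X x" by (rule divergence_invariant[OF x X X' related])
  moreover have "lie_metric G X x = transpose ?J ** lie_metric G' X' (\<tau> x) ** ?J"
    by (rule lie_metric_pullback[OF x X X' related])
  ultimately show ?thesis
    unfolding traceless_strain_def pullback[OF x]
    by (simp add: matrix_mul_diff_left matrix_mul_diff_right matrix_mul_scaleR_left matrix_mul_scaleR_right)
qed

text \<open>Lowering the index with \<open>G = J\<^sup>T G' J\<close> reduces the claim to the transformation of the strain, because \<open>J\<^sup>T G'\<close> is invertible.\<close>

lemma strain_flux_related:
  assumes x: "x \<in> U" and X: "\<And>i. (\<lambda>y. X y $ i) differentiable (at x)"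
    and X': "\<And>i. (\<lambda>y. X' y $ i) differentiable (at (\<tau> x))"
    and related: "\<And>y. y \<in> U \<Longrightarrow> X' (\<tau> y) = jac_mat \<tau> y *v X y"
  shows "strain_flux G' X' (\<tau> x) = jac_mat \<tau> x *v strain_flux G X x"
proof -
  let ?J = "jac_mat \<tau> x" and ?M = "transpose (jac_mat \<tau> x) ** G' (\<tau> x)"
  have xV: "x \<in> V" "\<tau> x \<in> V'" using x U_V \<tau>_maps by auto
  have flux: "G x *v strain_flux G X x = traceless_strain G X x *v X x"
    by (simp add: strain_flux_def matrix_vector_mul_assoc matrix_mul_assoc M.mul_inv_G[OF xV(1)])
  have flux': "G' (\<tau> x) *v strain_flux G' X' (\<tau> x) = traceless_strain G' X' (\<tau> x) *v X' (\<tau> x)"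
    by (simp add: strain_flux_def matrix_vector_mul_assoc matrix_mul_assoc M'.mul_inv_G[OF xV(2)])
  have "?M *v (?J *v strain_flux G X x) = G x *v strain_flux G X x"
    by (simp only: pullback[OF x] matrix_vector_mul_assoc matrix_mul_assoc)
  also have "\<dots> = (transpose ?J ** traceless_strain G' X' (\<tau> x) ** ?J) *v X x"
    by (simp only: flux traceless_strain_pullback[OF x X X' related])
  also have "\<dots> = transpose ?J *v (traceless_strain G' X' (\<tau> x) *v X' (\<tau> x))"
    by (simp only: related[OF x] matrix_vector_mul_assoc matrix_mul_assoc)
  also have "\<dots> = ?M *v strain_flux G' X' (\<tau> x)"
    by (simp only: flux'[symmetric] matrix_vector_mul_assoc matrix_mul_assoc)
  finally have eq: "?M *v (?J *v strain_flux G X x) = ?M *v strain_flux G' X' (\<tau> x)" .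
  have "det ?M \<noteq> 0"
    using det_jac_nonzero[OF x] M'.det_G_pos[OF xV(2)] by (simp add: det_mul det_transpose)
  then obtain N where N: "N ** ?M = mat 1" by (auto simp: invertible_det_nz[symmetric] invertible_def)
  have "N *v (?M *v (?J *v strain_flux G X x)) = N *v (?M *v strain_flux G' X' (\<tau> x))"
    by (simp only: eq)
  then show ?thesis unfolding matrix_vector_mul_assoc[of N ?M] N matrix_vector_mul_lid by (rule sym)
qed

end

context riemannian_manifold
begin

lemma locally_constant_imp_constant:
  fixes f :: "'a \<Rightarrow> real"
  assumes conn: "connected (UNIV :: 'a set)"
    and diff: "\<And>c x. c \<in> A \<Longrightarrow> x \<in> chart_img c \<Longrightarrow> (\<lambda>y. f (chart_inv c y)) differentiable (at x)"
    and zero: "\<And>c x i. c \<in> A \<Longrightarrow> x \<in> chart_img c \<Longrightarrow> pd i (\<lambda>y. f (chart_inv c y)) x = 0"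
  shows "\<exists>k. \<forall>p. f p = k"
proof -
  have "eventually (\<lambda>q. f p = f q) (at p within UNIV)" for p
  proof -
    obtain c where c: "c \<in> A" "p \<in> fst c" using chart_cover by blast
    obtain r where r: "0 < r" "ball (snd c p) r \<subseteq> chart_img c"
      using open_chart_img[OF c(1)] c(2) by (meson imageI open_contains_ball)
    have "\<exists>k. \<forall>x\<in>ball (snd c p) r. f (chart_inv c x) = k"
    proof (rule has_derivative_zero_constant[OF convex_ball])
      fix x assume "x \<in> ball (snd c p) r"
      then have x: "x \<in> chart_img c" using r(2) by blast
      have "((\<lambda>y. f (chart_inv c y)) has_derivative (\<lambda>h. 0)) (at x)"
        using pd_has_derivative[OF diff[OF c(1) x]] by (simp add: zero[OF c(1) x])
      then show "((\<lambda>y. f (chart_inv c y)) has_derivative (\<lambda>h. 0)) (at x within ball (snd c p) r)"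
        by (rule has_derivative_at_withinI)
    qed
    then obtain k where k: "\<And>x. x \<in> ball (snd c p) r \<Longrightarrow> f (chart_inv c x) = k" by blast
    have fk: "f q = k" if "q \<in> fst c" "snd c q \<in> ball (snd c p) r" for q
      using k[OF that(2)] chart_inv_chart[OF c(1) that(1)] by simp
    have "open {q \<in> fst c. snd c q \<in> ball (snd c p) r}" by (rule open_dom_preimage[OF c(1) open_ball])
    then show ?thesis
      unfolding eventually_at_topological using c(2) r(1) fk
      by (intro exI[of _ "{q \<in> fst c. snd c q \<in> ball (snd c p) r}"]) auto
  qed
  then have "f p = f q" for p q
    using connected_local_const[OF conn, of p q f] by simp
  then show ?thesis by blast
qed

end

locale ricci_expansion_manifold = compact_riemannian_manifold A g
  for A :: "('a::t2_space, 'n::finite) chart set" and g +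
  fixes \<xi> :: "('a, 'n) chart \<Rightarrow> real^'n \<Rightarrow> real^'n" and l :: "'a \<Rightarrow> real" and \<phi> :: "('a, 'n) chart \<Rightarrow> real^'n \<Rightarrow> real^'n^'n"
  assumes conn: "connected (UNIV :: 'a set)" and exp: "ricci_expansion A g \<xi> l \<phi>"
begin

lemma expansion_chart_at:
  assumes c: "c \<in> A"
  shows "ricci_expansion_chart (g c) (chart_img c) (\<xi> c) (\<lambda>x. l (chart_inv c x)) (\<phi> c)"
proof (intro ricci_expansion_chart.intro ricci_expansion_chart_axioms.intro metric_chart_at c)
  note e = exp[unfolded ricci_expansion_def tt_tensor_def]
  show "smooth_on (chart_img c) (\<xi> c)" using e c unfolding smooth_vector_field_def by blast
  have "smooth_on (chart_img c) (l \<circ> chart_inv c)" using e c unfolding smooth_fun_def by blast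
  then show "smooth_on (chart_img c) (\<lambda>x. l (chart_inv c x))" by (simp only: o_def)
  show "smooth_on (chart_img c) (\<phi> c)" using e c unfolding smooth_sym_tensor_def by blast
  fix x assume "x \<in> chart_img c"
  then show "delta (g c) (\<phi> c) x = 0" "metric_trace (g c) (\<phi> c) x = 0"
    "ricci (g c) x = ((1/2) *\<^sub>R lie_metric (g c) (\<xi> c) x + l (chart_inv c x) *\<^sub>R g c x) + \<phi> c x"
    using e c by blast+
qed

lemma \<xi>_field: "C1_field \<xi>"
  unfolding C1_field_def
proof (intro conjI ballI allI)
  fix c i assume c: "c \<in> A"
  interpret E: ricci_expansion_chart "g c" "chart_img c" "\<xi> c" "\<lambda>x. l (chart_inv c x)" "\<phi> c" by (rule expansion_chart_at[OF c])
  show "C_diff (Suc 0) (chart_img c) (\<lambda>x. \<xi> c x $ i)"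
    by (rule smooth_on_C_diff[OF E.X_smooth[OF E.smooth_X]])
next
  fix c d p assume c: "c \<in> A" and d: "d \<in> A" and p: "p \<in> fst c \<inter> fst d"
  have "\<xi> d (snd d p) = jacobian c d p (\<xi> c (snd c p))"
    using exp c d p unfolding ricci_expansion_def smooth_vector_field_def by blast
  then show "\<xi> d (snd d p) = jac_mat (transition c d) (snd c p) *v \<xi> c (snd c p)"
    by (simp only: jacobian_eq_jac_mat(1)[OF c d p])
qed

text \<open>The trace of the expansion is \<open>s = div \<xi> + n \<lambda>\<close>, so the invariance of \<open>s\<close> follows from that of the divergence.\<close>

lemma scalar_chart_independent:
  assumes c: "c \<in> A" and d: "d \<in> A" and p: "p \<in> fst c \<inter> fst d"
  shows "scalar (g c) (snd c p) = scalar (g d) (snd d p)"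
proof -
  interpret C: ricci_expansion_chart "g c" "chart_img c" "\<xi> c" "\<lambda>x. l (chart_inv c x)" "\<phi> c" by (rule expansion_chart_at[OF c])
  interpret D: ricci_expansion_chart "g d" "chart_img d" "\<xi> d" "\<lambda>x. l (chart_inv d x)" "\<phi> d" by (rule expansion_chart_at[OF d])
  have "snd c p \<in> chart_img c" "snd d p \<in> chart_img d" "chart_inv c (snd c p) = p" "chart_inv d (snd d p) = p"
    using p chart_inv_chart[OF c] chart_inv_chart[OF d] by auto
  then show ?thesis
    by (simp add: C.scalar_eq D.scalar_eq divergence_chart_independent[OF \<xi>_field c d p])
qed

lemma scalar_curvature_eq: "c \<in> A \<Longrightarrow> p \<in> fst c \<Longrightarrow> scalar_curvature A g p = scalar (g c) (snd c p)"
  unfolding scalar_curvature_def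
  by (rule glue_eq[where h = "\<lambda>c. scalar (g c)"]) (rule scalar_chart_independent)

lemma scalar_curvature_chart: "c \<in> A \<Longrightarrow> x \<in> chart_img c \<Longrightarrow> scalar_curvature A g (chart_inv c x) = scalar (g c) x"
  by (simp add: scalar_curvature_eq chart_inv_dom chart_chart_inv)

text \<open>The function \<open>\<xi>(s)\<close> in coordinates.\<close>

definition d_scalar :: "('a, 'n) chart \<Rightarrow> real^'n \<Rightarrow> real" where
  "d_scalar c x = (\<Sum>j\<in>UNIV. \<xi> c x $ j * pd j (scalar (g c)) x)"

lemma frechet_scalar_curvature:
  assumes c: "c \<in> A" and x: "x \<in> chart_img c"
  shows "frechet_derivative (scalar_curvature A g \<circ> chart_inv c) (at x) (\<xi> c x) = d_scalar c x"
proof -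
  interpret metric_chart "g c" "chart_img c" by (rule metric_chart_at[OF c])
  have d: "scalar (g c) differentiable (at x)" by (rule smooth_on_D[OF smooth_scalar x])
  have "(scalar (g c) has_derivative (\<lambda>v. \<Sum>i\<in>UNIV. v $ i * pd i (scalar (g c)) x)) (at x)"
    by (rule pd_has_derivative[OF d])
  then have "(scalar_curvature A g \<circ> chart_inv c has_derivative (\<lambda>v. \<Sum>i\<in>UNIV. v $ i * pd i (scalar (g c)) x)) (at x)"
    by (rule has_derivative_transform_within_open[OF _ open_V x]) (simp add: scalar_curvature_chart[OF c])
  from frechet_derivative_at[OF this, symmetric] show ?thesis by (simp add: d_scalar_def)
qed

lemma d_scalar_chart_independent:
  assumes c: "c \<in> A" and d: "d \<in> A" and p: "p \<in> fst c \<inter> fst d"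
  shows "d_scalar c (snd c p) = d_scalar d (snd d p)"
proof -
  interpret C: chart_change "g c" "chart_img c" "g d" "chart_img d" "transition c d" "overlap c d"
    by (rule chart_change_at[OF c d])
  let ?x = "snd c p" and ?\<tau> = "transition c d"
  have x: "?x \<in> overlap c d" unfolding overlap_def by (rule imageI[OF p])
  have tr: "?\<tau> ?x = snd d p" using transition_chart[OF c] p by blast
  have xV: "?x \<in> chart_img c" "snd d p \<in> chart_img d" using p by auto
  have ds: "scalar (g d) differentiable (at (?\<tau> ?x))" unfolding tr by (rule smooth_on_D[OF C.M'.smooth_scalar xV(2)])
  have "pd j (scalar (g c)) ?x = (\<Sum>m\<in>UNIV. pd m (scalar (g d)) (snd d p) * jac_mat ?\<tau> ?x $ m $ j)" for j
  proof -
    have "pd j (scalar (g c)) ?x = pd j (\<lambda>y. scalar (g d) (?\<tau> y)) ?x"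
    proof (rule pd_cong[OF C.open_U x smooth_on_D[OF C.M.smooth_scalar xV(1)]])
      fix y assume "y \<in> overlap c d"
      then obtain q where q: "q \<in> fst c \<inter> fst d" "y = snd c q" unfolding overlap_def by (rule imageE)
      then have "?\<tau> y = snd d q" using transition_chart[OF c] by blast
      then show "scalar (g c) y = scalar (g d) (?\<tau> y)" using scalar_chart_independent[OF c d q(1)] q(2) by simp
    qed
    then show ?thesis by (simp add: pd_compose[OF C.diff_\<tau>[OF x] ds] tr jac_mat_def)
  qed
  then have "d_scalar c ?x = (\<Sum>j\<in>UNIV. \<Sum>m\<in>UNIV. pd m (scalar (g d)) (snd d p) * (jac_mat ?\<tau> ?x $ m $ j * \<xi> c ?x $ j))"
    by (simp add: d_scalar_def sum_distrib_left mult_ac)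
  also have "\<dots> = (\<Sum>m\<in>UNIV. pd m (scalar (g d)) (snd d p) * (jac_mat ?\<tau> ?x *v \<xi> c ?x) $ m)"
    by (subst sum.swap) (simp add: matrix_vector_mult_def sum_distrib_left)
  also have "jac_mat ?\<tau> ?x *v \<xi> c ?x = \<xi> d (snd d p)"
    using C1_fieldD(2)[OF \<xi>_field c d x] tr by simp
  finally show ?thesis by (simp add: d_scalar_def mult.commute)
qed

lemma lie_fun_eq:
  assumes c: "c \<in> A" "p \<in> fst c"
  shows "lie_fun A \<xi> (scalar_curvature A g) p = d_scalar c (snd c p)"
proof -
  let ?h = "\<lambda>c x. frechet_derivative (scalar_curvature A g \<circ> chart_inv c) (at x) (\<xi> c x)"
  have "lie_fun A \<xi> (scalar_curvature A g) p = ?h c (snd c p)"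
    unfolding lie_fun_def
  proof (rule glue_eq[where h = ?h, OF _ c])
    fix d e assume d: "d \<in> A" and e: "e \<in> A" and p: "p \<in> fst d \<inter> fst e"
    have "snd d p \<in> chart_img d" "snd e p \<in> chart_img e" using p by auto
    then show "?h d (snd d p) = ?h e (snd e p)"
      by (simp only: frechet_scalar_curvature[OF d] frechet_scalar_curvature[OF e] d_scalar_chart_independent[OF d e p])
  qed
  then show ?thesis using frechet_scalar_curvature[OF c(1) imageI[OF c(2)]] by simp
qed

lemma continuous_lie_fun: "continuous_on UNIV (lie_fun A \<xi> (scalar_curvature A g))"
proof (rule continuous_from_charts)
  fix c assume c: "c \<in> A"
  interpret E: ricci_expansion_chart "g c" "chart_img c" "\<xi> c" "\<lambda>x. l (chart_inv c x)" "\<phi> c" by (rule expansion_chart_at[OF c])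
  have "continuous_on (chart_img c) (d_scalar c)"
    unfolding d_scalar_def[abs_def]
    by (intro continuous_on_sum continuous_on_mult smooth_on_cont E.X_smooth[OF E.smooth_X] smooth_on_pd E.smooth_scalar)
  then show "continuous_on (chart_img c) (lie_fun A \<xi> (scalar_curvature A g) \<circ> chart_inv c)"
    by (rule continuous_on_eq) (simp add: lie_fun_eq[OF c] chart_inv_dom[OF c] chart_chart_inv[OF c])
qed

definition flux :: "('a, 'n) chart \<Rightarrow> real^'n \<Rightarrow> real^'n" where
  "flux c = strain_flux (g c) (\<xi> c)"

lemma flux_field: "C1_field flux"
  unfolding C1_field_def
proof (intro conjI ballI allI)
  fix c i assume c: "c \<in> A"
  interpret E: ricci_expansion_chart "g c" "chart_img c" "\<xi> c" "\<lambda>x. l (chart_inv c x)" "\<phi> c" by (rule expansion_chart_at[OF c])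
  have "smooth_on (chart_img c) (\<lambda>x. \<Sum>p\<in>UNIV. ginv (g c) i p x * (\<Sum>j\<in>UNIV. traceless_strain (g c) (\<xi> c) x $ p $ j * \<xi> c x $ j))"
    by (intro smooth_on_sum smooth_on_mult E.smooth_ginv E.smooth_traceless_strain E.X_smooth E.smooth_X E.open_V)
  then show "C_diff (Suc 0) (chart_img c) (\<lambda>x. flux c x $ i)"
    unfolding flux_def strain_flux_def matrix_vector_mult_def vec_lambda_beta ginv_def by (rule smooth_on_C_diff)
next
  fix c d p assume c: "c \<in> A" and d: "d \<in> A" and p: "p \<in> fst c \<inter> fst d"
  interpret C: chart_change "g c" "chart_img c" "g d" "chart_img d" "transition c d" "overlap c d"
    by (rule chart_change_at[OF c d])
  have x: "snd c p \<in> overlap c d" unfolding overlap_def by (rule imageI[OF p])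
  have tr: "transition c d (snd c p) = snd d p" using transition_chart[OF c] p by blast
  have "strain_flux (g d) (\<xi> d) (transition c d (snd c p)) = jac_mat (transition c d) (snd c p) *v strain_flux (g c) (\<xi> c) (snd c p)"
  proof (rule C.strain_flux_related[OF x])
    show "(\<lambda>y. \<xi> c y $ i) differentiable (at (snd c p))" for i
      by (rule C1_field_differentiable[OF \<xi>_field c]) (use p in auto)
    show "(\<lambda>y. \<xi> d y $ i) differentiable (at (transition c d (snd c p)))" for i
      unfolding tr by (rule C1_field_differentiable[OF \<xi>_field d]) (use p in auto)
  qed (rule C1_fieldD(2)[OF \<xi>_field c d])
  then show "flux d (snd d p) = jac_mat (transition c d) (snd c p) *v flux c (snd c p)"
    unfolding tr flux_def .
qed

lemma strain_energy_eq:
  assumes c: "c \<in> A" "p \<in> fst c"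
  shows "strain_energy (g c) (\<xi> c) (snd c p)
    = divergence flux p - (real CARD('n) - 2) / (2 * real CARD('n)) * lie_fun A \<xi> (scalar_curvature A g) p"
proof -
  interpret E: ricci_expansion_chart "g c" "chart_img c" "\<xi> c" "\<lambda>x. l (chart_inv c x)" "\<phi> c" by (rule expansion_chart_at[OF c(1)])
  let ?k = "(real CARD('n) - 2) / (2 * real CARD('n))"
  have x: "snd c p \<in> chart_img c" by (rule imageI[OF c(2)])
  have "delta (g c) (traceless_strain (g c) (\<xi> c)) (snd c p) \<bullet> \<xi> c (snd c p) = - (?k * d_scalar c (snd c p))"
    by (simp add: inner_vec_def E.delta_traceless_strain[OF x] d_scalar_def sum_distrib_left sum_negf mult_ac)
  then show ?thesis
    using E.divergence_strain_flux[OF E.smooth_X x]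
    by (simp add: divergence_eq[OF flux_field c] flux_def lie_fun_eq[OF c])
qed

text \<open>By \<open>strain_energy_eq\<close> the function \<open>|S|\<^sup>2 = div(S \<xi>) - k \<xi>(s)\<close> is globally defined and continuous; by the divergence
  theorem, \<open>k \<ge> 0\<close> and the sign of \<open>\<integral> \<xi>(s)\<close> its integral is at most \<open>0\<close>, so this nonnegative function vanishes.\<close>

theorem traceless_strain_vanishes:
  assumes n: "2 \<le> CARD('n)" and pos: "0 \<le> (\<integral>p. lie_fun A \<xi> (scalar_curvature A g) p \<partial>vol A g)"
    and c: "c \<in> A" and x: "x \<in> chart_img c"
  shows "traceless_strain (g c) (\<xi> c) x = 0"
proof -
  let ?k = "(real CARD('n) - 2) / (2 * real CARD('n))"
  let ?L = "lie_fun A \<xi> (scalar_curvature A g)"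
  define E where "E p = divergence flux p - ?k * ?L p" for p
  have k: "0 \<le> ?k" using n by simp
  have contE: "continuous_on UNIV E"
    unfolding E_def[abs_def]
    by (intro continuous_on_diff continuous_on_mult continuous_on_const continuous_divergence flux_field continuous_lie_fun)
  have E0: "0 \<le> E p" for p
  proof -
    obtain d where d: "d \<in> A" "p \<in> fst d" using chart_cover by blast
    interpret metric_chart "g d" "chart_img d" by (rule metric_chart_at[OF d(1)])
    show ?thesis
      unfolding E_def strain_energy_eq[OF d, symmetric] by (rule strain_energy_nonneg[OF imageI[OF d(2)]])
  qed
  have "(\<integral>p. E p \<partial>vol A g) = (\<integral>p. divergence flux p \<partial>vol A g) - ?k * (\<integral>p. ?L p \<partial>vol A g)"
    unfolding E_def
    by (simp add: integrable_continuous continuous_divergence[OF flux_field] continuous_lie_fun)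
  also have "\<dots> = - (?k * (\<integral>p. ?L p \<partial>vol A g))"
    by (simp add: divergence_theorem[OF flux_field])
  also have "\<dots> \<le> 0" using mult_nonneg_nonneg[OF k pos] by simp
  finally have "(\<integral>p. E p \<partial>vol A g) \<le> 0" .
  moreover have "0 \<le> (\<integral>p. E p \<partial>vol A g)" by (rule Bochner_Integration.integral_nonneg) (rule E0)
  ultimately have "(\<integral>p. E p \<partial>vol A g) = 0" by simp
  then have zero: "E p = 0" for p by (rule nonneg_integral_zero[OF contE E0])
  interpret metric_chart "g c" "chart_img c" by (rule metric_chart_at[OF c])
  have "strain_energy (g c) (\<xi> c) (snd c (chart_inv c x)) = 0"
    unfolding strain_energy_eq[OF c chart_inv_dom[OF c x]] using zero by (simp add: E_def)
  then show ?thesis using strain_energy_zero[OF x] by (simp add: chart_chart_inv[OF c x])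
qed

lemma harmonic_iff:
  "infinitesimal_harmonic A g \<xi> \<longleftrightarrow>
    (\<forall>c\<in>A. \<forall>x\<in>chart_img c. \<forall>j. (2 - real CARD('n)) * pd j (\<lambda>y. l (chart_inv c y)) x = 0)"
proof -
  have "smooth_vector_field A \<xi>" using exp by (simp add: ricci_expansion_def)
  note iff = infinitesimal_harmonic_iff[OF atlas metric this]
  show ?thesis
    unfolding iff
  proof (intro ball_cong refl)
    fix c x assume c: "c \<in> A" and x: "x \<in> chart_img c"
    interpret E: ricci_expansion_chart "g c" "chart_img c" "\<xi> c" "\<lambda>x. l (chart_inv c x)" "\<phi> c" by (rule expansion_chart_at[OF c])
    show "rough_laplacian (g c) (flat (g c) (\<xi> c)) x = \<xi> c x v* ricci (g c) x \<longleftrightarrow>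
        (\<forall>j. (2 - real CARD('n)) * pd j (\<lambda>y. l (chart_inv c y)) x = 0)"
      unfolding E.rough_laplacian_minus_ricci[OF x, symmetric] by (simp add: vec_eq_iff)
  qed
qed

theorem harmonic_iff_constant:
  assumes n: "3 \<le> CARD('n)"
  shows "infinitesimal_harmonic A g \<xi> \<longleftrightarrow> (\<exists>k. \<forall>p. l p = k)"
proof
  assume "infinitesimal_harmonic A g \<xi>"
  then have zero: "pd j (\<lambda>y. l (chart_inv c y)) x = 0" if "c \<in> A" "x \<in> chart_img c" for c x j
    using n that unfolding harmonic_iff by fastforce
  show "\<exists>k. \<forall>p. l p = k"
  proof (rule locally_constant_imp_constant[OF conn _ zero])
    fix c x assume c: "c \<in> A" and x: "x \<in> chart_img c"
    interpret E: ricci_expansion_chart "g c" "chart_img c" "\<xi> c" "\<lambda>x. l (chart_inv c x)" "\<phi> c" by (rule expansion_chart_at[OF c])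
    show "(\<lambda>y. l (chart_inv c y)) differentiable (at x)" by (rule smooth_on_D[OF E.smooth_f x])
  qed
next
  assume "\<exists>k. \<forall>p. l p = k"
  then obtain k where "l = (\<lambda>p. k)" by auto
  then show "infinitesimal_harmonic A g \<xi>" unfolding harmonic_iff by simp
qed

text \<open>If \<open>S = 0\<close> then \<open>k ds = - \<delta>S = 0\<close>, and \<open>k = (n - 2)/(2n)\<close> is not zero.\<close>

theorem scalar_curvature_constant:
  assumes n: "3 \<le> CARD('n)" and zero: "\<And>c x. c \<in> A \<Longrightarrow> x \<in> chart_img c \<Longrightarrow> traceless_strain (g c) (\<xi> c) x = 0"
  shows "\<exists>k. \<forall>p. scalar_curvature A g p = k"
proof (rule locally_constant_imp_constant[OF conn])
  fix c x j assume c: "c \<in> A" and x: "x \<in> chart_img c"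
  interpret E: ricci_expansion_chart "g c" "chart_img c" "\<xi> c" "\<lambda>x. l (chart_inv c x)" "\<phi> c" by (rule expansion_chart_at[OF c])
  have ds: "scalar (g c) differentiable (at x)" by (rule smooth_on_D[OF E.smooth_scalar x])
  show "(\<lambda>y. scalar_curvature A g (chart_inv c y)) differentiable (at x)"
    by (rule differentiable_cong[OF E.open_V x ds]) (simp add: scalar_curvature_chart[OF c])
  have "delta (g c) (\<lambda>y. 0) x = delta (g c) (traceless_strain (g c) (\<xi> c)) x"
    by (rule E.delta_cong[OF x]) (simp_all add: zero[OF c])
  moreover have "delta (g c) (\<lambda>y. 0) x $ j = 0" by (simp add: delta_def nabla_two_def)
  ultimately have "pd j (scalar (g c)) x = 0"
    using E.delta_traceless_strain[OF x, of j] n by simp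
  moreover have "pd j (scalar (g c)) x = pd j (\<lambda>y. scalar_curvature A g (chart_inv c y)) x"
    by (rule pd_cong[OF E.open_V x ds]) (simp add: scalar_curvature_chart[OF c])
  ultimately show "pd j (\<lambda>y. scalar_curvature A g (chart_inv c y)) x = 0" by simp
qed

end

theorem lemma4p1:
  fixes A :: "('a::t2_space, 'n::finite) chart set"
    and g \<phi> :: "('a, 'n) chart \<Rightarrow> real^'n \<Rightarrow> real^'n^'n"
    and \<xi> :: "('a, 'n) chart \<Rightarrow> real^'n \<Rightarrow> real^'n"
    and l :: "'a \<Rightarrow> real"
  assumes "smooth_atlas A"
    and "compact (UNIV :: 'a set)"
    and "connected (UNIV :: 'a set)"
    and "CARD('n) \<ge> 2"
    and "riemannian_metric A g"
    and "ricci_expansion A g \<xi> l \<phi>"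
  shows "(CARD('n) \<ge> 3 \<longrightarrow> (infinitesimal_harmonic A g \<xi> \<longleftrightarrow> (\<exists>k. \<forall>p. l p = k)))
    \<and> (CARD('n) = 2 \<longrightarrow> infinitesimal_harmonic A g \<xi>)
    \<and> (CARD('n) \<ge> 3 \<and> (\<integral>p. lie_fun A \<xi> (scalar_curvature A g) p \<partial>vol A g) \<ge> 0 \<longrightarrow>
        (\<exists>k. \<forall>p. scalar_curvature A g p = k)
        \<and> (\<forall>c\<in>A. \<forall>x\<in>chart_img c. \<phi> c x =
             ricci (g c) x - (scalar_curvature A g (chart_inv c x) / real CARD('n)) *\<^sub>R g c x)
        \<and> conformal_killing A g \<xi>)"
proof -
  interpret ricci_expansion_manifold A g \<xi> l \<phi>
    by unfold_locales (rule assms)+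
  show ?thesis
  proof (intro conjI impI ballI)
    show "infinitesimal_harmonic A g \<xi> \<longleftrightarrow> (\<exists>k. \<forall>p. l p = k)" if "CARD('n) \<ge> 3"
      by (rule harmonic_iff_constant[OF that])
    show "infinitesimal_harmonic A g \<xi>" if "CARD('n) = 2"
      unfolding harmonic_iff using that by simp
    assume *: "CARD('n) \<ge> 3 \<and> (\<integral>p. lie_fun A \<xi> (scalar_curvature A g) p \<partial>vol A g) \<ge> 0"
    have zero: "traceless_strain (g c) (\<xi> c) x = 0" if "c \<in> A" "x \<in> chart_img c" for c x
      by (rule traceless_strain_vanishes[OF assms(4) _ that]) (use * in simp)
    show "\<exists>k. \<forall>p. scalar_curvature A g p = k"
      by (rule scalar_curvature_constant[OF _ zero]) (use * in simp)
    show "conformal_killing A g \<xi>"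
      unfolding conformal_killing_def using zero by (simp add: traceless_strain_def)
    fix c x assume c: "c \<in> A" and x: "x \<in> chart_img c"
    interpret E: ricci_expansion_chart "g c" "chart_img c" "\<xi> c" "\<lambda>x. l (chart_inv c x)" "\<phi> c" by (rule expansion_chart_at[OF c])
    show "\<phi> c x = ricci (g c) x - (scalar_curvature A g (chart_inv c x) / real CARD('n)) *\<^sub>R g c x"
      using E.strain_eq[OF x] zero[OF c x] by (simp add: scalar_curvature_chart[OF c x])
  qed
qed

end
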